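(* Let $D\subset\mathbf{R}^2$ be a convex compact set with $0\in\operatorname{int}D$. There is a convex set $P\subset\mathbf{R}^2$ such that the following holds. Let $(P_n)_{n\ge3}$ be an arbitrary sequence of minimizers for $L_n(D)$, each translated so that $\min\{x:(x,y)\in P_n\}$ is reached at the origin. Then $$\lim_{n\to\infty}\operatorname{dist}(n^{-3/2}P_n,P)=0.$$
   Context: The (not necessarily symmetric) norm defined by $D$ is $\|x\|_D=\min\{t\ge0: x\in tD\}$. For $n\ge3$, $\mathcal{P}_n$ is the set of all convex lattice $n$-gons, i.e. convex polygons with exactly $n$ vertices, all in $\mathbf{Z}^2$. If $P\in\mathcal{P}_n$ has vertices $z_1,\dots,z_n$ in anticlockwise order (and $z_{n+1}=z_1$), its $D$-perimeter is $\operatorname{Per}_DP=\sum_{i=1}^n\|z_{i+1}-z_i\|_D$. Put $L_n(D)=\min\{\operatorname{Per}_DP:P\in\mathcal{P}_n\}$; a minimizer for $L_n(D)$ is a $P\in\mathcal{P}_n$ with $\operatorname{Per}_DP=L_n(D)$. $\operatorname{dist}$ is the Hausdorff distance. *)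

theory Defs
  imports "HOL-Analysis.Analysis"
begin

type_synonym point = "real \<times> real"

text \<open>For compact convex \<open>D\<close> with \<open>0 \<in> interior D\<close> the infimum is attained.\<close>

definition norm_wrt :: "point set \<Rightarrow> point \<Rightarrow> real" where
  "norm_wrt D x = Inf {t. 0 \<le> t \<and> x \<in> (\<lambda>d. t *\<^sub>R d) ` D}"

definition vertices :: "point set \<Rightarrow> point set" where
  "vertices P = {v. v extreme_point_of P}"

text \<open>For \<open>n \<ge> 3\<close> the convex hull of \<open>n\<close> extreme points in the plane has nonempty interior,
  so these are genuine polygons. The product \<open>\<int> \<times> \<int>\<close> is the integer lattice in the plane.\<close>

definition lattice_polygons :: "nat \<Rightarrow> point set set" where
  "lattice_polygons n = {P. polytope P \<and> card (vertices P) = n \<and> vertices P \<subseteq> \<int> \<times> \<int>}"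

definition cross2 :: "point \<Rightarrow> point \<Rightarrow> real" where
  "cross2 u v = fst u * snd v - snd u * fst v"

abbreviation cyc_next :: "point list \<Rightarrow> nat \<Rightarrow> point" where
  "cyc_next zs i \<equiv> zs ! (Suc i mod length zs)"

text \<open>A list enumerates the vertices in anticlockwise order iff, walking from each entry to the
  cyclically next one, all the other vertices lie strictly to the left.\<close>

definition anticlockwise_vertices :: "point set \<Rightarrow> point list \<Rightarrow> bool" where
  "anticlockwise_vertices P zs \<longleftrightarrow>
     distinct zs \<and> set zs = vertices P \<and>
     (\<forall>i<length zs. \<forall>w \<in> vertices P - {zs ! i, cyc_next zs i}.
        0 < cross2 (cyc_next zs i - zs ! i) (w - zs ! i))"

text \<open>For a convex polygon the anticlockwise enumeration is unique up to cyclic rotation, which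
  does not change the sum, so the choice made by \<open>SOME\<close> is immaterial.\<close>

definition perimeter :: "point set \<Rightarrow> point set \<Rightarrow> real" where
  "perimeter D P =
     (let zs = (SOME zs. anticlockwise_vertices P zs)
      in \<Sum>i<length zs. norm_wrt D (cyc_next zs i - zs ! i))"

text \<open>If \<open>n \<ge> 3\<close>, \<open>D\<close> is compact convex and \<open>0 \<in> interior D\<close>, the infimum is attained.\<close>

definition min_perimeter :: "nat \<Rightarrow> point set \<Rightarrow> real" where
  "min_perimeter n D = Inf (perimeter D ` lattice_polygons n)"

definition minimizer :: "nat \<Rightarrow> point set \<Rightarrow> point set \<Rightarrow> bool" where
  "minimizer n D P \<longleftrightarrow> P \<in> lattice_polygons n \<and> perimeter D P = min_perimeter n D"

text \<open>Extended values make this exact for arbitrary sets: in particular, a bounded nonempty set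
  is at distance \<open>\<infinity>\<close> from the empty set and from every unbounded set.\<close>

definition hausdorff_dist :: "'a::metric_space set \<Rightarrow> 'a set \<Rightarrow> ennreal" where
  "hausdorff_dist A B =
     max (SUP a\<in>A. INF b\<in>B. ennreal (dist a b)) (SUP b\<in>B. INF a\<in>A. ennreal (dist a b))"

end

theory Submission
  imports Defs "HOL-Real_Asymp.Real_Asymp"
begin

text \<open>A convex lattice \<open>n\<close>-gon is determined up to translation by its edges: \<open>n\<close> integer vectors with sum
  zero and distinct directions. For such a set the perimeter does not change when a linear functional is
  subtracted from the norm. Choose the functional so that the body \<open>{g \<le> 1}\<close> of the tilted gauge \<open>g\<close> has
  its centroid at the origin (it minimises a convex function of the functional). Then the primitive vectors
  with \<open>g \<le> T\<close>, for the \<open>T\<close> at which there are about \<open>n\<close> of them, have sum \<open>o(T\<^sup>3)\<close>, so a few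
  corrections of negligible length turn them into an admissible edge set. Hence every minimal edge set
  agrees with these vectors up to a total length \<open>o(T\<^sup>3)\<close>. Primitive vectors being equidistributed, the
  edges within any range of directions have, after scaling by \<open>n\<^bsup>-3/2\<^esup>\<close>, a sum converging uniformly to an
  integral over a sector of the body. These sums are the vertices of the polygon seen from its leftmost one.\<close>

section \<open>Pseudo-angles\<close>

text \<open>The tilt is forced by the closing condition: without it the primitive vectors of norm at
  most T can have a sum of order T^3, as large as the perimeter, and repairing it would not be
  negligible. For the tilted gauge the leading term of that sum is T^3 times the first moment of the
  body over \<open>zeta2\<close>, which centring makes zero. Minimality is used quantitatively.
  Relative to the level T, a vector z wrongly included or omitted costs |g z - T|, and the total
  cost is o(T^3). Vectors with |g z - T| < \<delta> T nearly escape this cost, but there are only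
  O(\<delta> T^2) of them, each of length O(T), so they vanish as \<delta> tends to 0. Since the
  minimizers form an arbitrary sequence, the estimates hold for all minimal edge sets and all
  direction bounds \<theta> at once. The exponent comes from n ~ \<beta> T^2 and vertex positions of
  size T^3; the limit is the hull of the curve \<beta>^(-3/2) J(\<theta>), and the tilt on which it
  is built is chosen from D alone.\<close>

definition lexpos :: "point \<Rightarrow> bool" where
  "lexpos z \<longleftrightarrow> 0 < fst z \<or> (fst z = 0 \<and> 0 < snd z)"

text \<open>A replacement for the angle measured anticlockwise from \<open>(0, - 1)\<close>, with values in \<open>{-1<..3}\<close> and
  \<open>pang (- z) = pang z \<plusminus> 2\<close>; the direction \<open>(0, - 1)\<close> itself gets the value \<open>3\<close>, so it comes last.
  The value at the origin is \<open>2\<close> because of \<open>0 / 0 = 0\<close>.\<close>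

definition pang :: "point \<Rightarrow> real" where
  "pang z = (if lexpos z then snd z / (\<bar>fst z\<bar> + \<bar>snd z\<bar>) else 2 - snd z / (\<bar>fst z\<bar> + \<bar>snd z\<bar>))"

lemma lexpos_uminus: "z \<noteq> 0 \<Longrightarrow> lexpos (- z) \<longleftrightarrow> \<not> lexpos z"
  by (cases z) (auto simp: lexpos_def zero_prod_def)

lemma lexpos_0 [simp]: "\<not> lexpos 0"
  by (simp add: lexpos_def)

lemma lexpos_add: "lexpos a \<Longrightarrow> lexpos b \<Longrightarrow> lexpos (a + b)"
  by (auto simp: lexpos_def)

lemma lexpos_scaleR: "0 < c \<Longrightarrow> lexpos (c *\<^sub>R z) \<longleftrightarrow> lexpos z"
  by (auto simp: lexpos_def zero_less_mult_iff)

lemma pang_scaleR: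
  assumes "0 < c" shows "pang (c *\<^sub>R z) = pang z"
proof -
  have "c * snd z / (\<bar>c * fst z\<bar> + \<bar>c * snd z\<bar>) = snd z / (\<bar>fst z\<bar> + \<bar>snd z\<bar>)"
    using assms by (simp add: abs_mult flip: distrib_left)
  then show ?thesis
    using assms by (simp add: pang_def lexpos_scaleR)
qed

lemma pang_lexpos: assumes "lexpos z" shows "- 1 < pang z" "pang z \<le> 1"
  using assms unfolding pang_def by (auto simp: lexpos_def divide_simps)

lemma pang_uminus:
  assumes "z \<noteq> 0" "\<not> lexpos z" shows "pang z = pang (- z) + 2"
  using assms by (simp add: pang_def lexpos_uminus)

lemma pang_not_lexpos: assumes "\<not> lexpos z" shows "1 < pang z" "pang z \<le> 3"
proof -
  have "1 < pang z \<and> pang z \<le> 3"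
  proof (cases "z = 0")
    case False
    then show ?thesis using assms pang_uminus[of z] pang_lexpos[of "- z"] lexpos_uminus[of z] by auto
  qed (simp add: pang_def)
  then show "1 < pang z" "pang z \<le> 3" by auto
qed

lemma pang_bounds: "- 1 < pang z" "pang z \<le> 3"
  using pang_lexpos[of z] pang_not_lexpos[of z] by linarith+

lemma lexpos_iff_pang: "lexpos z \<longleftrightarrow> pang z \<le> 1"
  using pang_lexpos[of z] pang_not_lexpos[of z] by linarith

lemma cross2_simps:
  "cross2 (a + b) c = cross2 a c + cross2 b c" "cross2 c (a + b) = cross2 c a + cross2 c b"
  "cross2 (a - b) c = cross2 a c - cross2 b c" "cross2 c (a - b) = cross2 c a - cross2 c b"
  "cross2 (- a) c = - cross2 a c" "cross2 c (- a) = - cross2 c a"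
  "cross2 (r *\<^sub>R a) c = r * cross2 a c" "cross2 c (r *\<^sub>R a) = r * cross2 c a"
  "cross2 a a = 0" "cross2 0 a = 0" "cross2 a 0 = 0"
  by (simp_all add: cross2_def algebra_simps)

lemma cross2_commute: "cross2 a b = - cross2 b a"
  by (simp add: cross2_def)

lemma cross2_sum: "cross2 a (\<Sum>i\<in>I. f i) = (\<Sum>i\<in>I. cross2 a (f i))"
  by (induction I rule: infinite_finite_induct) (auto simp: cross2_simps)

lemma cross2_pos_lexpos:
  assumes "lexpos a" "lexpos b"
  shows "0 < cross2 a b \<longleftrightarrow> pang a < pang b"
proof -
  obtain a1 a2 b1 b2 where ab: "a = (a1, a2)" "b = (b1, b2)" by (cases a; cases b)
  have pos: "0 \<le> a1" "0 \<le> b1" "0 < a1 + \<bar>a2\<bar>" "0 < b1 + \<bar>b2\<bar>" "a1 = 0 \<Longrightarrow> 0 < a2" "b1 = 0 \<Longrightarrow> 0 < b2"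
    using assms ab by (auto simp: lexpos_def)
  have "pang a < pang b \<longleftrightarrow> a2 * (b1 + \<bar>b2\<bar>) < b2 * (a1 + \<bar>a2\<bar>)"
    using assms pos by (simp add: pang_def ab divide_simps mult.commute)
  \<comment> \<open>For second coordinates of equal sign the terms with absolute values cancel; for
    opposite signs both inequalities are decided by the signs alone.\<close>
  also have "\<dots> \<longleftrightarrow> 0 < a1 * b2 - a2 * b1"
  proof (cases "0 \<le> a2 \<and> 0 \<le> b2 \<or> a2 \<le> 0 \<and> b2 \<le> 0")
    case True
    then show ?thesis by (auto simp: algebra_simps)
  next
    case False
    then consider "a2 < 0" "0 < b2" | "0 < a2" "b2 < 0" by linarith
    then show ?thesis
    proof cases
      case 1
      have "0 < a1 * b2" "0 \<le> - a2 * b1" "a2 * b2 < 0"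
        using 1 pos by (auto intro!: mult_pos_pos mult_nonneg_nonneg mult_neg_pos simp: mult_le_0_iff less_le)
      then show ?thesis using 1 by (auto simp: algebra_simps)
    next
      case 2
      have "0 < a2 * b1" "a1 * b2 \<le> 0" "a2 * b2 < 0"
        using 2 pos by (auto intro!: mult_pos_pos mult_pos_neg simp: mult_le_0_iff less_le)
      then show ?thesis using 2 by (auto simp: algebra_simps)
    qed
  qed
  finally show ?thesis by (simp add: ab cross2_def)
qed

text \<open>A half turn adds 2 to \<open>pang\<close>, so the directions strictly to the left of
  \<open>a\<close> fill the window between \<open>pang a\<close> and \<open>pang a + 2\<close>. It
  does not wrap around, because \<open>pang a\<close> is at most 1.\<close>

lemma cross2_pos_iff:
  assumes "lexpos a" "b \<noteq> 0"
  shows "0 < cross2 a b \<longleftrightarrow> pang a < pang b \<and> pang b < pang a + 2"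
proof (cases "lexpos b")
  case True
  then show ?thesis using cross2_pos_lexpos[of a b] assms pang_lexpos[of a] pang_lexpos[of b] by auto
next
  case False
  then have "lexpos (- b)" using assms lexpos_uminus by simp
  have "0 < cross2 a b \<longleftrightarrow> 0 < cross2 (- b) a" by (simp add: cross2_def mult.commute)
  also have "\<dots> \<longleftrightarrow> pang (- b) < pang a" using cross2_pos_lexpos \<open>lexpos (- b)\<close> assms by blast
  finally show ?thesis
    using pang_uminus[OF assms(2) False] assms pang_lexpos[of a] pang_not_lexpos[OF False] by linarith
qed

lemma cross2_neg_iff:
  assumes "lexpos a" "b \<noteq> 0"
  shows "cross2 a b < 0 \<longleftrightarrow> pang b < pang a \<or> pang a + 2 < pang b"
proof (cases "lexpos b")
  case True
  then show ?thesis using cross2_pos_lexpos[of b a] assms pang_lexpos[of a] pang_lexpos[of b] cross2_commute[of a b] by auto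
next
  case False
  then have "lexpos (- b)" using assms lexpos_uminus by simp
  have "cross2 a b < 0 \<longleftrightarrow> 0 < cross2 a (- b)" by (simp add: cross2_def)
  also have "\<dots> \<longleftrightarrow> pang a < pang (- b)" using cross2_pos_lexpos \<open>lexpos (- b)\<close> assms by blast
  finally show ?thesis
    using pang_uminus[OF assms(2) False] assms pang_lexpos[of a] pang_not_lexpos[OF False] by auto
qed

lemma cross2_eq_0_parallel:
  assumes "a \<noteq> 0" "cross2 a b = 0" obtains c where "b = c *\<^sub>R a"
proof -
  obtain a1 a2 b1 b2 where ab: "a = (a1, a2)" "b = (b1, b2)" by (cases a; cases b)
  have *: "a1 * b2 = a2 * b1" using assms ab by (simp add: cross2_def)
  show ?thesis
  proof (cases "a1 = 0")
    case True
    then have "b = (b2 / a2) *\<^sub>R a" using * assms ab by (auto simp: zero_prod_def)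
    then show ?thesis by (rule that)
  next
    case False
    then have "b = (b1 / a1) *\<^sub>R a" using * assms ab by (auto simp: field_simps)
    then show ?thesis by (rule that)
  qed
qed

text \<open>After replacing \<open>a\<close> by \<open>- a\<close> if necessary, equal values
  exclude both signs of the cross product. The factor is positive because \<open>pang\<close> also
  decides \<open>lexpos\<close>.\<close>

lemma pang_eq_parallel:
  assumes "a \<noteq> 0" "b \<noteq> 0" "pang a = pang b" obtains c where "0 < c" "b = c *\<^sub>R a"
proof -
  have lp: "lexpos a \<longleftrightarrow> lexpos b" using assms by (simp add: lexpos_iff_pang)
  have "cross2 a b = 0"
  proof (cases "lexpos a")
    case True
    then show ?thesis using cross2_pos_iff[of a b] cross2_neg_iff[of a b] assms by linarith
  next
    case False
    then have "lexpos (- a)" "pang a = pang (- a) + 2"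
      using assms lexpos_uminus pang_uminus by auto
    then have "cross2 (- a) b = 0"
      using cross2_pos_iff[of "- a" b] cross2_neg_iff[of "- a" b] assms by linarith
    then show ?thesis by (simp add: cross2_simps)
  qed
  then obtain c where c: "b = c *\<^sub>R a" using cross2_eq_0_parallel assms by metis
  have "0 < c"
  proof (rule ccontr)
    assume "\<not> 0 < c"
    moreover have "c \<noteq> 0" using c assms by auto
    ultimately have "c < 0" by simp
    then have "lexpos b \<longleftrightarrow> lexpos (- a)" using lexpos_scaleR[of "- c" "- a"] c by simp
    then show False using lp lexpos_uminus assms by blast
  qed
  then show ?thesis using c that by blast
qed

section \<open>Convex lattice polygons and their edge sets\<close>

lemma exists_sorted_wrt_key:
  fixes f :: "'a \<Rightarrow> real"
  assumes "finite S" "inj_on f S"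
  obtains xs where "distinct xs" "set xs = S" "sorted_wrt (\<lambda>a b. f a < f b) xs"
proof -
  define ys where "ys = sorted_list_of_set (f ` S)"
  have ys: "distinct ys" "set ys = f ` S" "sorted_wrt (<) ys"
    using assms by (auto simp: ys_def)
  define xs where "xs = map (the_inv_into S f) ys"
  have f: "f (the_inv_into S f y) = y" if "y \<in> set ys" for y
    using f_the_inv_into_f[OF assms(2)] that ys by auto
  have "map f xs = ys"
    using f by (auto simp: xs_def o_def intro: map_idI)
  then have "sorted_wrt (\<lambda>a b. f a < f b) xs" "distinct xs"
    using ys sorted_wrt_map[of "(<)" f xs] distinct_map[of f xs] by auto
  moreover have "set xs = S"
    using ys assms by (simp add: xs_def image_image the_inv_into_f_f)
  ultimately show ?thesis using that by blast
qed

text \<open>The cyclic successor in terms of the vertex set alone, so that it can be compared across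
  enumerations. The case \<open>w = v\<close> matches a one-element list, whose entry is its own
  successor.\<close>

definition is_next :: "point set \<Rightarrow> point \<Rightarrow> point \<Rightarrow> bool" where
  "is_next V v w \<longleftrightarrow> w \<in> V \<and> (w = v \<longrightarrow> V = {v}) \<and> (\<forall>x \<in> V - {v, w}. 0 < cross2 (w - v) (x - v))"

lemma is_next_unique:
  assumes "is_next V v w" "is_next V v w'" shows "w = w'"
proof (rule ccontr)
  assume "w \<noteq> w'"
  then have "w \<noteq> v" "w' \<noteq> v" using assms by (auto simp: is_next_def)
  then have "0 < cross2 (w - v) (w' - v)" "0 < cross2 (w' - v) (w - v)"
    using assms \<open>w \<noteq> w'\<close> by (auto simp: is_next_def)
  then show False using cross2_commute[of "w - v"] by simp
qed

lemma Suc_mod_neq: "2 \<le> n \<Longrightarrow> i < n \<Longrightarrow> Suc i mod n \<noteq> i"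
  by (metis One_nat_def Suc_n_not_le_n mod_Suc mod_less n_not_Suc_n numeral_2_eq_2)

lemma is_next_cyc_next:
  assumes "anticlockwise_vertices P zs" "i < length zs"
  shows "is_next (vertices P) (zs ! i) (cyc_next zs i)"
proof -
  have s: "distinct zs" "set zs = vertices P" using assms by (auto simp: anticlockwise_vertices_def)
  have m: "Suc i mod length zs < length zs" using assms by (intro mod_less_divisor) auto
  have "cyc_next zs i = zs ! i \<Longrightarrow> vertices P = {zs ! i}"
  proof -
    assume "cyc_next zs i = zs ! i"
    then have "Suc i mod length zs = i" using nth_eq_iff_index_eq[OF s(1) m assms(2)] by simp
    then have "length zs = 1" using Suc_mod_neq[of "length zs" i] assms(2) by fastforce
    then show ?thesis using s assms by (cases zs) auto
  qed
  then show ?thesis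
    using assms s m nth_mem[OF m] unfolding is_next_def anticlockwise_vertices_def by blast
qed

text \<open>For every enumeration the sum equals one over the vertices and their
  \<open>is_next\<close> successors, which does not mention the enumeration; hence the value chosen
  by \<open>SOME\<close> agrees with the value for \<open>zs\<close>.\<close>

lemma perimeter_eq:
  assumes zs: "anticlockwise_vertices P zs"
  shows "perimeter D P = (\<Sum>i<length zs. norm_wrt D (cyc_next zs i - zs ! i))"
proof -
  have *: "(\<Sum>i<length xs. norm_wrt D (cyc_next xs i - xs ! i))
      = (\<Sum>v\<in>vertices P. norm_wrt D ((THE w. is_next (vertices P) v w) - v))"
    if xs: "anticlockwise_vertices P xs" for xs
  proof -
    have b: "bij_betw ((!) xs) {..<length xs} (vertices P)"
      using xs by (intro bij_betw_nth) (auto simp: anticlockwise_vertices_def)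
    have "(\<Sum>v\<in>vertices P. norm_wrt D ((THE w. is_next (vertices P) v w) - v))
       = (\<Sum>i<length xs. norm_wrt D ((THE w. is_next (vertices P) (xs ! i) w) - xs ! i))"
      by (rule sum.reindex_bij_betw[OF b, symmetric])
    also have "\<dots> = (\<Sum>i<length xs. norm_wrt D (cyc_next xs i - xs ! i))"
    proof (rule sum.cong[OF refl])
      fix i assume "i \<in> {..<length xs}"
      then have "is_next (vertices P) (xs ! i) (cyc_next xs i)"
        using is_next_cyc_next[OF xs] by simp
      then have "(THE w. is_next (vertices P) (xs ! i) w) = cyc_next xs i"
        using is_next_unique by blast
      then show "norm_wrt D ((THE w. is_next (vertices P) (xs ! i) w) - xs ! i)
          = norm_wrt D (cyc_next xs i - xs ! i)" by simp
    qed
    finally show ?thesis by simp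
  qed
  show ?thesis
    unfolding perimeter_def Let_def
    using *[OF zs] *[OF someI[of "anticlockwise_vertices P", OF zs]] by simp
qed

section \<open>Anticlockwise enumeration starting at the lowest leftmost vertex\<close>

lemma exists_lexmin:
  assumes "finite V" "V \<noteq> {}"
  shows "\<exists>u\<in>V. \<forall>v\<in>V - {u}. lexpos (v - u)"
  using assms
proof (induction rule: finite_ne_induct)
  case (insert x F)
  then obtain u where u: "u \<in> F" "\<And>v. v \<in> F - {u} \<Longrightarrow> lexpos (v - u)" by blast
  show ?case
  proof (cases "lexpos (x - u)")
    case True
    then show ?thesis using u by blast
  next
    case False
    then have 1: "lexpos (u - x)"
      using lexpos_uminus[of "x - u"] insert u by auto
    have "lexpos (v - x)" if "v \<in> F" for v
    proof (cases "v = u")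
      case True
      then show ?thesis using 1 by simp
    next
      case False
      then show ?thesis using lexpos_add[OF u(2)[of v] 1] that by simp
    qed
    then show ?thesis by blast
  qed
qed auto

text \<open>Removing an extreme point leaves a convex set, which then contains the whole triangle.
  Taking \<open>c = a\<close> gives the case of a segment.\<close>

lemma extreme_point_not_in_triangle:
  assumes "b extreme_point_of P" "convex P" "u \<in> P" "a \<in> P" "c \<in> P" "b \<notin> {u, a, c}"
    and "0 \<le> \<alpha>" "0 \<le> \<beta>" "\<alpha> + \<beta> \<le> 1"
  shows "b - u \<noteq> \<alpha> *\<^sub>R (a - u) + \<beta> *\<^sub>R (c - u)"
proof
  assume "b - u = \<alpha> *\<^sub>R (a - u) + \<beta> *\<^sub>R (c - u)"
  then have eq: "b = (1 - \<alpha> - \<beta>) *\<^sub>R u + \<alpha> *\<^sub>R a + \<beta> *\<^sub>R c"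
    by (simp add: algebra_simps)
  have cv: "convex (P - {b})" using assms extreme_point_of_stillconvex by blast
  have "b \<in> convex hull {u, a, c}"
    unfolding convex_hull_3 using eq assms by force
  also have "\<dots> \<subseteq> P - {b}" using cv assms by (intro hull_minimal) auto
  finally show False by simp
qed

lemma vertices_polytope:
  assumes "polytope P" shows "finite (vertices P)" "P = convex hull (vertices P)"
proof -
  obtain S where S: "finite S" "P = convex hull S" using assms polytope_def by blast
  show "finite (vertices P)"
    using S extreme_points_of_convex_hull[of S] finite_subset unfolding vertices_def by blast
  show "P = convex hull (vertices P)"
    unfolding vertices_def by (rule Krein_Milman_Minkowski) (use S in \<open>auto simp: finite_imp_compact_convex_hull\<close>)
qed

lemma cross2_solve:
  assumes "cross2 a c \<noteq> 0"
  shows "b = (cross2 b c / cross2 a c) *\<^sub>R a + (cross2 a b / cross2 a c) *\<^sub>R c"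
proof -
  obtain a1 a2 b1 b2 c1 c2 where ab: "a = (a1, a2)" "b = (b1, b2)" "c = (c1, c2)"
    by (cases a; cases b; cases c)
  show ?thesis using assms
    by (simp add: ab cross2_def divide_simps) (simp add: algebra_simps)
qed

text \<open>Seen from the lexicographic minimum \<open>u\<close> all other vertices lie in the half
  plane of \<open>lexpos\<close> directions, so sorting them by \<open>pang\<close> around
  \<open>u\<close> gives the order.\<close>

lemma exists_anticlockwise_vertices:
  assumes "polytope P" "3 \<le> card (vertices P)"
  obtains zs where "anticlockwise_vertices P zs" 
    "\<And>i. 0 < i \<Longrightarrow> i < length zs \<Longrightarrow> lexpos (zs ! i - zs ! 0)"
proof -
  let ?V = "vertices P"
  have V: "finite ?V" "P = convex hull ?V" "convex P"
    using vertices_polytope[OF assms(1)] polytope_imp_convex[OF assms(1)] by auto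
  have VP: "v \<in> P" "v extreme_point_of P" if "v \<in> ?V" for v
    using that by (auto simp: vertices_def extreme_point_of_def)
  have "?V \<noteq> {}" using assms by auto
  then obtain u where u: "u \<in> ?V" "\<And>v. v \<in> ?V - {u} \<Longrightarrow> lexpos (v - u)"
    using exists_lexmin[OF V(1)] by blast
  \<comment> \<open>Of two vertices on one ray from \<open>u\<close>, the nearer would lie on the
    segment from \<open>u\<close> to the farther.\<close>
  have inj: "inj_on (\<lambda>v. pang (v - u)) (?V - {u})"
  proof (rule inj_onI, rule ccontr)
    fix a b assume ab: "a \<in> ?V - {u}" "b \<in> ?V - {u}" "pang (a - u) = pang (b - u)" "a \<noteq> b"
    obtain c where c: "0 < c" "b - u = c *\<^sub>R (a - u)"
      by (rule pang_eq_parallel[of "a - u" "b - u"]) (use ab in auto)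
    show False
    proof (cases "c \<le> 1")
      case True
      then show False
        using extreme_point_not_in_triangle[of b P u a a c 0] ab u VP V c by auto
    next
      case False
      have "a - u = (1 / c) *\<^sub>R (b - u)" using c by simp
      then show False
        using extreme_point_not_in_triangle[of a P u b b "1/c" 0] ab u VP V c False by auto
    qed
  qed
  obtain xs where xs: "distinct xs" "set xs = ?V - {u}" 
    "sorted_wrt (\<lambda>a b. pang (a - u) < pang (b - u)) xs"
    by (rule exists_sorted_wrt_key[OF _ inj]) (use V in auto)
  define zs where "zs = u # xs"
  define n where "n = length zs"
  define p where "p i = zs ! i - u" for i
  have zs: "distinct zs" "set zs = ?V" "zs ! 0 = u" using xs u by (auto simp: zs_def)
  have n: "3 \<le> n" using assms distinct_card[OF zs(1)] zs n_def by simp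
  have p0: "p 0 = 0" using zs by (simp add: p_def)
  have zsV: "zs ! i \<in> ?V" if "i < n" for i using that n_def zs nth_mem by metis
  have zs_u: "zs ! i \<noteq> u" if "0 < i" "i < n" for i
    using that nth_eq_iff_index_eq[OF zs(1), of i 0] zs(3) n_def by (metis less_trans less_irrefl)
  have lp: "lexpos (p i)" if "0 < i" "i < n" for i
    using u(2) zsV zs_u that p_def by simp
  have cr: "0 < cross2 (p i) (p j)" if "0 < i" "i < j" "j < n" for i j
  proof -
    have "pang (p i) < pang (p j)"
      using that sorted_wrt_nth_less[OF xs(3), of "i - 1" "j - 1"] by (simp add: p_def zs_def n_def nth_Cons')
    then show ?thesis using lp[of i] lp[of j] that cross2_pos_lexpos by simp
  qed
  \<comment> \<open>If this turn were not to the left, Cramer's rule would express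
    \<open>p j\<close> by \<open>p i\<close> and \<open>p k\<close> with nonnegative coefficients of
    sum at most 1, putting the vertex into the triangle with corner \<open>u\<close>.\<close>
  have T: "0 < cross2 (p j - p i) (p k - p i)" if ijk: "0 < i" "i < j" "j < k" "k < n" for i j k
  proof (rule ccontr)
    assume "\<not> ?thesis"
    then have le: "cross2 (p j) (p k) + cross2 (p i) (p j) \<le> cross2 (p i) (p k)"
      using cross2_commute[of "p j" "p i"] by (simp add: cross2_simps)
    have pos: "0 < cross2 (p i) (p j)" "0 < cross2 (p j) (p k)" "0 < cross2 (p i) (p k)"
      using cr ijk by auto
    let ?\<alpha> = "cross2 (p j) (p k) / cross2 (p i) (p k)" and ?\<beta> = "cross2 (p i) (p j) / cross2 (p i) (p k)"
    have "p j = ?\<alpha> *\<^sub>R p i + ?\<beta> *\<^sub>R p k" using cross2_solve[of "p i" "p k" "p j"] pos by simp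
    moreover have "?\<alpha> + ?\<beta> \<le> 1" using le pos by (simp add: add_divide_distrib[symmetric])
    moreover have "zs ! j \<notin> {u, zs ! i, zs ! k}"
      using ijk zs_u[of j] nth_eq_iff_index_eq[OF zs(1)] n_def by auto
    ultimately show False
      using extreme_point_not_in_triangle[of "zs ! j" P u "zs ! i" "zs ! k" ?\<alpha> ?\<beta>] pos VP zsV u V ijk
      by (auto simp: p_def)
  qed
  have main: "0 < cross2 (cyc_next zs i - zs ! i) (zs ! k - zs ! i)"
    if ik: "i < n" "k < n" "k \<noteq> i" "k \<noteq> Suc i mod n" for i k
  proof -
    have eq: "cyc_next zs i - zs ! i = p (Suc i mod n) - p i" "zs ! k - zs ! i = p k - p i"
      by (simp_all add: p_def n_def)
    consider "i = n - 1" | "i = 0" "Suc i < n" | "0 < i" "Suc i < n" using ik n by linarith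
    then show ?thesis
    proof cases
      case 1
      then have "Suc i mod n = 0" using n by simp
      then show ?thesis
        using cr[of k i] that 1 n cross2_commute[of "p k" "p i"] unfolding eq by (simp add: p0 cross2_simps)
    next
      case 2
      then show ?thesis using that cr[of 1 k] unfolding eq by (simp add: p0)
    next
      case 3
      then have m: "Suc i mod n = Suc i" by simp
      consider "k = 0" | "0 < k" "k < i" | "Suc i < k" using ik m by linarith
      then show ?thesis
      proof cases
        case 1
        then show ?thesis using cr[of i "Suc i"] 3 cross2_commute[of "p i" "p (Suc i)"] unfolding eq m
          by (simp add: p0 cross2_simps)
      next
        case 2
        then show ?thesis using T[of k i "Suc i"] 3 
            cross2_commute[of "p i" "p (Suc i)"] cross2_commute[of "p k" "p (Suc i)"] cross2_commute[of "p k" "p i"]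
          unfolding eq m by (simp add: cross2_simps)
      next
        case k: 3
        then show ?thesis using T[of i "Suc i" k] 3 that unfolding eq m by simp
      qed
    qed
  qed
  have "anticlockwise_vertices P zs"
    unfolding anticlockwise_vertices_def
  proof (intro conjI allI impI ballI)
    fix i w assume i: "i < length zs" and w: "w \<in> ?V - {zs ! i, cyc_next zs i}"
    then obtain k where "k < n" "w = zs ! k" using zs n_def by (metis DiffD1 in_set_conv_nth)
    then show "0 < cross2 (cyc_next zs i - zs ! i) (w - zs ! i)"
      using main[of i k] i w n_def by auto
  qed (use zs in auto)
  moreover have "lexpos (zs ! i - zs ! 0)" if "0 < i" "i < length zs" for i
    using lp[of i] that p_def n_def zs by simp
  ultimately show ?thesis using that by blast
qed

section \<open>Correspondence between convex lattice polygons and edge sets\<close>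

definition edge_set :: "point set \<Rightarrow> bool" where
  "edge_set E \<longleftrightarrow> finite E \<and> E \<subseteq> \<int> \<times> \<int> - {0} \<and> inj_on pang E \<and> \<Sum>E = 0"

text \<open>From the lowest leftmost vertex the edges appear with increasing \<open>pang\<close>, so
  the vertices are the sums of all edges up to a direction. Indexing by every real \<theta>, with
  repetitions, gives a family whose index set does not depend on n and can be compared with a limit
  curve.\<close>

lemma polygon_edges:
  assumes P: "P \<in> lattice_polygons n" and n: "3 \<le> n"
  obtains u E where "edge_set E" "card E = n" "perimeter D P = (\<Sum>e\<in>E. norm_wrt D e)"
    "vertices P = range (\<lambda>\<theta>. u + \<Sum>{e \<in> E. pang e \<le> \<theta>})"
proof -
  have P: "polytope P" "card (vertices P) = n" "vertices P \<subseteq> \<int> \<times> \<int>"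
    using P by (auto simp: lattice_polygons_def)
  obtain zs where ac: "anticlockwise_vertices P zs" 
    and lex: "\<And>i. 0 < i \<Longrightarrow> i < length zs \<Longrightarrow> lexpos (zs ! i - zs ! 0)"
    by (rule exists_anticlockwise_vertices[of P]) (use P n in auto)
  have zs: "distinct zs" "set zs = vertices P" using ac by (auto simp: anticlockwise_vertices_def)
  have len: "length zs = n" using distinct_card[OF zs(1)] zs P by simp
  define z where "z i = zs ! (i mod n)" for i
  define e where "e i = z (Suc i) - z i" for i
  have zV: "z i \<in> vertices P" for i
    using nth_mem[of "i mod n" zs] zs(2) len n by (simp add: z_def)
  have z_eq: "z i = z j \<longleftrightarrow> i mod n = j mod n" for i j
    using nth_eq_iff_index_eq[OF zs(1), of "i mod n" "j mod n"] len n by (simp add: z_def)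
  have left: "0 < cross2 (e i) (z k - z i)" if "k mod n \<noteq> i mod n" "k mod n \<noteq> Suc i mod n" for i k
  proof -
    have "i mod n < n" using n by simp
    moreover have "z k \<in> vertices P - {z i, z (Suc i)}" using zV that z_eq by auto
    moreover have "cyc_next zs (i mod n) = z (Suc i)" "zs ! (i mod n) = z i" 
      by (simp_all add: z_def len mod_Suc_eq)
    ultimately show ?thesis using ac len unfolding anticlockwise_vertices_def e_def by metis
  qed
  have e0: "e i \<noteq> 0" if "i < n" for i
    using that n z_eq[of "Suc i" i] Suc_mod_neq[of n i] by (auto simp: e_def)
  have cr: "0 < cross2 (e i) (e (Suc i))" if "Suc i < n" for i
  proof -
    have "Suc (Suc i) mod n \<noteq> i mod n" 
      using that n by (cases "Suc (Suc i) = n") auto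
    moreover have "Suc (Suc i) mod n \<noteq> Suc i mod n" 
      using that n Suc_mod_neq[of n "Suc i"] by auto
    ultimately have "0 < cross2 (e i) (z (Suc (Suc i)) - z i)" using left by blast
    also have "z (Suc (Suc i)) - z i = e (Suc i) + e i" by (simp add: e_def)
    finally show ?thesis by (simp add: cross2_simps)
  qed
  \<comment> \<open>Otherwise the walk would pass the direction (0, -1) before its end. The vector
    \<open>w\<close> back to the start is not \<open>lexpos\<close> and is not to the right of
    either edge; this confines \<open>pang w\<close> to a window that the left turn between the two
    edges makes empty.\<close>
  have nowrap: "lexpos (e i)" if "lexpos (e (Suc i))" "Suc i < n" for i
  proof (rule ccontr)
    assume "\<not> lexpos (e i)"
    then have f: "lexpos (- e i)" using lexpos_uminus e0 that by simp
    define w where "w = z 0 - z (Suc i)"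
    have "lexpos (- w)" using lex[of "Suc i"] that len by (simp add: w_def z_def)
    then have "w \<noteq> 0" by auto
    then have w: "w \<noteq> 0" "\<not> lexpos w" using lexpos_uminus[of w] \<open>lexpos (- w)\<close> by auto
    have "0 \<le> cross2 (e i) w"
    proof -
      have "w = (z 0 - z i) - e i" by (simp add: w_def e_def)
      moreover have "0 \<le> cross2 (e i) (z 0 - z i)"
        using left[of 0 i] that by (cases "i = 0") (auto simp: cross2_simps intro: less_imp_le)
      ultimately show ?thesis by (simp add: cross2_simps)
    qed
    then have "\<not> 0 < cross2 (- e i) w" by (simp add: cross2_simps)
    then have 1: "pang (- e i) + 2 \<le> pang w"
      using cross2_pos_iff[OF f w(1)] pang_lexpos[OF f] pang_not_lexpos[OF w(2)] by linarith
    have "0 \<le> cross2 (e (Suc i)) w"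
    proof (cases "Suc (Suc i) mod n = 0")
      case True
      then have "w = e (Suc i)" using z_eq[of "Suc (Suc i)" 0] by (simp add: w_def e_def)
      then show ?thesis by (simp add: cross2_simps)
    next
      case False
      then show ?thesis using left[of 0 "Suc i"] that by (simp add: w_def less_imp_le)
    qed
    then have 2: "pang w \<le> pang (e (Suc i)) + 2"
      using cross2_neg_iff[OF that(1) w(1)] by linarith
    have "cross2 (- e i) (e (Suc i)) < 0" using cr that by (simp add: cross2_simps)
    then show False
      using cross2_neg_iff[OF f, of "e (Suc i)"] e0 that 1 2 pang_lexpos[OF f] pang_lexpos[OF that(1)] by auto
  qed
  have mono1: "pang (e i) < pang (e (Suc i))" if i: "Suc i < n" for i
  proof (cases "lexpos (e i)")
    case True
    then show ?thesis using cr[OF i] cross2_pos_iff[of "e i" "e (Suc i)"] e0 i by auto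
  next
    case False
    then have F: "\<not> lexpos (e (Suc i))" using nowrap i by blast
    have "0 < cross2 (- e i) (- e (Suc i))" using cr[OF i] by (simp add: cross2_simps)
    then show ?thesis
      using cross2_pos_lexpos[of "- e i" "- e (Suc i)"] False F e0 i lexpos_uminus 
        pang_uminus[of "e i"] pang_uminus[of "e (Suc i)"] by auto
  qed
  have mono: "pang (e i) < pang (e j)" if "i < j" "j < n" for i j
    using that by (induction j) (use mono1 less_Suc_eq in \<open>force intro: less_trans\<close>)+
  have mono_iff: "pang (e i) < pang (e j) \<longleftrightarrow> i < j" if "i < n" "j < n" for i j
    using mono[of i j] mono[of j i] that by (metis less_asym linorder_neqE_nat less_irrefl)
  have inj': "inj_on (pang \<circ> e) {..<n}"
    by (rule inj_onI) (metis comp_apply lessThan_iff linorder_neqE_nat less_irrefl mono)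
  then have inj: "inj_on e {..<n}" by (rule inj_on_imageI2)
  define E where "E = e ` {..<n}"
  have sum_e: "(\<Sum>i<j. e i) = z j - z 0" for j
    unfolding e_def by (rule sum_lessThan_telescope)
  have E_sum: "(\<Sum>x\<in>E. f x) = (\<Sum>i<n. f (e i))" for f :: "point \<Rightarrow> 'x::comm_monoid_add"
    unfolding E_def using inj by (simp add: sum.reindex)
  have "edge_set E"
    unfolding edge_set_def
  proof (intro conjI)
    show "E \<subseteq> \<int> \<times> \<int> - {0}"
    proof
      fix x assume "x \<in> E"
      then obtain i where i: "i < n" "x = e i" by (auto simp: E_def)
      have "z i \<in> \<int> \<times> \<int>" "z (Suc i) \<in> \<int> \<times> \<int>" using P zV by auto
      then show "x \<in> \<int> \<times> \<int> - {0}"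
        using e0[OF i(1)] i by (auto simp: e_def mem_Times_iff intro: Ints_diff)
    qed
    show "inj_on pang E"
      unfolding E_def by (rule inj_on_imageI[OF inj'])
    have "\<Sum>E = z n - z 0" using E_sum[of "\<lambda>x. x"] sum_e by simp
    then show "\<Sum>E = 0" using z_eq[of n 0] by simp
  qed (simp add: E_def)
  moreover have "card E = n" unfolding E_def using card_image[OF inj] by simp
  moreover have "perimeter D P = (\<Sum>e\<in>E. norm_wrt D e)"
    unfolding perimeter_eq[OF ac] E_sum len by (rule sum.cong) (auto simp: e_def z_def len)
  moreover have "vertices P = range (\<lambda>\<theta>. z 0 + \<Sum>{x \<in> E. pang x \<le> \<theta>})"
  proof -
    have S: "z 0 + \<Sum>{x \<in> E. pang x \<le> \<theta>} = z k" if k: "{i \<in> {..<n}. pang (e i) \<le> \<theta>} = {..<k}" for \<theta> k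
    proof -
      have "{x \<in> E. pang x \<le> \<theta>} = e ` {..<k}" unfolding k[symmetric] E_def by auto
      moreover have "inj_on e {..<k}" unfolding k[symmetric] by (rule inj_on_subset[OF inj]) auto
      ultimately have "\<Sum>{x \<in> E. pang x \<le> \<theta>} = (\<Sum>i<k. e i)" by (simp add: sum.reindex)
      then show ?thesis by (simp add: sum_e)
    qed
    have "z 0 + \<Sum>{x \<in> E. pang x \<le> \<theta>} \<in> vertices P" for \<theta>
    proof -
      \<comment> \<open>The first edge beyond \<theta>, or n if there is none; the edges up to
        \<theta> are then exactly those with index below \<open>k\<close>.\<close>
      define k where "k = (LEAST i. n \<le> i \<or> \<theta> < pang (e i))"
      have k: "n \<le> k \<or> \<theta> < pang (e k)" unfolding k_def by (rule LeastI[of _ n]) simp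
      have k': "i < n \<and> pang (e i) \<le> \<theta>" if "i < k" for i
        using not_less_Least[OF that[unfolded k_def]] by (simp add: not_le not_less)
      have "{i \<in> {..<n}. pang (e i) \<le> \<theta>} = {..<k}"
      proof (intro set_eqI iffI)
        fix i assume i: "i \<in> {i \<in> {..<n}. pang (e i) \<le> \<theta>}"
        show "i \<in> {..<k}"
        proof (rule ccontr)
          assume "i \<notin> {..<k}"
          then have "k \<le> i" by simp
          then show False using i k mono[of k i] by (cases "k = i") auto
        qed
      qed (use k' in auto)
      from S[OF this] zV[of k] show ?thesis by metis
    qed
    moreover have "x \<in> range (\<lambda>\<theta>. z 0 + \<Sum>{x \<in> E. pang x \<le> \<theta>})" if xV: "x \<in> vertices P" for x
    proof -
      obtain j where j: "j < n" "x = zs ! j" using xV unfolding zs(2)[symmetric] in_set_conv_nth len by blast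
      then have "x = z j" by (simp add: z_def)
      note j = j(1) this
      show ?thesis
      proof (cases j)
        case 0
        \<comment> \<open>The value -1 is never attained, so \<theta> = -1 gives the empty sum and
          thus the starting vertex.\<close>
        have "\<not> pang y \<le> - 1" for y using pang_bounds[of y] by simp
        then have "x = z 0 + \<Sum>{y \<in> E. pang y \<le> - 1}" using j 0 by simp
        then show ?thesis by (rule range_eqI)
      next
        case (Suc m)
        have "{i \<in> {..<n}. pang (e i) \<le> pang (e m)} = {..<j}"
          using j Suc mono_iff[of m] by (auto simp: not_less[symmetric] less_Suc_eq_le)
        from S[OF this, folded j(2), symmetric] show ?thesis by (rule range_eqI)
      qed
    qed
    ultimately show ?thesis by blast
  qed
  ultimately show ?thesis using that by blast
qed

text \<open>Going round from edge i, the edges point to its left for half a turn and to its right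
  for the rest, so the numbers \<open>x j\<close> are cyclically first positive, then negative, and
  their total is zero. Hence either the block from i to k has only positive terms or the
  complementary block has only negative ones.\<close>

lemma partial_sums_left:
  fixes e :: "nat \<Rightarrow> point"
  assumes mono: "\<And>i j. i < j \<Longrightarrow> j < n \<Longrightarrow> pang (e i) < pang (e j)"
    and e0: "\<And>i. i < n \<Longrightarrow> e i \<noteq> 0" and sum0: "(\<Sum>i<n. e i) = 0"
    and ik: "i < n" "k < n" "k \<noteq> i" "k \<noteq> Suc i mod n"
  shows "0 < cross2 (e i) ((\<Sum>j<k. e j) - (\<Sum>j<i. e j))"
proof -
  define x where "x j = cross2 (e i) (e j)" for j
  have goal: "cross2 (e i) ((\<Sum>j<k. e j) - (\<Sum>j<i. e j)) = (\<Sum>j<k. x j) - (\<Sum>j<i. x j)"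
    by (simp add: cross2_simps cross2_sum x_def)
  have x0: "(\<Sum>j<n. x j) = 0" "x i = 0"
    using sum0 by (simp_all add: x_def cross2_sum[symmetric] cross2_simps)
  have split: "(\<Sum>j<b. x j) = (\<Sum>j<a. x j) + (\<Sum>j\<in>{a..<b}. x j)" if "a \<le> b" for a b
    using sum.atLeastLessThan_concat[of 0 a b x] that by (simp add: atLeast0LessThan)
  have pos: "0 < sum x S" if "finite S" "S \<noteq> {}" "\<And>j. j \<in> S \<Longrightarrow> 0 < x j" for S
    using that by (intro sum_pos) auto
  have neg: "sum x S < 0" if "finite S" "S \<noteq> {}" "\<And>j. j \<in> S \<Longrightarrow> x j < 0" for S
    using sum_pos[of S "\<lambda>j. - x j"] that by (simp add: sum_negf)
  have nonneg: "0 \<le> sum x S" if "\<And>j. j \<in> S \<Longrightarrow> 0 < x j" for S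
    using that by (intro sum_nonneg) (auto intro: less_imp_le)
  have nonpos: "sum x S \<le> 0" if "\<And>j. j \<in> S \<Longrightarrow> x j < 0" for S
    using that by (intro sum_nonpos) (auto intro: less_imp_le)
  have step: "(\<Sum>j<Suc i. x j) = (\<Sum>j<i. x j)" using x0 by simp
  consider (gt) "Suc (Suc i) \<le> k" | (lt) "k < i"
    using ik by (cases "Suc i = n") (simp_all, linarith+)
  then have "0 < (\<Sum>j<k. x j) - (\<Sum>j<i. x j)"
  proof cases
    case gt
    have S1: "(\<Sum>j<k. x j) - (\<Sum>j<i. x j) = (\<Sum>j\<in>{Suc i..<k}. x j)"
      using split[of "Suc i" k] gt step by simp
    \<comment> \<open>The same difference through the complementary block, as the total is zero; the
      block with constant sign is used.\<close>
    have S2: "(\<Sum>j<k. x j) - (\<Sum>j<i. x j) = - (\<Sum>j\<in>{k..<n}. x j) - (\<Sum>j<i. x j)"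
      using split[of k n] ik x0 by simp
    show ?thesis
    proof (cases "lexpos (e i)")
      case True
      note c = cross2_pos_iff[OF True e0] cross2_neg_iff[OF True e0]
      show ?thesis
      proof (cases "pang (e (k - 1)) < pang (e i) + 2")
        case True
        have "0 < x j" if "j \<in> {Suc i..<k}" for j
        proof -
          have "pang (e j) \<le> pang (e (k - 1))" 
            using mono[of j "k - 1"] that ik by (cases "j = k - 1") (auto intro: less_imp_le)
          then show ?thesis using c(1)[of j] mono[of i j] that ik True by (auto simp: x_def)
        qed
        then show ?thesis unfolding S1 using gt by (intro pos) auto
      next
        case False
        have "x j < 0" if "j \<in> {k..<n}" for j
        proof -
          have "k - 1 < j" using that gt by auto
          then show ?thesis using c(2)[of j] mono[of "k - 1" j] that False gt by (auto simp: x_def)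
        qed
        then have "(\<Sum>j\<in>{k..<n}. x j) < 0" using ik by (intro neg) auto
        moreover have "x j < 0" if "j \<in> {..<i}" for j
          using c(2)[of j] mono[of j i] that ik by (auto simp: x_def)
        then have "(\<Sum>j<i. x j) \<le> 0" by (rule nonpos)
        ultimately show ?thesis unfolding S2 by linarith
      qed
    next
      case False
      then have m: "lexpos (- e i)" "pang (e i) = pang (- e i) + 2"
        using e0[OF ik(1)] lexpos_uminus pang_uminus by auto
      have "0 < x j" if "j \<in> {Suc i..<k}" for j
        using cross2_neg_iff[OF m(1) e0, of j] mono[of i j] that ik m(2) by (auto simp: x_def cross2_simps)
      then show ?thesis unfolding S1 using gt by (intro pos) auto
    qed
  next
    case lt
    have S1: "(\<Sum>j<k. x j) - (\<Sum>j<i. x j) = - (\<Sum>j\<in>{k..<i}. x j)"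
      using split[of k i] lt by simp
    have S2: "(\<Sum>j<k. x j) - (\<Sum>j<i. x j) = (\<Sum>j<k. x j) + (\<Sum>j\<in>{Suc i..<n}. x j)"
      using split[of "Suc i" n] ik x0 step by simp
    show ?thesis
    proof (cases "lexpos (e i)")
      case True
      have "x j < 0" if "j \<in> {k..<i}" for j
        using cross2_neg_iff[OF True e0, of j] mono[of j i] that ik by (auto simp: x_def)
      then have "(\<Sum>j\<in>{k..<i}. x j) < 0" using lt by (intro neg) auto
      then show ?thesis unfolding S1 by simp
    next
      case False
      then have m: "lexpos (- e i)" "pang (e i) = pang (- e i) + 2"
        using e0[OF ik(1)] lexpos_uminus pang_uminus by auto
      note c = cross2_pos_iff[OF m(1) e0] cross2_neg_iff[OF m(1) e0]
      show ?thesis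
      proof (cases "pang (- e i) < pang (e k)")
        case True
        have "x j < 0" if "j \<in> {k..<i}" for j
        proof -
          have "pang (e k) \<le> pang (e j)" 
            using mono[of k j] that ik by (cases "j = k") (auto intro: less_imp_le)
          then show ?thesis using c(1)[of j] mono[of j i] that ik True m(2) by (auto simp: x_def cross2_simps)
        qed
        then have "(\<Sum>j\<in>{k..<i}. x j) < 0" using lt by (intro neg) auto
        then show ?thesis unfolding S1 by simp
      next
        case False
        have 1: "0 < x j" if "j \<in> {..<k}" for j
          using c(2)[of j] mono[of j k] that ik False by (auto simp: x_def cross2_simps)
        have 2: "0 < x j" if "j \<in> {Suc i..<n}" for j
          using c(2)[of j] mono[of i j] that ik m(2) by (auto simp: x_def cross2_simps)
        show ?thesis
        proof (cases "k = 0")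
          case True
          then have "Suc i < n" using ik by (cases "Suc i = n") auto
          then have "0 < (\<Sum>j\<in>{Suc i..<n}. x j)" using 2 by (intro pos) auto
          then show ?thesis unfolding S2 using True by simp
        next
          case False
          then have "0 < (\<Sum>j<k. x j)" using 1 by (intro pos) auto
          moreover have "0 \<le> (\<Sum>j\<in>{Suc i..<n}. x j)" using 2 by (rule nonneg)
          ultimately show ?thesis unfolding S2 by simp
        qed
      qed
    qed
  qed
  then show ?thesis by (simp add: goal)
qed

lemma convex_cross2_pos: "convex {x. 0 < cross2 a (x - p) + cross2 b (x - p)}"
proof -
  have "{x. 0 < cross2 a (x - p) + cross2 b (x - p)} = {x. inner (- snd a - snd b, fst a + fst b) x
      > inner (- snd a - snd b, fst a + fst b) p}"
    by (auto simp: cross2_def inner_prod_def algebra_simps)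
  then show ?thesis by (simp add: convex_halfspace_gt)
qed

text \<open>Sorting the edges by \<open>pang\<close> and taking partial sums closes up to a convex
  polygon; \<open>partial_sums_left\<close> supplies the orientation. What remains is that no
  partial sum is lost as an extreme point of the hull.\<close>

lemma edges_polygon:
  assumes E: "edge_set E" and n: "card E = n" "3 \<le> n"
  obtains P where "P \<in> lattice_polygons n" "perimeter D P = (\<Sum>e\<in>E. norm_wrt D e)"
proof -
  have E: "finite E" "E \<subseteq> \<int> \<times> \<int> - {0}" "inj_on pang E" "\<Sum>E = 0"
    using E by (auto simp: edge_set_def)
  obtain es where es: "distinct es" "set es = E" "sorted_wrt (\<lambda>a b. pang a < pang b) es"
    using exists_sorted_wrt_key[OF E(1,3)] by blast
  have len: "length es = n" using distinct_card[OF es(1)] es n by simp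
  define e where "e i = es ! i" for i
  have mono: "pang (e i) < pang (e j)" if "i < j" "j < n" for i j
    using sorted_wrt_nth_less[OF es(3)] that len by (simp add: e_def)
  have eE: "e i \<in> E" if "i < n" for i using that es len by (auto simp: e_def)
  have e0: "e i \<noteq> 0" if "i < n" for i using eE[OF that] E by auto
  have bij: "bij_betw e {..<n} E"
    unfolding e_def using es len by (intro bij_betw_nth) auto
  have E_sum: "(\<Sum>x\<in>E. f x) = (\<Sum>i<n. f (e i))" for f :: "point \<Rightarrow> 'x::comm_monoid_add"
    using sum.reindex_bij_betw[OF bij, of f] by simp
  have sum0: "(\<Sum>i<n. e i) = 0" using E_sum[of "\<lambda>x. x"] E by simp
  define z where "z k = (\<Sum>j<k. e j)" for k
  define zs where "zs = map z [0..<n]"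
  have zs: "length zs = n" "\<And>i. i < n \<Longrightarrow> zs ! i = z i" by (simp_all add: zs_def)
  note left = partial_sums_left[of n e, OF mono e0 sum0, folded z_def]
  have next_eq: "z (Suc i mod n) - z i = e i" if "i < n" for i
    using that sum0 by (cases "Suc i = n") (auto simp: z_def add_eq_0_iff)
  have z_neq: "z k \<noteq> z i" if "i < n" "k < n" "k \<noteq> i" for i k
  proof (cases "k = Suc i mod n")
    case True
    then show ?thesis using next_eq[of i] e0[of i] that by auto
  next
    case False
    then show ?thesis using left[of i k] that by (auto simp: cross2_simps)
  qed
  have dist: "distinct zs" using z_neq zs by (metis distinct_conv_nth)
  define P where "P = convex hull (set zs)"
  have sub: "vertices P \<subseteq> set zs"
    unfolding vertices_def P_def by (rule extreme_points_of_convex_hull)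
  have P: "polytope P" unfolding P_def by (simp add: polytope_convex_hull)
  have vert: "vertices P = set zs"
  proof (rule ccontr)
    assume "vertices P \<noteq> set zs"
    then obtain i where i: "i < n" "z i \<notin> vertices P" using sub zs by (metis in_set_conv_nth psubsetE psubsetI subsetI)
    \<comment> \<open>The cyclic predecessor of i. The sum of the cross products with the incoming
      and outgoing edges vanishes at \<open>z i\<close> and is positive at every other
      \<open>z j\<close>: each neighbour annihilates only one of the two. So \<open>z i\<close>
      cannot lie in the hull of the others.\<close>
    define h where "h = (if i = 0 then n - 1 else i - 1)"
    have h: "h < n" "Suc h mod n = i" "h \<noteq> Suc i mod n" "h \<noteq> i"
      using i n by (auto simp: h_def mod_if)
    have *: "0 < cross2 (e h) (x - z i) + cross2 (e i) (x - z i)" if x: "x \<in> vertices P" for x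
    proof -
      have "x \<in> set zs" using sub x by blast
      then obtain j where j: "j < n" "x = z j" using zs by (metis in_set_conv_nth)
      have "j \<noteq> i" using i j x by auto
      have eh: "cross2 (e h) (x - z i) = cross2 (e h) (z j - z h)"
      proof -
        have "z i = z h + e h" using next_eq[of h] h by (simp add: algebra_simps)
        then show ?thesis by (simp add: j cross2_simps)
      qed
      have 1: "0 < cross2 (e h) (x - z i)" if "j \<noteq> h"
        using left[of h j] h j \<open>j \<noteq> i\<close> that eh by auto
      have 2: "0 < cross2 (e i) (x - z i)" if "j \<noteq> Suc i mod n"
        using left[of i j] i j \<open>j \<noteq> i\<close> that by auto
      have 3: "cross2 (e i) (x - z i) = 0" if "j = Suc i mod n"
        using that next_eq[of i] i j by (simp add: cross2_simps)
      have 4: "cross2 (e h) (x - z i) = 0" if "j = h"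
        using that eh by (simp add: cross2_simps)
      show ?thesis using 1 2 3 4 h(3) by (cases "j = h"; cases "j = Suc i mod n") auto
    qed
    have "z i \<in> P" unfolding P_def using i zs by (metis hull_inc nth_mem)
    also have "P = convex hull (vertices P)" using vertices_polytope[OF P] by simp
    also have "\<dots> \<subseteq> {x. 0 < cross2 (e h) (x - z i) + cross2 (e i) (x - z i)}"
      using * convex_cross2_pos by (intro hull_minimal) auto
    finally show False by (simp add: cross2_simps)
  qed
  have zint: "z k \<in> \<int> \<times> \<int>" if "k \<le> n" for k
    using that unfolding z_def
  proof (induction k)
    case (Suc k)
    then show ?case using eE[of k] E(2) by (auto simp: mem_Times_iff intro!: Ints_add)
  qed (simp add: zero_prod_def)
  have "anticlockwise_vertices P zs"
    unfolding anticlockwise_vertices_def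
  proof (intro conjI allI impI ballI)
    fix i w assume i: "i < length zs" and w: "w \<in> vertices P - {zs ! i, cyc_next zs i}"
    then obtain k where k: "k < n" "w = z k" using vert zs by (metis DiffD1 in_set_conv_nth)
    have m: "Suc i mod n < n" using n by simp
    have "k \<noteq> i" "k \<noteq> Suc i mod n" using w k zs i m by auto
    then show "0 < cross2 (cyc_next zs i - zs ! i) (w - zs ! i)"
      using left[of i k] i k zs next_eq[of i] m by simp
  qed (simp_all only: dist vert)
  from perimeter_eq[OF this] have "perimeter D P = (\<Sum>i<n. norm_wrt D (cyc_next zs i - zs ! i))"
    by (simp only: zs)
  also have "\<dots> = (\<Sum>i<n. norm_wrt D (e i))"
    by (rule sum.cong) (use next_eq zs n in auto)
  finally have "perimeter D P = (\<Sum>e\<in>E. norm_wrt D e)" by (simp add: E_sum)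
  moreover have "set zs \<subseteq> \<int> \<times> \<int>" using zint by (simp add: zs_def image_subset_iff)
  then have "P \<in> lattice_polygons n"
    unfolding lattice_polygons_def mem_Collect_eq vert using P zs(1) distinct_card[OF dist] by simp
  ultimately show ?thesis using that by blast
qed

section \<open>Density of primitive vectors\<close>

abbreviation lattice :: "point set" where "lattice \<equiv> \<int> \<times> \<int> - {0}"

definition primitive :: "point set" where
  "primitive = {(of_int a, of_int b) | a b. coprime a b}"

lemma lattice_obtain:
  assumes "z \<in> lattice" obtains a b where "z = (of_int a, of_int b)" "a \<noteq> 0 \<or> b \<noteq> 0"
proof -
  obtain x y where z: "z = (x, y)" by (cases z)
  then obtain a b where "x = of_int a" "y = of_int b" using assms by (auto elim!: Ints_cases)
  then show ?thesis using that z assms by (auto simp: zero_prod_def)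
qed

lemma primitive_lattice: "primitive \<subseteq> lattice"
  by (auto simp: primitive_def zero_prod_def)

text \<open>The factor is recovered as the gcd of the coordinates, which gives injectivity; dividing
  by the gcd gives surjectivity.\<close>

lemma bij_primitive: "bij_betw (\<lambda>(d, p). real d *\<^sub>R p) ({1..} \<times> primitive) lattice"
  unfolding bij_betw_def
proof (intro conjI inj_onI set_eqI iffI)
  fix x y assume "x \<in> {1..} \<times> primitive" "y \<in> {1..} \<times> primitive"
    and eq: "(case x of (d, p) \<Rightarrow> real d *\<^sub>R p) = (case y of (d, p) \<Rightarrow> real d *\<^sub>R p)"
  then obtain d a b e a' b' where x: "x = (d, (of_int a, of_int b))" "1 \<le> d" "coprime a b"
    and y: "y = (e, (of_int a', of_int b'))" "1 \<le> e" "coprime a' b'"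
    by (auto simp: primitive_def)
  have "of_int (int d * a) = (of_int (int e * a') :: real)" "of_int (int d * b) = (of_int (int e * b') :: real)"
    using eq x y by simp_all
  then have ab: "int d * a = int e * a'" "int d * b = int e * b'" by (simp_all only: of_int_eq_iff)
  have "gcd (int d * a) (int d * b) = int d" using x by (simp add: gcd_mult_left)
  moreover have "gcd (int e * a') (int e * b') = int e" using y by (simp add: gcd_mult_left)
  ultimately have "d = e" using ab by simp
  then show "x = y" using ab x y by simp
next
  fix z assume "z \<in> (\<lambda>(d, p). real d *\<^sub>R p) ` ({1..} \<times> primitive)"
  then obtain d a b where "z = (of_int (int d * a), of_int (int d * b))" "1 \<le> d" "coprime a b"
    by (auto simp: primitive_def)
  then show "z \<in> lattice" by (auto simp: zero_prod_def simp del: of_int_mult)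
next
  fix z :: point assume "z \<in> lattice"
  then obtain a b where z: "z = (of_int a, of_int b)" "a \<noteq> 0 \<or> b \<noteq> 0" by (rule lattice_obtain)
  let ?d = "gcd a b"
  have d: "0 < ?d" using z by simp
  have "a = ?d * (a div ?d)" "b = ?d * (b div ?d)" by simp_all
  then have "of_int a = real_of_int ?d * of_int (a div ?d)" "of_int b = real_of_int ?d * of_int (b div ?d)"
    by (metis of_int_mult)+
  then have "z = real (nat ?d) *\<^sub>R (of_int (a div ?d), of_int (b div ?d))"
    using z d by (simp add: of_nat_nat)
  moreover have "coprime (a div ?d) (b div ?d)" using z by (simp add: div_gcd_coprime)
  ultimately show "z \<in> (\<lambda>(d, p). real d *\<^sub>R p) ` ({1..} \<times> primitive)"
    using d z(2) by (intro image_eqI[of _ _ "(nat ?d, (of_int (a div ?d), of_int (b div ?d)))"])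
      (auto simp: primitive_def Suc_le_eq)
qed

section \<open>From sums over all lattice vectors to sums over primitive ones\<close>

lemma norm_lattice: assumes "z \<in> lattice" shows "1 \<le> norm z"
proof -
  obtain a b where z: "z = (of_int a, of_int b)" "a \<noteq> 0 \<or> b \<noteq> 0" using assms by (rule lattice_obtain)
  then have "1 \<le> \<bar>real_of_int a\<bar> \<or> 1 \<le> \<bar>real_of_int b\<bar>" by linarith
  then show ?thesis
    using z norm_fst_le[of "real_of_int a" "real_of_int b"] norm_snd_le[of "real_of_int b" "real_of_int a"] by auto
qed

text \<open>A square box with (2k + 1)^2 points, where 2k + 1 is at most 3r once r is at least 1.
  For smaller r the set is empty because \<open>lattice\<close> omits the origin, so the bound is
  purely quadratic.\<close>

lemma card_lattice_cball:
  fixes r :: real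
  assumes "0 \<le> r"
  shows "finite (lattice \<inter> cball 0 r)" "card (lattice \<inter> cball 0 r) \<le> 9 * r\<^sup>2"
proof -
  define k where "k = \<lfloor>r\<rfloor>"
  have k: "0 \<le> k" "of_int k \<le> r" using assms by (auto simp: k_def)
  let ?S = "(\<lambda>(a, b). (of_int a, of_int b)) ` ({- k..k} \<times> {- k..k}) :: point set"
  have sub: "lattice \<inter> cball 0 r \<subseteq> ?S"
  proof
    fix z assume z: "z \<in> lattice \<inter> cball 0 r"
    then obtain a b where ab: "z = (of_int a, of_int b)" using lattice_obtain by blast
    have "\<bar>real_of_int a\<bar> \<le> r" "\<bar>real_of_int b\<bar> \<le> r"
      using z ab norm_fst_le[of "real_of_int a" "real_of_int b"] norm_snd_le[of "real_of_int b" "real_of_int a"] by auto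
    then have "\<bar>a\<bar> \<le> k" "\<bar>b\<bar> \<le> k" by (auto simp: k_def le_floor_iff)
    then show "z \<in> ?S" using ab by (intro image_eqI[of _ _ "(a, b)"]) auto
  qed
  then show fin: "finite (lattice \<inter> cball 0 r)" by (rule finite_subset) auto
  show "card (lattice \<inter> cball 0 r) \<le> 9 * r\<^sup>2"
  proof (cases "r < 1")
    case True
    have "lattice \<inter> cball 0 r = {}"
      using norm_lattice True by (force simp del: mem_Times_iff)
    then have "card (lattice \<inter> cball 0 r) = 0" by simp
    then show ?thesis by simp
  next
    case False
    have "card (lattice \<inter> cball 0 r) \<le> card ?S" using sub by (intro card_mono) auto
    also have "\<dots> \<le> card ({- k..k} \<times> {- k..k})" by (intro card_image_le) auto
    also have "\<dots> = nat (2 * k + 1) ^ 2" by (simp add: card_cartesian_product power2_eq_square)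
    finally have "real (card (lattice \<inter> cball 0 r)) \<le> (real (nat (2 * k + 1)))\<^sup>2"
      by (metis of_nat_le_iff of_nat_power)
    also have "real (nat (2 * k + 1)) = 2 * of_int k + 1" using k by (simp add: of_nat_nat)
    also have "(2 * real_of_int k + 1)\<^sup>2 \<le> (3 * r)\<^sup>2" using k False by (intro power_mono) auto
    finally show ?thesis by (simp add: power_mult_distrib)
  qed
qed

text \<open>Vectors are grouped by their content d: if z = d p, then z / t = p / (t / d), so each
  group is a primitive sum at scale t / d. Contents above \<open>m\<close> do not occur, since
  primitive vectors have norm at least 1.\<close>

lemma lattice_sum_by_primitive:
  assumes "0 < t" "0 < R" "R * t \<le> real m"
  shows "(\<Sum>z\<in>lattice \<inter> cball 0 (R * t). f ((1 / t) *\<^sub>R z))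
       = (\<Sum>d\<in>{1..m}. \<Sum>p\<in>primitive \<inter> cball 0 (R * (t / real d)). f ((1 / (t / real d)) *\<^sub>R p))"
proof -
  let ?A = "Sigma {1..m} (\<lambda>d. primitive \<inter> cball 0 (R * (t / real d)))"
  let ?h = "\<lambda>(d, p). real d *\<^sub>R (p :: point)"
  have fin: "finite (primitive \<inter> cball 0 r)" if "0 \<le> r" for r :: real
    using card_lattice_cball(1)[OF that] primitive_lattice by (meson Int_mono finite_subset order_refl)
  have A: "?A \<subseteq> {1..} \<times> primitive" by auto
  have img: "?h ` ?A = lattice \<inter> cball 0 (R * t)"
  proof (intro set_eqI iffI)
    fix z assume "z \<in> ?h ` ?A"
    then obtain d p where dp: "z = real d *\<^sub>R p" "1 \<le> d" "p \<in> primitive" "norm p \<le> R * (t / real d)" by auto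
    then have "z \<in> lattice" using bij_betwE[OF bij_primitive, rule_format, of "(d, p)"] by simp
    moreover have "norm z \<le> R * t" using dp by (simp add: field_simps)
    ultimately show "z \<in> lattice \<inter> cball 0 (R * t)" by simp
  next
    fix z assume z: "z \<in> lattice \<inter> cball 0 (R * t)"
    then have "z \<in> ?h ` ({1..} \<times> primitive)" unfolding bij_betw_imp_surj_on[OF bij_primitive] by blast
    then obtain d p where dp: "z = real d *\<^sub>R p" "1 \<le> d" "p \<in> primitive" by auto
    have le: "real d * norm p \<le> R * t" using z dp by simp
    have "1 \<le> norm p" using norm_lattice dp primitive_lattice by blast
    then have "real d * 1 \<le> real d * norm p" by (intro mult_left_mono) auto
    then have "d \<le> m" using le assms by linarith
    moreover have "norm p \<le> R * (t / real d)" using le dp by (simp add: field_simps)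
    ultimately show "z \<in> ?h ` ?A" using dp by (intro image_eqI[of _ _ "(d, p)"]) auto
  qed
  have "inj_on ?h ?A" using A bij_betw_imp_inj_on[OF bij_primitive] inj_on_subset by blast
  then have "(\<Sum>z\<in>lattice \<inter> cball 0 (R * t). f ((1 / t) *\<^sub>R z)) = (\<Sum>x\<in>?A. f ((1 / t) *\<^sub>R ?h x))"
    by (simp add: img[symmetric] sum.reindex)
  also have "\<dots> = (\<Sum>(d, p)\<in>?A. f ((1 / (t / real d)) *\<^sub>R p))"
    by (rule sum.cong) auto
  also have "\<dots> = (\<Sum>d\<in>{1..m}. \<Sum>p\<in>primitive \<inter> cball 0 (R * (t / real d)). f ((1 / (t / real d)) *\<^sub>R p))"
    using fin assms by (intro sum.Sigma[symmetric]) auto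
  finally show ?thesis .
qed

lemma sum_inverse_squares_tail:
  assumes "1 \<le> D"
  shows "(\<Sum>d\<in>{Suc D..m}. 1 / (real d)\<^sup>2) \<le> 1 / real D"
proof -
  have "(\<Sum>d\<in>{Suc D..m}. 1 / (real d)\<^sup>2) \<le> 1 / real D - 1 / real m" if "D \<le> m"
    using that
  proof (induction rule: dec_induct)
    case (step k)
    have "1 / (real (Suc k))\<^sup>2 \<le> 1 / real k - 1 / real (Suc k)"
      using assms step by (simp add: divide_simps power2_eq_square)
    moreover have "(\<Sum>d\<in>{Suc D..Suc k}. 1 / (real d)\<^sup>2) = (\<Sum>d\<in>{Suc D..k}. 1 / (real d)\<^sup>2) + 1 / (real (Suc k))\<^sup>2"
      using step by simp
    ultimately show ?case using step by linarith
  qed simp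
  then show ?thesis by (cases "D \<le> m") (auto intro: order_trans)
qed

text \<open>The first term 1/4 plus the telescoping tail bound 1/2. That 3/4 is below 1 makes the
  iteration for primitive vectors contract.\<close>

lemma sum_inverse_squares_from_2: "(\<Sum>d\<in>{2..m}. 1 / (real d)\<^sup>2) \<le> 3 / 4"
proof (cases "2 \<le> m")
  case True
  have "(\<Sum>d\<in>{2..m}. 1 / (real d)\<^sup>2) = 1 / 4 + (\<Sum>d\<in>{Suc 2..m}. 1 / (real d)\<^sup>2)"
    using True sum.atLeast_Suc_atMost[of 2 m "\<lambda>d. 1 / (real d)\<^sup>2"] by simp
  then show ?thesis using sum_inverse_squares_tail[of 2 m] by simp
qed auto

text \<open>The zeta function at 2; its inverse is the density of primitive vectors among lattice
  vectors.\<close>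

definition zeta2 :: real where "zeta2 = (\<Sum>n. 1 / (real (Suc n))\<^sup>2)"

lemma zeta2_sums: "(\<lambda>n. 1 / (real (Suc n))\<^sup>2) sums zeta2"
  using inverse_squares_sums sums_unique by (fastforce simp: zeta2_def)

lemma zeta2_ge_1: "1 \<le> zeta2"
  using sum_le_suminf[OF sums_summable[OF zeta2_sums], of "{0}"] by (simp add: zeta2_def)

lemma zeta2_partial_sums: "(\<lambda>m. \<Sum>d\<in>{1..m}. 1 / (real d)\<^sup>2) \<longlonglongrightarrow> zeta2"
proof -
  have "(\<Sum>d\<in>{1..m}. 1 / (real d)\<^sup>2) = (\<Sum>n<m. 1 / (real (Suc n))\<^sup>2)" for m
    using sum.atLeast1_atMost_eq[of "\<lambda>d. 1 / (real d)\<^sup>2" m] by simp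
  then show ?thesis using zeta2_sums by (simp add: sums_def)
qed

text \<open>With \<open>F(t)\<close> the error term for primitive vectors, grouping lattice vectors by their content
  gives \<open>F(t) = o(1) - (\<Sum>d\<ge>2. F(t/d) / d\<^sup>2)\<close>, and \<open>(\<Sum>d\<ge>2. 1 / d\<^sup>2) < 1\<close>, so \<open>F\<close> is small by iteration;
  no Moebius inversion is needed.\<close>

lemma primitive_density:
  fixes f :: "'i \<Rightarrow> point \<Rightarrow> real"
  assumes bound: "\<And>i x. i \<in> I \<Longrightarrow> \<bar>f i x\<bar> \<le> B" and R: "0 < R"
    and lim: "uniform_limit I (\<lambda>t i. (\<Sum>z\<in>lattice \<inter> cball 0 (R * t). f i ((1 / t) *\<^sub>R z)) / t\<^sup>2) a at_top"
  shows "uniform_limit I (\<lambda>t i. (\<Sum>z\<in>primitive \<inter> cball 0 (R * t). f i ((1 / t) *\<^sub>R z)) / t\<^sup>2)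
           (\<lambda>i. a i / zeta2) at_top"
proof (cases "I = {}")
  case False
  then have "0 \<le> B" using bound by (meson abs_ge_zero equals0I order_trans)
  define N where "N i t = (\<Sum>z\<in>lattice \<inter> cball 0 (R * t). f i ((1 / t) *\<^sub>R z))" for i t
  define P where "P i t = (\<Sum>z\<in>primitive \<inter> cball 0 (R * t). f i ((1 / t) *\<^sub>R z))" for i t
  define F where "F i t = P i t / t\<^sup>2 - a i / zeta2" for i t
  \<comment> \<open>By \<open>card_lattice_cball\<close> the normalised sums are at most 9 B R^2 in
    absolute value; the extra 1 lets \<open>A\<close> also bound the limit \<open>a i\<close>, which
    is within 1 of such a value. \<open>M\<close> then bounds \<open>F\<close>.\<close>
  define A where "A = 9 * B * R\<^sup>2 + 1"
  define M where "M = 2 * A"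
  have A: "0 < A" using \<open>0 \<le> B\<close> by (simp add: A_def add_nonneg_pos)
  have sum_le: "\<bar>\<Sum>z\<in>X \<inter> cball 0 (R * t). f i ((1 / t) *\<^sub>R z)\<bar> \<le> 9 * B * R\<^sup>2 * t\<^sup>2"
    if "i \<in> I" "0 < t" "X \<subseteq> lattice" for i t X
  proof -
    have r: "0 \<le> R * t" using R that by simp
    have "\<bar>\<Sum>z\<in>X \<inter> cball 0 (R * t). f i ((1 / t) *\<^sub>R z)\<bar> \<le> (\<Sum>z\<in>X \<inter> cball 0 (R * t). \<bar>f i ((1 / t) *\<^sub>R z)\<bar>)"
      by (rule sum_abs)
    also have "\<dots> \<le> real (card (X \<inter> cball 0 (R * t))) * B" 
      using bound[OF that(1)] by (intro sum_bounded_above) auto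
    also have "\<dots> \<le> (9 * (R * t)\<^sup>2) * B"
    proof (rule mult_right_mono[OF _ \<open>0 \<le> B\<close>])
      have "card (X \<inter> cball 0 (R * t)) \<le> card (lattice \<inter> cball 0 (R * t))"
        using card_lattice_cball(1)[OF r] that(3) by (intro card_mono) auto
      then show "real (card (X \<inter> cball 0 (R * t))) \<le> 9 * (R * t)\<^sup>2"
        using card_lattice_cball(2)[OF r] by linarith
    qed
    finally show ?thesis by (simp add: power_mult_distrib mult_ac)
  qed
  have ratio: "\<bar>s / t\<^sup>2\<bar> \<le> A" if "\<bar>s\<bar> \<le> 9 * B * R\<^sup>2 * t\<^sup>2" "0 < t" for s t
  proof -
    have "\<bar>s\<bar> \<le> 9 * B * R\<^sup>2 * t\<^sup>2 + 1 * t\<^sup>2" using that by (simp add: add_increasing2)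
    then show ?thesis using that by (simp add: A_def abs_div pos_divide_le_eq distrib_right)
  qed
  have a: "\<bar>a i\<bar> \<le> A" if "i \<in> I" for i
  proof -
    have "\<forall>\<^sub>F t in at_top. \<forall>i\<in>I. dist (N i t / t\<^sup>2) (a i) < 1"
      using uniform_limitD[OF lim, of 1] by (simp add: N_def)
    then have "\<forall>\<^sub>F t in at_top. dist (N i t / t\<^sup>2) (a i) < 1 \<and> 0 < t"
      using eventually_gt_at_top[of 0] by eventually_elim (use that in auto)
    then obtain t where t: "dist (N i t / t\<^sup>2) (a i) < 1" "0 < t"
      using eventually_happens'[of "at_top :: real filter"] by auto
    have "\<bar>N i t / t\<^sup>2\<bar> \<le> 9 * B * R\<^sup>2"
      using sum_le[OF that t(2), of lattice] t(2) by (simp add: N_def abs_div pos_divide_le_eq)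
    then show ?thesis using t(1) unfolding A_def dist_real_def by linarith
  qed
  have az: "\<bar>a i / zeta2\<bar> \<le> A" if "i \<in> I" for i
  proof -
    have "\<bar>a i\<bar> * 1 \<le> \<bar>a i\<bar> * zeta2" by (intro mult_left_mono zeta2_ge_1) auto
    then have "\<bar>a i / zeta2\<bar> \<le> \<bar>a i\<bar>" using zeta2_ge_1 by (simp add: abs_div pos_divide_le_eq)
    then show ?thesis using a[OF that] by linarith
  qed
  have Fle: "\<bar>F i t\<bar> \<le> M" if "i \<in> I" "0 < t" for i t
  proof -
    have "\<bar>P i t / t\<^sup>2\<bar> \<le> A" unfolding P_def by (intro ratio sum_le that primitive_lattice)
    then show ?thesis using az[OF that(1)] unfolding F_def M_def by linarith
  qed
  have rec: "F i t = (N i t / t\<^sup>2 - a i) + a i / zeta2 * (zeta2 - (\<Sum>d\<in>{1..m}. 1 / (real d)\<^sup>2))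
      - (\<Sum>d\<in>{2..m}. F i (t / real d) / (real d)\<^sup>2)"
    if "0 < t" "R * t \<le> real m" "1 \<le> m" for i t m
  proof -
    have "N i t / t\<^sup>2 = (\<Sum>d\<in>{1..m}. P i (t / real d) / t\<^sup>2)"
      unfolding N_def P_def lattice_sum_by_primitive[OF that(1) R that(2)] by (simp add: sum_divide_distrib)
    also have "\<dots> = (\<Sum>d\<in>{1..m}. F i (t / real d) / (real d)\<^sup>2 + a i / zeta2 * (1 / (real d)\<^sup>2))"
      by (rule sum.cong) (use that in \<open>auto simp: F_def field_simps\<close>)
    also have "\<dots> = (\<Sum>d\<in>{1..m}. F i (t / real d) / (real d)\<^sup>2) + a i / zeta2 * (\<Sum>d\<in>{1..m}. 1 / (real d)\<^sup>2)"
      by (simp add: sum.distrib sum_distrib_left)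
    also have "(\<Sum>d\<in>{1..m}. F i (t / real d) / (real d)\<^sup>2) = F i t + (\<Sum>d\<in>{2..m}. F i (t / real d) / (real d)\<^sup>2)"
      using sum.atLeast_Suc_atMost[OF that(3), of "\<lambda>d. F i (t / real d) / (real d)\<^sup>2"] by (simp add: numeral_2_eq_2)
    finally show ?thesis using zeta2_ge_1 by (simp add: algebra_simps)
  qed
  \<comment> \<open>An eventual bound \<open>b\<close> costs 3/4 b in the sum over d. The contents d
    > D, where t / d may be too small for that bound, add at most M / D, and D is chosen so that
    this is at most b/24. The lattice error and the tail of \<open>zeta2\<close> add b/24 each: 3/4
    + 3/24 = 7/8.\<close>
  have contract: "\<forall>\<^sub>F t in at_top. \<forall>i\<in>I. \<bar>F i t\<bar> \<le> 7 / 8 * b"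
    if "0 < b" and ev: "\<forall>\<^sub>F t in at_top. \<forall>i\<in>I. \<bar>F i t\<bar> \<le> b" for b
  proof -
    obtain T where T: "\<And>t i. T \<le> t \<Longrightarrow> i \<in> I \<Longrightarrow> \<bar>F i t\<bar> \<le> b"
      using ev unfolding eventually_at_top_linorder by blast
    define \<epsilon> where "\<epsilon> = b / 24"
    have \<epsilon>: "0 < \<epsilon>" using that by (simp add: \<epsilon>_def)
    obtain D :: nat where D: "M / \<epsilon> < real D" using reals_Archimedean2 by blast
    have "0 < M / \<epsilon>" using A \<epsilon> by (simp add: M_def)
    then have D1: "1 \<le> D" using D by linarith
    have MD: "M / real D \<le> \<epsilon>" using D D1 \<epsilon> by (simp add: field_simps)
    have "0 < \<epsilon> / A" using \<epsilon> A by simp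
    from LIMSEQ_D[OF zeta2_partial_sums this] obtain m0 
      where m0: "\<And>m. m0 \<le> m \<Longrightarrow> \<bar>(\<Sum>d\<in>{1..m}. 1 / (real d)\<^sup>2) - zeta2\<bar> < \<epsilon> / A" by auto
    have "\<forall>\<^sub>F t in at_top. \<forall>i\<in>I. dist (N i t / t\<^sup>2) (a i) < \<epsilon>"
      using uniform_limitD[OF lim \<epsilon>] by (simp add: N_def)
    then show ?thesis
      using eventually_gt_at_top[of 0] eventually_ge_at_top[of "T * real D"] eventually_ge_at_top[of "real D * \<bar>T\<bar>"]
    proof eventually_elim
      case (elim t)
      show ?case
      proof
        fix i assume i: "i \<in> I"
        define m where "m = Max {m0, 1, nat \<lceil>R * t\<rceil>}"
        have m: "m0 \<le> m" "1 \<le> m" "nat \<lceil>R * t\<rceil> \<le> m" unfolding m_def by (rule Max_ge; simp)+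
        have m': "R * t \<le> real m"
          using real_nat_ceiling_ge[of "R * t"] m(3) by (meson of_nat_mono order_trans)
        have 1: "\<bar>N i t / t\<^sup>2 - a i\<bar> \<le> \<epsilon>" using elim i by (auto simp: dist_real_def)
        have 2: "\<bar>a i / zeta2 * (zeta2 - (\<Sum>d\<in>{1..m}. 1 / (real d)\<^sup>2))\<bar> \<le> \<epsilon>"
        proof -
          have "\<bar>a i / zeta2\<bar> * \<bar>zeta2 - (\<Sum>d\<in>{1..m}. 1 / (real d)\<^sup>2)\<bar> \<le> A * (\<epsilon> / A)"
            using m0[OF m(1)] A az[OF i] by (intro mult_mono) (auto simp: abs_minus_commute)
          then show ?thesis using A by (simp add: abs_mult)
        qed
        have "\<bar>\<Sum>d\<in>{2..m}. F i (t / real d) / (real d)\<^sup>2\<bar> \<le> (\<Sum>d\<in>{2..m}. \<bar>F i (t / real d) / (real d)\<^sup>2\<bar>)"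
          by (rule sum_abs)
        also have "\<dots> \<le> (\<Sum>d\<in>{2..m}. b * (1 / (real d)\<^sup>2) + (if D < d then M * (1 / (real d)\<^sup>2) else 0))"
        proof (rule sum_mono)
          fix d assume d: "d \<in> {2..m}"
          show "\<bar>F i (t / real d) / (real d)\<^sup>2\<bar> \<le> b * (1 / (real d)\<^sup>2) + (if D < d then M * (1 / (real d)\<^sup>2) else 0)"
          proof (cases "D < d")
            case True
            have "\<bar>F i (t / real d)\<bar> \<le> M" using Fle i elim d by simp
            then show ?thesis using True \<open>0 < b\<close> d
              by (simp add: abs_div divide_simps)
          next
            case False
            have "T * real d \<le> \<bar>T\<bar> * real D" using False d by (intro mult_mono) auto
            then have "T \<le> t / real d" using elim d by (simp add: field_simps)
            then have "\<bar>F i (t / real d)\<bar> \<le> b" using T i by blast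
            then show ?thesis using False by (simp add: abs_div divide_right_mono)
          qed
        qed
        also have "\<dots> = b * (\<Sum>d\<in>{2..m}. 1 / (real d)\<^sup>2) + M * (\<Sum>d\<in>{d\<in>{2..m}. D < d}. 1 / (real d)\<^sup>2)"
          unfolding sum.distrib sum_distrib_left by (subst sum.inter_filter) auto
        also have "{d\<in>{2..m}. D < d} = {Suc D..m}" using D1 by auto
        also have "b * (\<Sum>d\<in>{2..m}. 1 / (real d)\<^sup>2) + M * (\<Sum>d\<in>{Suc D..m}. 1 / (real d)\<^sup>2) \<le> b * (3 / 4) + M * (1 / real D)"
          using sum_inverse_squares_from_2[of m] sum_inverse_squares_tail[OF D1, of m] \<open>0 < b\<close> A
          by (intro add_mono mult_left_mono) (auto simp: M_def)
        finally have 3: "\<bar>\<Sum>d\<in>{2..m}. F i (t / real d) / (real d)\<^sup>2\<bar> \<le> 3 / 4 * b + \<epsilon>" using MD by simp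
        show "\<bar>F i t\<bar> \<le> 7 / 8 * b"
          using 1 2 3 rec[OF elim(2) m' m(2), of i] unfolding \<epsilon>_def by linarith
      qed
    qed
  qed
  have iter: "\<forall>\<^sub>F t in at_top. \<forall>i\<in>I. \<bar>F i t\<bar> \<le> (7 / 8) ^ k * M" for k
  proof (induction k)
    case 0
    show ?case using eventually_gt_at_top[of 0] by eventually_elim (use Fle in auto)
  next
    case (Suc k)
    then show ?case using contract[of "(7 / 8) ^ k * M"] A by (simp add: M_def mult_ac)
  qed
  show ?thesis
  proof (rule uniform_limitI)
    fix e :: real assume "0 < e"
    have "(\<lambda>k. (7 / 8 :: real) ^ k * M) \<longlonglongrightarrow> 0 * M" by (intro tendsto_mult LIMSEQ_power_zero) auto
    then have "\<forall>\<^sub>F k in sequentially. (7 / 8) ^ k * M < e" using order_tendstoD(2) \<open>0 < e\<close> by fastforce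
    then obtain k where k: "(7 / 8) ^ k * M < e" using eventually_happens' sequentially_bot by blast
    show "\<forall>\<^sub>F t in at_top. \<forall>i\<in>I. dist ((\<Sum>z\<in>primitive \<inter> cball 0 (R * t). f i ((1 / t) *\<^sub>R z)) / t\<^sup>2) (a i / zeta2) < e"
      using iter[of k] by eventually_elim (use k in \<open>force simp: F_def P_def dist_real_def\<close>)
  qed
qed auto

section \<open>Riemann sums over the integer lattice\<close>

definition grid :: "real \<Rightarrow> point \<Rightarrow> point" where
  "grid t x = (of_int \<lfloor>t * fst x\<rfloor> / t, of_int \<lfloor>t * snd x\<rfloor> / t)"

lemma grid_measurable [measurable]: "grid t \<in> borel_measurable borel"
proof -
  have "(\<lambda>x::point. real_of_int \<lfloor>t * fst x\<rfloor> / t) \<in> borel_measurable borel"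
    "(\<lambda>x::point. real_of_int \<lfloor>t * snd x\<rfloor> / t) \<in> borel_measurable borel"
    using measurable_compose[OF borel_measurable_continuous_onI borel_measurable_real_floor, of "\<lambda>x::point. t * fst x"]
      measurable_compose[OF borel_measurable_continuous_onI borel_measurable_real_floor, of "\<lambda>x::point. t * snd x"]
    by (simp_all add: continuous_intros)
  then show ?thesis unfolding grid_def by (rule borel_measurable_Pair)
qed

lemma norm_grid_diff: assumes "0 < t" shows "norm (grid t x - x) \<le> 2 / t"
proof -
  have *: "\<bar>of_int \<lfloor>t * a\<rfloor> / t - a\<bar> \<le> 1 / t" for a
  proof -
    have "of_int \<lfloor>t * a\<rfloor> / t - a = (of_int \<lfloor>t * a\<rfloor> - t * a) / t" using assms by (simp add: field_simps)
    moreover have "\<bar>of_int \<lfloor>t * a\<rfloor> - t * a\<bar> \<le> 1" by linarith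
    ultimately show ?thesis using assms by (simp add: abs_div divide_right_mono)
  qed
  have "norm (grid t x - x) \<le> \<bar>fst (grid t x - x)\<bar> + \<bar>snd (grid t x - x)\<bar>"
    by (metis norm_Pair_le prod.collapse real_norm_def)
  also have "\<dots> \<le> 1 / t + 1 / t" using *[of "fst x"] *[of "snd x"] by (intro add_mono) (auto simp: grid_def)
  finally show ?thesis by simp
qed

lemma grid_cell:
  assumes "0 < t"
  shows "{x. grid t x = (1 / t) *\<^sub>R (of_int a, of_int b)} = {of_int a / t..<(of_int a + 1) / t} \<times> {of_int b / t..<(of_int b + 1) / t}"
  using assms by (auto simp: grid_def floor_eq_iff field_simps)

lemma measure_grid_cell:
  assumes "0 < t" "z \<in> \<int> \<times> \<int>"
  shows "measure lborel {x. grid t x = (1 / t) *\<^sub>R z} = 1 / t\<^sup>2" 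
    "emeasure lborel {x. grid t x = (1 / t) *\<^sub>R z} < \<infinity>"
proof -
  obtain a b where z: "z = (of_int a, of_int b)"
    using assms(2) by (cases z) (auto elim!: Ints_cases)
  have "emeasure lborel {x. grid t x = (1 / t) *\<^sub>R z}
      = emeasure (lborel \<Otimes>\<^sub>M lborel) ({of_int a / t..<(of_int a + 1) / t} \<times> {of_int b / t..<(of_int b + 1) / t})"
    unfolding z grid_cell[OF assms(1)] lborel_prod ..
  also have "\<dots> = emeasure lborel {of_int a / t..<(of_int a + 1) / t} * emeasure lborel {of_int b / t..<(of_int b + 1) / t}"
    by (intro lborel.emeasure_pair_measure_Times) auto
  also have "\<dots> = ennreal (1 / t) * ennreal (1 / t)"
    using assms by (simp add: divide_right_mono diff_divide_distrib[symmetric])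
  also have "\<dots> = ennreal (1 / t\<^sup>2)"
    using assms by (simp add: ennreal_mult[symmetric] power2_eq_square)
  finally have e: "emeasure lborel {x. grid t x = (1 / t) *\<^sub>R z} = ennreal (1 / t\<^sup>2)" .
  show "measure lborel {x. grid t x = (1 / t) *\<^sub>R z} = 1 / t\<^sup>2"
    by (simp add: measure_def e)
  show "emeasure lborel {x. grid t x = (1 / t) *\<^sub>R z} < \<infinity>" by (simp add: e)
qed

lemma integral_grid:
  assumes t: "0 < t" and R: "0 < R" and supp: "\<And>x. R < norm x \<Longrightarrow> f x = (0 :: real)"
  shows "(\<integral>x. f (grid t x) \<partial>lborel) = (\<Sum>z\<in>\<int> \<times> \<int> \<inter> cball 0 (R * t). f ((1 / t) *\<^sub>R z)) / t\<^sup>2"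
proof -
  let ?S = "\<int> \<times> \<int> \<inter> cball 0 (R * t) :: point set"
  let ?C = "\<lambda>z. {x. grid t x = (1 / t) *\<^sub>R z}"
  have fin: "finite ?S"
  proof -
    have "?S \<subseteq> insert 0 (lattice \<inter> cball 0 (R * t))" by auto
    moreover have "0 \<le> R * t" using R t by simp
    ultimately show ?thesis using card_lattice_cball(1) finite_subset by blast
  qed
  have eq: "f (grid t x) = (\<Sum>z\<in>?S. f ((1 / t) *\<^sub>R z) * indicat_real (?C z) x)" for x
  proof -
    define w :: point where "w = (of_int \<lfloor>t * fst x\<rfloor>, of_int \<lfloor>t * snd x\<rfloor>)"
    have gw: "grid t x = (1 / t) *\<^sub>R w" by (simp add: w_def grid_def)
    then have ind: "indicat_real (?C z) x = (if z = w then 1 else 0)" for z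
      using t by (auto simp: indicator_def)
    have "(\<Sum>z\<in>?S. f ((1 / t) *\<^sub>R z) * indicat_real (?C z) x) = (if w \<in> ?S then f ((1 / t) *\<^sub>R w) else 0)"
      using fin by (simp add: ind if_distrib sum.delta cong: if_cong)
    also have "\<dots> = f (grid t x)"
    proof (cases "w \<in> ?S")
      case False
      then have "R * t < norm w" by (auto simp: w_def)
      then have "R < norm ((1 / t) *\<^sub>R w)" using t by (simp add: field_simps)
      then show ?thesis using supp False by (simp add: gw)
    qed (simp add: gw)
    finally show ?thesis by simp
  qed
  have meas: "?C z \<in> sets lborel" for z
    using measurable_sets_borel[OF grid_measurable[of t], of "{(1 / t) *\<^sub>R z}"] by (simp add: vimage_def)
  have "(\<integral>x. f (grid t x) \<partial>lborel) = (\<Sum>z\<in>?S. \<integral>x. f ((1 / t) *\<^sub>R z) * indicat_real (?C z) x \<partial>lborel)"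
    unfolding eq 
  proof (rule Bochner_Integration.integral_sum)
    fix z assume "z \<in> ?S"
    then show "integrable lborel (\<lambda>x. f ((1 / t) *\<^sub>R z) * indicat_real (?C z) x)"
      using meas measure_grid_cell(2)[OF t] by (intro integrable_mult_right integrable_real_indicator) auto
  qed
  also have "\<dots> = (\<Sum>z\<in>?S. f ((1 / t) *\<^sub>R z) * (1 / t\<^sup>2))"
    by (rule sum.cong) (use measure_grid_cell(1)[OF t] in auto)
  finally show ?thesis by (simp add: sum_divide_distrib)
qed

text \<open>Riemann sums are integrals of \<open>f (grid t x)\<close>, so joint continuity off a null set and dominated
  convergence give the limit along any convergent sequence of parameters; compactness makes it uniform.\<close>

lemma lattice_riemann_sum:
  fixes f :: "'i::metric_space \<Rightarrow> point \<Rightarrow> real"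
  assumes bound: "\<And>i x. i \<in> I \<Longrightarrow> \<bar>f i x\<bar> \<le> B" and R: "0 < R"
    and supp: "\<And>i x. i \<in> I \<Longrightarrow> R < norm x \<Longrightarrow> f i x = 0"
    and meas: "\<And>i. i \<in> I \<Longrightarrow> f i \<in> borel_measurable borel"
    and I: "compact I"
    and null: "\<And>i. i \<in> I \<Longrightarrow> negligible (N i)"
    and cont: "\<And>i x j y. \<lbrakk>i \<in> I; x \<notin> N i; \<And>k. j k \<in> I; j \<longlonglongrightarrow> i; y \<longlonglongrightarrow> x\<rbrakk> \<Longrightarrow> (\<lambda>k::nat. f (j k) (y k)) \<longlonglongrightarrow> f i x"
  shows "uniform_limit I (\<lambda>t i. (\<Sum>z\<in>lattice \<inter> cball 0 (R * t). f i ((1 / t) *\<^sub>R z)) / t\<^sup>2)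
           (\<lambda>i. \<integral>x. f i x \<partial>lborel) at_top"
proof -
  define G where "G t i = (\<integral>x. f i (grid t x) \<partial>lborel)" for t i
  \<comment> \<open>Stated for general perturbations \<open>y\<close> so that it applies both to
    \<open>grid\<close> and to the identity. As points move by at most 2, the constant B on the ball
    of radius R + 2 dominates.\<close>
  have dct: "(\<lambda>k. \<integral>x. f (j k) (y k x) \<partial>lborel) \<longlonglongrightarrow> (\<integral>x. f i x \<partial>lborel)"
    if i: "i \<in> I" and j: "\<And>k. j k \<in> I" "j \<longlonglongrightarrow> i" and y: "\<And>x. (\<lambda>k. y k x) \<longlonglongrightarrow> x"
      and ymeas: "\<And>k. y k \<in> borel_measurable borel" and ydist: "\<And>k x. norm (y k x - x) \<le> 2"
    for i j and y :: "nat \<Rightarrow> point \<Rightarrow> point"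
  proof (rule integral_dominated_convergence)
    let ?w = "\<lambda>x::point. B * indicat_real (cball 0 (R + 2)) x"
    show "f i \<in> borel_measurable lborel" using meas[OF i] by simp
    show "(\<lambda>x. f (j k) (y k x)) \<in> borel_measurable lborel" for k
      using measurable_compose[OF ymeas meas[OF j(1)]] by simp
    show "integrable lborel ?w"
      by (intro integrable_mult_right integrable_real_indicator emeasure_bounded_finite) auto
    have "AE x in lebesgue. x \<notin> N i"
      using null[OF i] by (intro AE_not_in) (simp add: negligible_iff_null_sets)
    then have "AE x in lborel. x \<notin> N i" by (simp add: AE_completion_iff)
    then show "AE x in lborel. (\<lambda>k. f (j k) (y k x)) \<longlonglongrightarrow> f i x"
    proof eventually_elim
      case (elim x)
      show ?case by (rule cont[OF i elim j y])
    qed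
    show "AE x in lborel. norm (f (j k) (y k x)) \<le> ?w x" for k
    proof (rule AE_I2)
      fix x
      show "norm (f (j k) (y k x)) \<le> ?w x"
      proof (cases "norm x \<le> R + 2")
        case False
        have "norm x \<le> norm (y k x) + norm (y k x - x)"
          by (metis norm_minus_commute norm_triangle_sub)
        then have "R < norm (y k x)" using False ydist[of k x] by linarith
        then show ?thesis using supp j False by simp
      qed (use bound j in simp)
    qed
  qed
  have G_lim: "uniform_limit I G (\<lambda>i. \<integral>x. f i x \<partial>lborel) at_top"
  proof (rule ccontr)
    assume "\<not> ?thesis"
    then obtain e where e: "0 < e" "\<not> (\<forall>\<^sub>F t in at_top. \<forall>i\<in>I. dist (G t i) (\<integral>x. f i x \<partial>lborel) < e)"
      unfolding uniform_limit_iff by blast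
    have "\<exists>t i. real (Suc k) \<le> t \<and> i \<in> I \<and> e \<le> dist (G t i) (\<integral>x. f i x \<partial>lborel)" for k
      using e(2) unfolding eventually_at_top_linorder by (meson not_le)
    then obtain t j where tj: "\<And>k. real (Suc k) \<le> t k" "\<And>k. j k \<in> I" 
      "\<And>k. e \<le> dist (G (t k) (j k)) (\<integral>x. f (j k) x \<partial>lborel)" by metis
    obtain i r where r: "i \<in> I" "strict_mono r" "(j \<circ> r) \<longlonglongrightarrow> i"
      using seq_compactE[OF compact_imp_seq_compact[OF I], of j] tj(2) by blast
    have tr: "real (Suc k) \<le> t (r k)" for k
      using tj(1)[of "r k"] seq_suble[OF r(2), of k] by linarith
    have tr0: "0 < t (r k)" "1 \<le> t (r k)" for k using tr[of k] by linarith+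
    have small: "2 / t (r k) \<le> 2 / real (Suc k)" for k using tr[of k] by (simp add: frac_le)
    have "(\<lambda>k. \<integral>x. f ((j \<circ> r) k) (grid (t (r k)) x) \<partial>lborel) \<longlonglongrightarrow> (\<integral>x. f i x \<partial>lborel)"
    proof (rule dct[OF r(1) _ r(3)])
      show "(\<lambda>k. grid (t (r k)) x) \<longlonglongrightarrow> x" for x
      proof (rule LIM_zero_cancel, rule Lim_null_comparison)
        show "\<forall>\<^sub>F k in sequentially. norm (grid (t (r k)) x - x) \<le> 2 / real (Suc k)"
          by (intro always_eventually allI order_trans[OF norm_grid_diff[OF tr0(1)] small])
        show "(\<lambda>k. 2 / real (Suc k)) \<longlonglongrightarrow> 0"
          by (rule LIMSEQ_Suc[OF lim_const_over_n])
      qed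
      show "norm (grid (t (r k)) x - x) \<le> 2" for k x
      proof -
        have "2 / t (r k) \<le> 2" using tr0[of k] by (simp add: field_simps)
        then show ?thesis using norm_grid_diff[OF tr0(1), of k x] by linarith
      qed
    qed (use tj in auto)
    \<comment> \<open>The limit integral must also converge along the chosen parameters, since the
      failure of uniformity compares both sides at \<open>j (r k)\<close> rather than at
      \<open>i\<close>.\<close>
    moreover have "(\<lambda>k. \<integral>x. f ((j \<circ> r) k) x \<partial>lborel) \<longlonglongrightarrow> (\<integral>x. f i x \<partial>lborel)"
      using dct[OF r(1) _ r(3), of "\<lambda>k x. x"] tj by auto
    ultimately have "(\<lambda>k. dist (G (t (r k)) (j (r k))) (\<integral>x. f (j (r k)) x \<partial>lborel)) \<longlonglongrightarrow> dist (\<integral>x. f i x \<partial>lborel) (\<integral>x. f i x \<partial>lborel)"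
      unfolding G_def comp_def by (rule tendsto_dist)
    then have "e \<le> dist (\<integral>x. f i x \<partial>lborel) (\<integral>x. f i x \<partial>lborel)"
      using tj(3) by (intro LIMSEQ_le_const) auto
    then show False using e by simp
  qed
  \<comment> \<open>The grid integral counts the origin, which \<open>lattice\<close> omits; its
    single term is uniformly negligible.\<close>
  have "uniform_limit I (\<lambda>t i. G t i - f i 0 / t\<^sup>2) (\<lambda>i. (\<integral>x. f i x \<partial>lborel) - 0) at_top"
  proof (intro uniform_limit_minus G_lim uniform_limitI)
    fix e :: real assume "0 < e"
    have "((\<lambda>t. \<bar>B\<bar> / t\<^sup>2) \<longlongrightarrow> 0) at_top" by real_asymp
    then have "\<forall>\<^sub>F t in at_top. \<bar>B\<bar> / t\<^sup>2 < e" using \<open>0 < e\<close> order_tendstoD(2) by blast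
    then show "\<forall>\<^sub>F t in at_top. \<forall>i\<in>I. dist (f i 0 / t\<^sup>2) 0 < e"
    proof eventually_elim
      case (elim t)
      show ?case
      proof
        fix i assume "i \<in> I"
        then have "\<bar>f i 0\<bar> / t\<^sup>2 \<le> \<bar>B\<bar> / t\<^sup>2" using bound[of i 0] by (intro divide_right_mono) auto
        then show "dist (f i 0 / t\<^sup>2) 0 < e" using elim by (simp add: abs_div)
      qed
    qed
  qed
  moreover have "\<forall>\<^sub>F t in at_top. \<forall>i\<in>I. G t i - f i 0 / t\<^sup>2 = (\<Sum>z\<in>lattice \<inter> cball 0 (R * t). f i ((1 / t) *\<^sub>R z)) / t\<^sup>2"
    using eventually_gt_at_top[of 0]
  proof eventually_elim
    case (elim t)
    show ?case
    proof
      fix i assume i: "i \<in> I"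
      have Rt: "0 \<le> R * t" using R elim by simp
      have "\<int> \<times> \<int> \<inter> cball 0 (R * t) = insert 0 (lattice \<inter> cball 0 (R * t))"
        using Rt by (auto simp: zero_prod_def)
      then have "(\<Sum>z\<in>\<int> \<times> \<int> \<inter> cball 0 (R * t). f i ((1 / t) *\<^sub>R z)) = f i 0 + (\<Sum>z\<in>lattice \<inter> cball 0 (R * t). f i ((1 / t) *\<^sub>R z))"
        using card_lattice_cball(1)[OF Rt] by simp
      then show "G t i - f i 0 / t\<^sup>2 = (\<Sum>z\<in>lattice \<inter> cball 0 (R * t). f i ((1 / t) *\<^sub>R z)) / t\<^sup>2"
        using integral_grid[of t R "f i", OF elim R supp[OF i]] by (simp add: G_def add_divide_distrib)
    qed
  qed
  ultimately show ?thesis using uniform_limit_cong[of I "\<lambda>t i. G t i - f i 0 / t\<^sup>2"] by force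
qed

section \<open>Gauges and their sectors\<close>

lemma dist_le_fst_snd: "dist x y \<le> dist (fst x) (fst y) + dist (snd x) (snd y)"
  for x y :: "'a::metric_space \<times> 'b::metric_space"
  by (cases x, cases y) (simp add: dist_Pair_Pair sqrt_sum_squares_le_sum)

text \<open>The whole vertical axis is excluded, so each of the two branches of \<open>pang\<close>
  is treated on an open half plane; the axis is a null set.\<close>

lemma isCont_pang: assumes "fst x \<noteq> 0" shows "isCont pang x"
proof -
  let ?q = "\<lambda>x::point. snd x / (\<bar>fst x\<bar> + \<bar>snd x\<bar>)"
  have q: "isCont ?q x" using assms by (intro continuous_intros) auto
  have op: "open {y::point. 0 < fst y}" "open {y::point. fst y < 0}"
    by (auto intro!: open_Collect_less continuous_intros)
  consider "0 < fst x" | "fst x < 0" using assms by linarith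
  then show ?thesis
  proof cases
    case 1
    then have "\<forall>\<^sub>F y in nhds x. pang y = ?q y"
      using eventually_nhds_in_open[OF op(1), of x] by (auto simp: pang_def lexpos_def elim!: eventually_mono)
    then show ?thesis using q isCont_cong by fastforce
  next
    case 2
    then have "\<forall>\<^sub>F y in nhds x. pang y = 2 - ?q y"
      using eventually_nhds_in_open[OF op(2), of x] by (auto simp: pang_def lexpos_def elim!: eventually_mono)
    moreover have "isCont (\<lambda>y. 2 - ?q y) x" by (intro continuous_diff continuous_const q)
    ultimately show ?thesis using isCont_cong by fastforce
  qed
qed

lemma pang_measurable [measurable]: "pang \<in> borel_measurable borel"
proof -
  have [measurable]: "fst \<in> borel_measurable (borel :: point measure)" "snd \<in> borel_measurable (borel :: point measure)"
    by (auto intro!: borel_measurable_continuous_onI continuous_intros)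
  show ?thesis unfolding pang_def lexpos_def by measurable
qed

lemma negligible_cross2: assumes "a \<noteq> 0" shows "negligible {x. cross2 a x = 0}"
proof -
  have "{x. cross2 a x = 0} = {x. inner (- snd a, fst a) x = 0}"
    by (auto simp: cross2_def inner_prod_def)
  moreover have "(- snd a, fst a) \<noteq> 0" using assms by (auto simp: zero_prod_def prod_eq_iff)
  ultimately show ?thesis using negligible_hyperplane by metis
qed

lemma negligible_pang_eq: "negligible {x. pang x = \<theta>}"
proof (cases "\<exists>a. a \<noteq> 0 \<and> pang a = \<theta>")
  case True
  then obtain a where a: "a \<noteq> 0" "pang a = \<theta>" by blast
  have "cross2 a x = 0" if x: "pang x = \<theta>" for x
  proof (cases "x = 0")
    case False
    then obtain c where "x = c *\<^sub>R a" using pang_eq_parallel[OF a(1) False] x a(2) by metis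
    then show ?thesis by (simp add: cross2_simps)
  qed (simp add: cross2_simps)
  then show ?thesis by (intro negligible_subset[OF negligible_cross2[OF a(1)]]) auto
next
  case False
  then have "{x. pang x = \<theta>} \<subseteq> {0}" by auto
  then show ?thesis by (rule negligible_subset[rotated]) simp
qed

text \<open>A possibly non-symmetric norm. The comparison constants are parameters because tilting
  by a linear functional changes them.\<close>

locale gauge =
  fixes g :: "point \<Rightarrow> real" and m M :: real
  assumes m_pos: "0 < m" and add: "g (x + y) \<le> g x + g y" 
    and scale: "0 \<le> c \<Longrightarrow> g (c *\<^sub>R x) = c * g x"
    and lower: "m * norm x \<le> g x" and upper: "g x \<le> M * norm x"
begin

lemma M_pos: "0 < M"
proof -
  have "m \<le> M" using lower[of "(1, 0)"] upper[of "(1, 0)"] by simp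
  then show ?thesis using m_pos by linarith
qed

lemma g_0 [simp]: "g 0 = 0"
  using scale[of 0 0] by simp

lemma g_nonneg: "0 \<le> g x"
  using lower[of x] m_pos by (meson mult_nonneg_nonneg norm_ge_zero less_imp_le order_trans)

lemma g_lipschitz: "\<bar>g x - g y\<bar> \<le> M * norm (x - y)"
proof -
  have "g x \<le> g y + g (x - y)" "g y \<le> g x + g (y - x)" using add[of y "x - y"] add[of x "y - x"] by auto
  then show ?thesis using upper[of "x - y"] upper[of "y - x"] by (simp add: norm_minus_commute)
qed

lemma continuous_g: "continuous_on A g"
proof (rule continuous_on_subset[OF lipschitz_on_continuous_on[of M UNIV]])
  show "M-lipschitz_on UNIV g"
    using g_lipschitz M_pos by (intro lipschitz_onI) (auto simp: dist_norm)
qed simp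

lemma norm_le: "g x \<le> t \<Longrightarrow> norm x \<le> t / m"
  using lower[of x] m_pos by (simp add: field_simps)

lemma g_measurable [measurable]: "g \<in> borel_measurable borel"
  by (intro borel_measurable_continuous_onI continuous_g)

text \<open>The level set lies in the frontier of the convex body, since scaling up slightly leaves
  the body.\<close>

lemma negligible_level: "negligible {x. g x = 1}"
proof -
  have "convex {x. g x \<le> 1}"
  proof (rule convexI)
    fix x y :: point and u v :: real assume *: "x \<in> {x. g x \<le> 1}" "y \<in> {x. g x \<le> 1}" "0 \<le> u" "0 \<le> v" "u + v = 1"
    have "g (u *\<^sub>R x + v *\<^sub>R y) \<le> u * g x + v * g y" using add scale * by metis
    also have "\<dots> \<le> u * 1 + v * 1" using * by (intro add_mono mult_left_mono) auto
    finally show "u *\<^sub>R x + v *\<^sub>R y \<in> {x. g x \<le> 1}" using * by simp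
  qed
  moreover have "{x. g x = 1} \<subseteq> frontier {x. g x \<le> 1}"
  proof
    fix x assume "x \<in> {x. g x = 1}"
    then have x: "g x = 1" by simp
    have "x \<notin> interior {x. g x \<le> 1}"
    proof
      assume "x \<in> interior {x. g x \<le> 1}"
      then obtain e where e: "0 < e" "cball x e \<subseteq> {x. g x \<le> 1}" using mem_interior_cball by blast
      have "x \<noteq> 0" using x by auto
      then have "(1 + e / norm x) *\<^sub>R x \<in> cball x e" using e by (simp add: dist_norm algebra_simps)
      then have "g ((1 + e / norm x) *\<^sub>R x) \<le> 1" using e by auto
      moreover have "0 < e / norm x" using e \<open>x \<noteq> 0\<close> by simp
      ultimately show False using scale[of "1 + e / norm x" x] x by simp
    qed
    then show "x \<in> frontier {x. g x \<le> 1}"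
      using x closure_subset[of "{x. g x \<le> 1}"] by (auto simp: frontier_def)
  qed
  ultimately show ?thesis using negligible_convex_frontier negligible_subset by blast
qed

text \<open>Weight 1 serves to count vectors; the weights \<open>fst\<close> and \<open>snd\<close>
  give first moments of the sector.\<close>

definition sector_fun :: "(point \<Rightarrow> real) \<Rightarrow> real \<Rightarrow> point \<Rightarrow> real" where
  "sector_fun w \<theta> x = (if g x \<le> 1 \<and> pang x \<le> \<theta> then w x else 0)"

lemma sector_fun_measurable [measurable]:
  assumes "continuous_on UNIV w" shows "sector_fun w \<theta> \<in> borel_measurable borel"
proof -
  have [measurable]: "w \<in> borel_measurable borel" using assms by (rule borel_measurable_continuous_onI)
  show ?thesis unfolding sector_fun_def by measurable
qed

definition prims :: "real \<Rightarrow> point set" where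
  "prims t = {z \<in> primitive. g z \<le> t}"

lemma finite_prims: "finite (prims t)"
proof (cases "0 \<le> t")
  case True
  have "prims t \<subseteq> lattice \<inter> cball 0 (t / m)"
    using norm_le primitive_lattice by (auto simp: prims_def simp del: mem_Times_iff)
  moreover have "finite (lattice \<inter> cball 0 (t / m))" using True m_pos by (intro card_lattice_cball(1)) simp
  ultimately show ?thesis by (rule finite_subset)
next
  case False
  then have "prims t = {}" unfolding prims_def using g_nonneg by (auto intro: order_trans)
  then show ?thesis by simp
qed

text \<open>Discontinuities are confined to three null sets: the boundary of the body, the ray at
  \<theta> and the vertical axis. The Riemann sums need a compact parameter set, here {-1..3}; any
  other \<theta> cuts out the same sector as its nearest endpoint, so uniformity extends to all
  reals.\<close>

lemma sector_density:
  assumes w: "continuous_on UNIV w"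
  shows "uniform_limit UNIV (\<lambda>t \<theta>. (\<Sum>z\<in>{z \<in> prims t. pang z \<le> \<theta>}. w ((1 / t) *\<^sub>R z)) / t\<^sup>2)
           (\<lambda>\<theta>. (\<integral>x. sector_fun w \<theta> x \<partial>lborel) / zeta2) at_top"
proof -
  define R where "R = 1 / m"
  have R: "0 < R" using m_pos by (simp add: R_def)
  have gR: "1 < g x" if "R < norm x" for x
  proof -
    have "1 < m * norm x" using that m_pos by (simp add: R_def field_simps)
    then show ?thesis using lower[of x] by linarith
  qed
  have "compact (w ` cball 0 R)" using w by (intro compact_continuous_image) (auto intro: continuous_on_subset)
  then obtain B where B: "\<And>x. x \<in> cball 0 R \<Longrightarrow> \<bar>w x\<bar> \<le> B"
    using compact_imp_bounded bounded_iff by (metis imageI real_norm_def)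
  have B0: "0 \<le> B" using B[of 0] R abs_ge_zero order_trans by (metis centre_in_cball less_imp_le)
  have bound: "\<bar>sector_fun w \<theta> x\<bar> \<le> B" for \<theta> x
    using B[of x] gR[of x] B0 by (auto simp: sector_fun_def not_le[symmetric])
  have supp: "sector_fun w \<theta> x = 0" if "R < norm x" for \<theta> x
    using gR[OF that] by (simp add: sector_fun_def)
  have 1: "uniform_limit {- 1..3} (\<lambda>t \<theta>. (\<Sum>z\<in>lattice \<inter> cball 0 (R * t). sector_fun w \<theta> ((1 / t) *\<^sub>R z)) / t\<^sup>2)
      (\<lambda>\<theta>. \<integral>x. sector_fun w \<theta> x \<partial>lborel) at_top"
  proof (rule lattice_riemann_sum[OF bound R supp sector_fun_measurable[OF w] compact_Icc,
        where N = "\<lambda>\<theta>. {x. g x = 1} \<union> {x. cross2 (0, 1) x = 0} \<union> {x. pang x = \<theta>}"])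
    fix \<theta> x j and y :: "nat \<Rightarrow> point"
    assume x: "x \<notin> {x. g x = 1} \<union> {x. cross2 (0, 1) x = 0} \<union> {x. pang x = \<theta>}"
      and j: "j \<longlonglongrightarrow> \<theta>" and y: "y \<longlonglongrightarrow> x"
    have gy: "(\<lambda>k. g (y k)) \<longlonglongrightarrow> g x"
      by (rule continuous_on_tendsto_compose[OF continuous_g[of UNIV] y]) auto
    have wy: "(\<lambda>k. w (y k)) \<longlonglongrightarrow> w x"
      by (rule continuous_on_tendsto_compose[OF w y]) auto
    have "fst x \<noteq> 0" using x by (simp add: cross2_def)
    then have "(\<lambda>k. pang (y k)) \<longlonglongrightarrow> pang x" using isCont_pang y isCont_tendsto_compose by blast
    then have py: "(\<lambda>k. pang (y k) - j k) \<longlonglongrightarrow> pang x - \<theta>" using j by (intro tendsto_diff)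
    consider "1 < g x" | "0 < pang x - \<theta>" | "g x < 1" "pang x - \<theta> < 0" using x by (simp) linarith
    then show "(\<lambda>k. sector_fun w (j k) (y k)) \<longlonglongrightarrow> sector_fun w \<theta> x"
    proof cases
      case 1
      have "\<forall>\<^sub>F k in sequentially. sector_fun w (j k) (y k) = 0"
        using order_tendstoD(1)[OF gy 1] by eventually_elim (simp add: sector_fun_def)
      then show ?thesis using 1 tendsto_eventually by (fastforce simp: sector_fun_def)
    next
      case 2
      have "\<forall>\<^sub>F k in sequentially. sector_fun w (j k) (y k) = 0"
        using order_tendstoD(1)[OF py 2] by eventually_elim (simp add: sector_fun_def)
      then show ?thesis using 2 tendsto_eventually by (fastforce simp: sector_fun_def)
    next
      case 3
      have "\<forall>\<^sub>F k in sequentially. w (y k) = sector_fun w (j k) (y k)"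
        using order_tendstoD(2)[OF gy 3(1)] order_tendstoD(2)[OF py 3(2)]
        by eventually_elim (simp add: sector_fun_def)
      then have "(\<lambda>k. sector_fun w (j k) (y k)) \<longlonglongrightarrow> w x" using wy tendsto_cong by fast
      then show ?thesis using 3 by (simp add: sector_fun_def)
    qed
  qed (auto intro!: negligible_Un negligible_level negligible_cross2 negligible_pang_eq simp: zero_prod_def)
  have 2: "uniform_limit {- 1..3} (\<lambda>t \<theta>. (\<Sum>z\<in>primitive \<inter> cball 0 (R * t). sector_fun w \<theta> ((1 / t) *\<^sub>R z)) / t\<^sup>2)
      (\<lambda>\<theta>. (\<integral>x. sector_fun w \<theta> x \<partial>lborel) / zeta2) at_top"
    by (rule primitive_density[OF bound R 1])
  have clamp: "pang z \<le> max (- 1) (min 3 \<theta>) \<longleftrightarrow> pang z \<le> \<theta>" for z \<theta>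
    using pang_bounds[of z] by auto
  have sf: "sector_fun w (max (- 1) (min 3 \<theta>)) = sector_fun w \<theta>" for \<theta>
    by (simp add: sector_fun_def clamp fun_eq_iff)
  have sum_eq: "(\<Sum>z\<in>primitive \<inter> cball 0 (R * t). sector_fun w \<theta> ((1 / t) *\<^sub>R z))
      = (\<Sum>z\<in>{z \<in> prims t. pang z \<le> \<theta>}. w ((1 / t) *\<^sub>R z))" if t: "0 < t" for t \<theta>
  proof -
    have "0 \<le> R * t" using R t by simp
    then have fin: "finite (primitive \<inter> cball 0 (R * t))"
      using card_lattice_cball(1) primitive_lattice by (meson Int_mono finite_subset order_refl)
    have g1: "g ((1 / t) *\<^sub>R z) \<le> 1 \<longleftrightarrow> g z \<le> t" for z
      using t scale[of "1 / t" z] by (simp add: pos_divide_le_eq)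
    have p1: "pang ((1 / t) *\<^sub>R z) = pang z" for z using t by (simp add: pang_scaleR)
    have "{z \<in> prims t. pang z \<le> \<theta>} \<subseteq> primitive \<inter> cball 0 (R * t)"
      using norm_le by (auto simp: prims_def R_def)
    then show ?thesis
      using fin by (intro sum.mono_neutral_cong_right) (auto simp: prims_def sector_fun_def g1 p1)
  qed
  show ?thesis
  proof (rule uniform_limitI)
    fix e :: real assume "0 < e"
    from uniform_limitD[OF 2 this] eventually_gt_at_top[of 0]
    show "\<forall>\<^sub>F t in at_top. \<forall>\<theta>\<in>UNIV. dist ((\<Sum>z\<in>{z \<in> prims t. pang z \<le> \<theta>}. w ((1 / t) *\<^sub>R z)) / t\<^sup>2)
        ((\<integral>x. sector_fun w \<theta> x \<partial>lborel) / zeta2) < e"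
    proof eventually_elim
      case (elim t)
      show ?case
      proof
        fix \<theta> :: real
        have "max (- 1) (min 3 \<theta>) \<in> {- 1..3}" by auto
        from elim(1)[rule_format, OF this] show "dist ((\<Sum>z\<in>{z \<in> prims t. pang z \<le> \<theta>}. w ((1 / t) *\<^sub>R z)) / t\<^sup>2)
        ((\<integral>x. sector_fun w \<theta> x \<partial>lborel) / zeta2) < e"
          unfolding sum_eq[OF elim(2)] clamp sf .
      qed
    qed
  qed
qed

text \<open>The area of the body over \<open>zeta2\<close>, since \<open>pang\<close> never exceeds
  3.\<close>

definition \<beta> :: real where "\<beta> = (\<integral>x. sector_fun (\<lambda>x. 1) 3 x \<partial>lborel) / zeta2"

text \<open>First moments of the sectors over \<open>zeta2\<close>: up to scale, the curve of the
  limiting vertices. \<open>J 3\<close> is the moment of the whole body and vanishes exactly when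
  the centroid is at the origin.\<close>

definition J :: "real \<Rightarrow> point" where
  "J \<theta> = ((\<integral>x. sector_fun fst \<theta> x \<partial>lborel) / zeta2, (\<integral>x. sector_fun snd \<theta> x \<partial>lborel) / zeta2)"

lemma prims_sector_3: "{z \<in> prims t. pang z \<le> 3} = prims t"
  using pang_bounds by auto

lemma card_prims_limit: "((\<lambda>t. card (prims t) / t\<^sup>2) \<longlongrightarrow> \<beta>) at_top"
proof -
  have "((\<lambda>t. (\<Sum>z\<in>{z \<in> prims t. pang z \<le> 3}. 1) / t\<^sup>2) \<longlongrightarrow> \<beta>) at_top"
    unfolding \<beta>_def by (rule tendsto_uniform_limitI[OF sector_density]) auto
  then show ?thesis unfolding prims_sector_3 by simp
qed

lemma beta_pos: "0 < \<beta>"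
proof -
  have eq: "sector_fun (\<lambda>x. 1) 3 = indicat_real {x. g x \<le> 1}"
    using pang_bounds by (auto simp: sector_fun_def indicator_def fun_eq_iff)
  have bnd: "{x. g x \<le> 1} \<subseteq> cball 0 (1 / m)" using norm_le by auto
  have meas: "{x. g x \<le> 1} \<in> sets borel" by measurable
  have sub: "ball 0 (1 / M) \<subseteq> {x. g x \<le> 1}"
  proof
    fix x :: point assume "x \<in> ball 0 (1 / M)"
    then have "M * norm x \<le> 1" using M_pos by (simp add: field_simps)
    then show "x \<in> {x. g x \<le> 1}" using upper[of x] by simp
  qed
  have fin: "emeasure lborel {x. g x \<le> 1} < \<infinity>"
    using bnd by (intro emeasure_bounded_finite bounded_subset[OF bounded_cball])
  have "0 < measure lborel (ball (0::point) (1 / M))" using M_pos by (intro content_ball_pos) auto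
  also have "\<dots> \<le> measure lborel {x. g x \<le> 1}"
    using sub meas fin by (intro measure_mono_fmeasurable) (auto simp: fmeasurable_def)
  finally show ?thesis unfolding \<beta>_def eq using zeta2_ge_1 meas by simp
qed

text \<open>\<open>sector_density\<close> with the two coordinates as weights; their linearity moves
  the inner factor 1 / t out, which turns t^2 into t^3.\<close>

lemma sector_sum_limit:
  "uniform_limit UNIV (\<lambda>t \<theta>. (1 / t ^ 3) *\<^sub>R \<Sum>{z \<in> prims t. pang z \<le> \<theta>}) J at_top"
proof (rule uniform_limitI)
  fix e :: real assume "0 < e"
  then have e: "0 < e / 2" by simp
  have c: "continuous_on UNIV (fst :: point \<Rightarrow> real)" "continuous_on UNIV (snd :: point \<Rightarrow> real)"
    by (auto intro!: continuous_intros)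
  have conv: "(\<Sum>z\<in>S. w ((1 / t) *\<^sub>R z)) / t\<^sup>2 = w ((1 / t ^ 3) *\<^sub>R \<Sum>S)" 
    if "bounded_linear w" for w :: "point \<Rightarrow> real" and S t
  proof -
    interpret bounded_linear w by fact
    show ?thesis by (simp add: scale sum sum_divide_distrib sum_distrib_left power3_eq_cube power2_eq_square scaleR mult.assoc)
  qed
  note conv = conv[OF bounded_linear_fst] conv[OF bounded_linear_snd]
  have ev: "\<forall>\<^sub>F t in at_top. \<forall>\<theta>. dist (fst ((1 / t ^ 3) *\<^sub>R \<Sum>{z \<in> prims t. pang z \<le> \<theta>})) (fst (J \<theta>)) < e / 2"
    "\<forall>\<^sub>F t in at_top. \<forall>\<theta>. dist (snd ((1 / t ^ 3) *\<^sub>R \<Sum>{z \<in> prims t. pang z \<le> \<theta>})) (snd (J \<theta>)) < e / 2"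
    using uniform_limitD[OF sector_density[OF c(1)] e] uniform_limitD[OF sector_density[OF c(2)] e]
    unfolding conv J_def fst_conv snd_conv by auto
  then show "\<forall>\<^sub>F t in at_top. \<forall>\<theta>\<in>UNIV. dist ((1 / t ^ 3) *\<^sub>R \<Sum>{z \<in> prims t. pang z \<le> \<theta>}) (J \<theta>) < e"
  proof eventually_elim
    case (elim t)
    show ?case
    proof
      fix \<theta>
      let ?s = "(1 / t ^ 3) *\<^sub>R \<Sum>{z \<in> prims t. pang z \<le> \<theta>}"
      have "dist ?s (J \<theta>) \<le> dist (fst ?s) (fst (J \<theta>)) + dist (snd ?s) (snd (J \<theta>))"
        by (rule dist_le_fst_snd)
      also have "\<dots> < e / 2 + e / 2"
        using elim by (intro add_strict_mono) blast+
      finally show "dist ?s (J \<theta>) < e" by simp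
    qed
  qed
qed

end

section \<open>Tilting a gauge to centre its body\<close>

context gauge
begin

text \<open>The explicit margin \<open>r\<close> keeps the tilted function a gauge and makes the set
  compact.\<close>

definition tilts :: "real \<Rightarrow> point set" where
  "tilts r = {u. \<forall>z. r * norm z \<le> g z - u \<bullet> z}"

text \<open>The height of a cone of height 1 over the tilted body. Unlike the indicator of the body
  it is continuous in \<open>u\<close>, and also convex, so differentiating its integral produces no
  boundary term.\<close>

definition cap :: "point \<Rightarrow> point \<Rightarrow> real" where
  "cap u z = max 0 (1 - (g z - u \<bullet> z))"

definition capint :: "point \<Rightarrow> real" where
  "capint u = (\<integral>z. cap u z \<partial>lborel)"

lemma tilts_0: "0 \<in> tilts m"
  using lower by (simp add: tilts_def)

lemma tiltsD: "u \<in> tilts r \<Longrightarrow> r * norm z \<le> g z - u \<bullet> z"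
  unfolding tilts_def by blast

lemma gauge_tilt: assumes "0 < r" "u \<in> tilts r" shows "gauge (\<lambda>z. g z - u \<bullet> z) r (M + norm u)"
proof
  show "g (x + y) - u \<bullet> (x + y) \<le> g x - u \<bullet> x + (g y - u \<bullet> y)" for x y
    using add[of x y] by (simp add: inner_add_right)
  show "g (c *\<^sub>R x) - u \<bullet> c *\<^sub>R x = c * (g x - u \<bullet> x)" if "0 \<le> c" for c x
    using scale[OF that] by (simp add: algebra_simps)
  show "r * norm x \<le> g x - u \<bullet> x" for x using assms(2) by (rule tiltsD)
  show "g x - u \<bullet> x \<le> (M + norm u) * norm x" for x
    using upper[of x] Cauchy_Schwarz_ineq2[of u x] by (simp add: algebra_simps abs_le_iff)
qed (use assms in auto)

lemma norm_tilt: assumes "0 < r" "u \<in> tilts r" shows "norm u \<le> M"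
proof -
  have "r * norm u \<le> g u - u \<bullet> u" using assms(2) by (rule tiltsD)
  moreover have "0 \<le> r * norm u" using assms by simp
  ultimately have "norm u * norm u \<le> M * norm u"
    using upper[of u] power2_norm_eq_inner[of u] unfolding power2_eq_square by linarith
  then show ?thesis using M_pos by (cases "u = 0") auto
qed

lemma cap_bounds:
  assumes "0 < r" "u \<in> tilts r" shows "0 \<le> cap u z" "cap u z \<le> indicat_real (cball 0 (1 / r)) z"
proof -
  interpret t: gauge "\<lambda>z. g z - u \<bullet> z" r "M + norm u" by (rule gauge_tilt[OF assms])
  show "0 \<le> cap u z" by (simp add: cap_def)
  show "cap u z \<le> indicat_real (cball 0 (1 / r)) z"
  proof (cases "g z - u \<bullet> z \<le> 1")
    case True
    then show ?thesis using t.g_nonneg[of z] t.norm_le[of z 1] by (simp add: cap_def)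
  next
    case False
    then have "cap u z = 0" unfolding cap_def by linarith
    then show ?thesis by simp
  qed
qed

lemma cap_measurable [measurable]: "cap u \<in> borel_measurable borel"
  unfolding cap_def by (intro borel_measurable_continuous_onI continuous_intros continuous_g)

lemma integrable_ball: "integrable lborel (indicat_real (cball (0::point) r))" for r :: real
  by (intro integrable_real_indicator emeasure_bounded_finite) auto

lemma integrable_mult_ball: "integrable lborel (\<lambda>z. c * indicat_real (cball (0::point) r) z)" for c r :: real
  using integrable_ball[of r] by simp

lemma integrable_cap:
  assumes "0 < r" "u \<in> tilts r" shows "integrable lborel (cap u)"
  by (rule Bochner_Integration.integrable_bound[OF integrable_ball[of "1 / r"]])
    (use cap_bounds[OF assms] in \<open>auto intro!: AE_I2\<close>)

text \<open>If \<open>g z - u \<bullet> z\<close> is tiny in some direction, the set where it is at most \<open>1/2\<close> contains many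
  disjoint balls of a fixed radius in that direction.\<close>

lemma capint_coercive:
  obtains r where "0 < r" "\<And>r' u. 0 < r' \<Longrightarrow> u \<in> tilts r' \<Longrightarrow> capint u \<le> C \<Longrightarrow> u \<in> tilts r"
proof -
  \<comment> \<open>With norm u at most M, a step of length \<rho> raises the tilted gauge by at
    most 1/4. The later choice of \<open>r\<close> keeps it at most 1/4 at the N centres, so
    \<open>cap\<close> is at least 1/2 on all the balls. N makes the resulting N v / 2 exceed
    C.\<close>
  define \<rho> where "\<rho> = 1 / (8 * M)"
  have \<rho>: "0 < \<rho>" using M_pos by (simp add: \<rho>_def)
  define v where "v = measure lborel (ball (0::point) \<rho>)"
  have v: "0 < v" unfolding v_def using \<rho> by (rule content_ball_pos)
  obtain N :: nat where N: "2 * \<bar>C\<bar> / v < real N" using reals_Archimedean2 by blast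
  have N0: "0 < real N" using N v by (smt (verit) divide_nonneg_pos)
  define r where "r = 1 / (8 * \<rho> * real N)"
  have r: "0 < r" using \<rho> N0 by (simp add: r_def)
  have main: "r \<le> g z0 - u \<bullet> z0" if u: "0 < r'" "u \<in> tilts r'" "capint u \<le> C" and z0: "norm z0 = 1" for r' u z0
  proof (rule ccontr)
    interpret t: gauge "\<lambda>z. g z - u \<bullet> z" r' "M + norm u" by (rule gauge_tilt[OF u(1,2)])
    assume "\<not> ?thesis"
    then have less: "g z0 - u \<bullet> z0 < r" by simp
    define c where "c k = (real k * (2 * \<rho>)) *\<^sub>R z0" for k
    let ?U = "\<Union>k\<in>{..<N}. ball (c k) \<rho>"
    have disj: "disjoint_family_on (\<lambda>k. ball (c k) \<rho>) {..<N}"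
      unfolding disjoint_family_on_def
    proof (intro ballI impI)
      fix a b :: nat assume "a \<noteq> b"
      have "1 \<le> \<bar>real a - real b\<bar>" using \<open>a \<noteq> b\<close> by linarith
      then have "1 * (2 * \<rho>) \<le> \<bar>real a - real b\<bar> * (2 * \<rho>)" using \<rho> by (intro mult_right_mono) auto
      moreover have "dist (c a) (c b) = \<bar>real a - real b\<bar> * (2 * \<rho>)"
        using z0 \<rho> by (simp add: c_def dist_norm abs_mult flip: scaleR_diff_left left_diff_distrib)
      ultimately show "ball (c a) \<rho> \<inter> ball (c b) \<rho> = {}" by (intro disjoint_ballI) simp
    qed
    have fin: "emeasure lborel (ball (c k) \<rho>) \<noteq> \<infinity>" for k
      using emeasure_bounded_finite[OF bounded_ball, of "c k" \<rho>] by simp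
    have "measure lborel ?U = (\<Sum>k<N. measure lborel (ball (c k) \<rho>))"
      by (rule measure_finite_Union) (use fin disj in auto)
    also have "\<dots> = real N * v" using \<rho> by (simp add: v_def content_ball)
    finally have mU: "measure lborel ?U = real N * v" .
    have half: "1 / 2 * indicat_real ?U z \<le> cap u z" for z
    proof (cases "z \<in> ?U")
      case True
      then obtain k where k: "k < N" "dist (c k) z < \<rho>" by auto
      have "g z - u \<bullet> z \<le> (g (c k) - u \<bullet> c k) + (g (z - c k) - u \<bullet> (z - c k))"
        using t.add[of "c k" "z - c k"] by simp
      also have "g (c k) - u \<bullet> c k = real k * (2 * \<rho>) * (g z0 - u \<bullet> z0)"
        unfolding c_def using \<rho> by (intro t.scale) auto
      also have "real k * (2 * \<rho>) * (g z0 - u \<bullet> z0) \<le> real N * (2 * \<rho>) * r"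
        using less k \<rho> t.g_nonneg[of z0] by (intro mult_mono mult_right_mono) auto
      also have "real N * (2 * \<rho>) * r = 1 / 4" using \<rho> N0 by (simp add: r_def)
      also have "g (z - c k) - u \<bullet> (z - c k) \<le> (M + norm u) * norm (z - c k)" by (rule t.upper)
      also have "\<dots> \<le> (M + M) * \<rho>"
        using k norm_tilt[OF u(1,2)] M_pos by (intro mult_mono) (auto simp: dist_norm norm_minus_commute)
      also have "(M + M) * \<rho> = 1 / 4" using M_pos by (simp add: \<rho>_def)
      finally have "g z - u \<bullet> z \<le> 1 / 2" by simp
      then show ?thesis using True by (simp add: cap_def)
    qed (simp add: cap_def)
    have "real N * v / 2 = (\<integral>z. 1 / 2 * indicat_real ?U z \<partial>lborel)"
      by (simp add: mU)
    also have "\<dots> \<le> capint u"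
      unfolding capint_def
    proof (rule integral_mono)
      have "emeasure lborel ?U < \<infinity>" by (intro emeasure_bounded_finite bounded_UN) auto
      then show "integrable lborel (\<lambda>z. 1 / 2 * indicat_real ?U z)"
        by (intro integrable_mult_right integrable_real_indicator) auto
    qed (use integrable_cap u half in auto)
    finally have "real N * v / 2 \<le> C" using u by simp
    then show False using N v by (simp add: field_simps)
  qed
  have "u \<in> tilts r" if u: "0 < r'" "u \<in> tilts r'" "capint u \<le> C" for r' u
  proof -
    interpret t: gauge "\<lambda>z. g z - u \<bullet> z" r' "M + norm u" by (rule gauge_tilt[OF u(1,2)])
    have "r * norm z \<le> g z - u \<bullet> z" for z
    proof (cases "z = 0")
      case False
      have "norm z *\<^sub>R ((1 / norm z) *\<^sub>R z) = z" using False by simp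
      then have "g z - u \<bullet> z = norm z * (g ((1 / norm z) *\<^sub>R z) - u \<bullet> ((1 / norm z) *\<^sub>R z))"
        using t.scale[of "norm z" "(1 / norm z) *\<^sub>R z"] by simp
      moreover have "r \<le> g ((1 / norm z) *\<^sub>R z) - u \<bullet> ((1 / norm z) *\<^sub>R z)"
        by (rule main[OF u]) (use False in simp)
      ultimately show ?thesis by (metis mult.commute mult_left_mono norm_ge_zero)
    qed simp
    then show ?thesis by (simp add: tilts_def)
  qed
  with r show ?thesis by (rule that)
qed

lemma compact_tilts: assumes "0 < r" shows "compact (tilts r)"
  unfolding compact_eq_bounded_closed
proof
  show "bounded (tilts r)" by (rule boundedI[OF norm_tilt[OF assms]])
  have "tilts r = (\<Inter>z. {u. r * norm z \<le> g z - u \<bullet> z})" by (auto simp: tilts_def)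
  then show "closed (tilts r)" 
    by (auto intro!: closed_INT closed_Collect_le continuous_intros)
qed

lemma continuous_capint: assumes r: "0 < r" shows "continuous_on (tilts r) capint"
proof -
  define L where "L = measure lborel (cball (0::point) (1 / r)) / r"
  have "\<bar>capint u - capint u'\<bar> \<le> L * norm (u - u')" if u: "u \<in> tilts r" "u' \<in> tilts r" for u u'
  proof -
    have *: "\<bar>cap u z - cap u' z\<bar> \<le> norm (u - u') / r * indicat_real (cball 0 (1 / r)) z" for z
    proof (cases "z \<in> cball 0 (1 / r)")
      case True
      have "\<bar>cap u z - cap u' z\<bar> \<le> \<bar>(u - u') \<bullet> z\<bar>" by (auto simp: cap_def max_def inner_diff_left)
      also have "\<dots> \<le> norm (u - u') * norm z" by (rule Cauchy_Schwarz_ineq2)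
      also have "\<dots> \<le> norm (u - u') * (1 / r)" using True by (intro mult_left_mono) auto
      finally show ?thesis using True by simp
    next
      case False
      then show ?thesis
        using cap_bounds[OF r u(1), of z] cap_bounds[OF r u(2), of z] by simp
    qed
    have "\<bar>capint u - capint u'\<bar> = \<bar>\<integral>z. cap u z - cap u' z \<partial>lborel\<bar>"
      unfolding capint_def using integrable_cap[OF r] u by simp
    also have "\<dots> \<le> (\<integral>z. \<bar>cap u z - cap u' z\<bar> \<partial>lborel)" by (rule integral_abs_bound)
    also have "\<dots> \<le> (\<integral>z. norm (u - u') / r * indicat_real (cball (0::point) (1 / r)) z \<partial>lborel)"
    proof (rule integral_mono[OF _ integrable_mult_ball])
      show "integrable lborel (\<lambda>z. \<bar>cap u z - cap u' z\<bar>)"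
        by (intro integrable_abs Bochner_Integration.integrable_diff integrable_cap[OF r] u)
    qed (rule *)
    also have "\<dots> = L * norm (u - u')" by (simp add: L_def)
    finally show ?thesis .
  qed
  moreover have "0 \<le> L" using r by (simp add: L_def)
  ultimately have "L-lipschitz_on (tilts r) capint"
    by (intro lipschitz_onI) (auto simp: dist_norm)
  then show ?thesis by (rule lipschitz_on_continuous_on)
qed

text \<open>Coercivity at the value \<open>capint 0\<close> puts all relevant tilts into one compact
  set. Minimality against every margin is what allows perturbing \<open>u\<close> in all directions
  afterwards.\<close>

lemma exists_minimal_tilt:
  obtains r u where "0 < r" "u \<in> tilts r" "\<And>r' u'. 0 < r' \<Longrightarrow> u' \<in> tilts r' \<Longrightarrow> capint u \<le> capint u'"
proof -
  obtain r where r: "0 < r" "\<And>r' u. 0 < r' \<Longrightarrow> u \<in> tilts r' \<Longrightarrow> capint u \<le> capint 0 \<Longrightarrow> u \<in> tilts r"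
    by (rule capint_coercive[of "capint 0"]) blast
  have 0: "0 \<in> tilts r" using r(2)[OF m_pos tilts_0] by simp
  obtain u where u: "u \<in> tilts r" "\<And>u'. u' \<in> tilts r \<Longrightarrow> capint u \<le> capint u'"
    using continuous_attains_inf[OF compact_tilts[OF r(1)] _ continuous_capint[OF r(1)]] 0 by blast
  have "capint u \<le> capint u'" if u': "0 < r'" "u' \<in> tilts r'" for r' u'
  proof (cases "capint u' \<le> capint 0")
    case True
    then show ?thesis using u(2) r(2)[OF u'] by simp
  next
    case False
    then show ?thesis using u(2)[OF 0] by simp
  qed
  with r(1) u(1) show ?thesis by (rule that)
qed

text \<open>The derivative of \<open>capint\<close> in direction \<open>v\<close> is the integral of \<open>v \<bullet> z\<close> over the tilted gauge body,
  so the body has its centroid at the origin for the minimal tilt.\<close>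

lemma exists_centred_tilt:
  obtains r u where "0 < r" "u \<in> tilts r"
    "\<And>v. (\<integral>z. (if g z - u \<bullet> z \<le> 1 then v \<bullet> z else 0) \<partial>lborel) = 0"
proof -
  obtain r u where r: "0 < r" "u \<in> tilts r" 
    and min: "\<And>r' u'. 0 < r' \<Longrightarrow> u' \<in> tilts r' \<Longrightarrow> capint u \<le> capint u'"
    by (rule exists_minimal_tilt) blast
  interpret t: gauge "\<lambda>z. g z - u \<bullet> z" r "M + norm u" by (rule gauge_tilt[OF r])
  define I where "I v = (\<integral>z. (if g z - u \<bullet> z \<le> 1 then v \<bullet> z else 0) \<partial>lborel)" for v
  have nonneg: "0 \<le> I v" for v
  proof -
    \<comment> \<open>Large enough that every step \<open>s k\<close> along \<open>v\<close> keeps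
      half of the margin \<open>r\<close>, so the perturbed tilt is an admissible
      competitor.\<close>
    define N where "N = nat \<lceil>2 * norm v / r\<rceil> + 1"
    define s where "s k = 1 / real (k + N)" for k
    have s: "0 < s k" "s k * norm v \<le> r / 2" for k
    proof -
      show "0 < s k" by (simp add: s_def N_def)
      have "2 * norm v / r \<le> real (k + N)" unfolding N_def by linarith
      moreover have "0 < real (k + N)" by (simp add: N_def)
      ultimately show "s k * norm v \<le> r / 2" using r by (simp add: s_def field_simps)
    qed
    have s_lim: "s \<longlonglongrightarrow> 0"
      unfolding s_def using LIMSEQ_ignore_initial_segment[OF lim_const_over_n[of 1], of N] by simp
    define f where "f k z = (if g z - (u + s k *\<^sub>R v) \<bullet> z < 1 then v \<bullet> z else 0)" for k z
    have tilt: "u + s k *\<^sub>R v \<in> tilts (r / 2)" for k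
      unfolding tilts_def mem_Collect_eq
    proof
      fix z
      have "s k * (v \<bullet> z) \<le> s k * (norm v * norm z)" 
        using s(1)[of k] Cauchy_Schwarz_ineq2[of v z] by (intro mult_left_mono) auto
      also have "\<dots> = (s k * norm v) * norm z" by simp
      also have "\<dots> \<le> r / 2 * norm z" using s(2) by (intro mult_right_mono) auto
      finally show "r / 2 * norm z \<le> g z - (u + s k *\<^sub>R v) \<bullet> z"
        using t.lower[of z] by (simp add: inner_add_left)
    qed
    have r2: "0 < r / 2" using r by simp
    have f_bound: "\<bar>f k z\<bar> \<le> norm v * (2 / r) * indicat_real (cball 0 (2 / r)) z" for k z
    proof (cases "g z - (u + s k *\<^sub>R v) \<bullet> z < 1")
      case True
      have "r / 2 * norm z \<le> g z - (u + s k *\<^sub>R v) \<bullet> z" by (rule tiltsD[OF tilt])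
      then have z: "norm z \<le> 2 / r" using True r by (simp add: field_simps)
      have "\<bar>v \<bullet> z\<bar> \<le> norm v * norm z" by (rule Cauchy_Schwarz_ineq2)
      also have "\<dots> \<le> norm v * (2 / r)" using z by (intro mult_left_mono) auto
      finally show ?thesis using True z by (simp add: f_def)
    next
      case False
      then show ?thesis using r by (simp add: f_def)
    qed
    have f_meas: "f k \<in> borel_measurable borel" for k
    proof -
      have [measurable]: "(\<lambda>z. (u + s k *\<^sub>R v) \<bullet> z) \<in> borel_measurable borel" "(\<lambda>z. v \<bullet> z) \<in> borel_measurable borel"
        by (auto intro!: borel_measurable_continuous_onI continuous_intros)
      show ?thesis unfolding f_def by measurable
    qed
    have w_int: "integrable lborel (\<lambda>z. norm v * (2 / r) * indicat_real (cball (0::point) (2 / r)) z)"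
      by (rule integrable_mult_ball)
    have f_int: "integrable lborel (f k)" for k
      by (rule Bochner_Integration.integrable_bound[OF w_int]) (use f_meas f_bound r in \<open>auto intro!: AE_I2\<close>)
    have "0 \<le> (\<integral>z. f k z \<partial>lborel)" for k
    proof -
      have "0 \<le> capint (u + s k *\<^sub>R v) - capint u" using min[OF r2 tilt] by simp
      also have "\<dots> = (\<integral>z. cap (u + s k *\<^sub>R v) z - cap u z \<partial>lborel)"
        unfolding capint_def using integrable_cap[OF r2 tilt] integrable_cap[OF r] by simp
      also have "\<dots> \<le> (\<integral>z. s k * f k z \<partial>lborel)"
      proof (rule integral_mono)
        \<comment> \<open>Convexity of \<open>cap\<close> in the tilt: \<open>f k z\<close> is its
          slope along \<open>v\<close> at the perturbed tilt, which bounds the difference quotient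
          from above.\<close>
        show "cap (u + s k *\<^sub>R v) z - cap u z \<le> s k * f k z" for z
          by (auto simp: cap_def f_def inner_add_left max_def)
      qed (use integrable_cap[OF r2 tilt] integrable_cap[OF r] f_int in auto)
      finally show ?thesis using s(1)[of k] by (simp add: zero_le_mult_iff)
    qed
    moreover have "(\<lambda>k. \<integral>z. f k z \<partial>lborel) \<longlonglongrightarrow> I v"
      unfolding I_def
    proof (rule integral_dominated_convergence[OF _ _ w_int])
      have [measurable]: "(\<lambda>z. u \<bullet> z) \<in> borel_measurable borel" "(\<lambda>z. v \<bullet> z) \<in> borel_measurable borel"
        by (auto intro!: borel_measurable_continuous_onI continuous_intros)
      show "(\<lambda>z. if g z - u \<bullet> z \<le> 1 then v \<bullet> z else 0) \<in> borel_measurable lborel" by measurable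
      have "AE z in lebesgue. z \<notin> {z. g z - u \<bullet> z = 1}"
        using t.negligible_level by (intro AE_not_in) (simp add: negligible_iff_null_sets)
      then have "AE z in lborel. z \<notin> {z. g z - u \<bullet> z = 1}" by (simp add: AE_completion_iff)
      then show "AE z in lborel. (\<lambda>k. f k z) \<longlonglongrightarrow> (if g z - u \<bullet> z \<le> 1 then v \<bullet> z else 0)"
      proof eventually_elim
        case (elim z)
        have "(\<lambda>k. g z - (u \<bullet> z + s k * (v \<bullet> z))) \<longlonglongrightarrow> g z - (u \<bullet> z + 0 * (v \<bullet> z))"
          by (intro tendsto_intros s_lim)
        then have lim: "(\<lambda>k. g z - (u + s k *\<^sub>R v) \<bullet> z) \<longlonglongrightarrow> g z - u \<bullet> z" by (simp add: inner_add_left)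
        have "\<forall>\<^sub>F k in sequentially. f k z = (if g z - u \<bullet> z \<le> 1 then v \<bullet> z else 0)"
        proof (cases "g z - u \<bullet> z < 1")
          case True
          show ?thesis using order_tendstoD(2)[OF lim True] by eventually_elim (use True in \<open>simp add: f_def\<close>)
        next
          case False
          then have gt: "1 < g z - u \<bullet> z" using elim by auto
          show ?thesis using order_tendstoD(1)[OF lim gt] by eventually_elim (use gt in \<open>simp add: f_def\<close>)
        qed
        then show ?case by (rule tendsto_eventually)
      qed
    qed (use f_meas f_bound in auto)
    ultimately show ?thesis by (intro LIMSEQ_le_const) auto
  qed
  have "I v = 0" for v
  proof -
    have "I (- v) = (\<integral>z. - (if g z - u \<bullet> z \<le> 1 then v \<bullet> z else 0) \<partial>lborel)"
      unfolding I_def by (rule Bochner_Integration.integral_cong) auto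
    also have "\<dots> = - I v" by (simp add: I_def)
    finally show ?thesis using nonneg[of v] nonneg[of "- v"] by simp
  qed
  with r show ?thesis unfolding I_def by (rule that)
qed

end

lemma (in gauge) J_3: "(\<And>v. (\<integral>z. (if g z \<le> 1 then v \<bullet> z else 0) \<partial>lborel) = 0) \<Longrightarrow> J 3 = 0"
proof -
  assume *: "\<And>v. (\<integral>z. (if g z \<le> 1 then v \<bullet> z else 0) \<partial>lborel) = 0"
  have "sector_fun fst 3 = (\<lambda>z. if g z \<le> 1 then (1, 0) \<bullet> z else 0)"
    "sector_fun snd 3 = (\<lambda>z. if g z \<le> 1 then (0, 1) \<bullet> z else 0)"
    using pang_bounds by (auto simp: sector_fun_def inner_prod_def fun_eq_iff)
  then show "J 3 = 0" using *[of "(1, 0)"] *[of "(0, 1)"] by (simp add: J_def zero_prod_def)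
qed

section \<open>Minimal edge sets\<close>

lemma inj_on_pang_primitive: "inj_on pang primitive"
proof (rule inj_onI)
  fix p q assume pq: "p \<in> primitive" "q \<in> primitive" "pang p = pang q"
  then obtain a b a' b' where ab: "p = (of_int a, of_int b)" "coprime a b" "q = (of_int a', of_int b')" "coprime a' b'"
    by (auto simp: primitive_def)
  have "p \<noteq> 0" "q \<noteq> 0" using pq primitive_lattice by auto
  then obtain c where c: "0 < c" "q = c *\<^sub>R p" using pq(3) by (rule pang_eq_parallel)
  have c': "of_int a' = c * of_int a" "of_int b' = c * of_int b" using c ab by auto
  have "real_of_int (a * b') = real_of_int (a' * b)" using c' by simp
  then have "a * b' = a' * b" by (simp only: of_int_eq_iff)
  then have "\<bar>a\<bar> * \<bar>b'\<bar> = \<bar>a'\<bar> * \<bar>b\<bar>" by (simp flip: abs_mult)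
  then have e: "\<bar>a\<bar> = \<bar>a'\<bar>" "\<bar>b\<bar> = \<bar>b'\<bar>"
    using coprime_crossproduct_int[OF ab(2), of a' b'] ab(4) by (auto simp: coprime_commute)
  have "\<bar>real_of_int a'\<bar> = c * \<bar>real_of_int a\<bar>" "\<bar>real_of_int b'\<bar> = c * \<bar>real_of_int b\<bar>"
    using c' c(1) by (simp_all add: abs_mult)
  then have "\<bar>real_of_int a\<bar> = c * \<bar>real_of_int a\<bar>" "\<bar>real_of_int b\<bar> = c * \<bar>real_of_int b\<bar>"
    using e by (metis of_int_abs)+
  moreover have "real_of_int a \<noteq> 0 \<or> real_of_int b \<noteq> 0" using \<open>p \<noteq> 0\<close> ab by (auto simp: zero_prod_def)
  ultimately have "c = 1" by auto
  then show "p = q" using c by simp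
qed

section \<open>Replacing edges by their primitive parts\<close>

definition prim_part :: "point \<Rightarrow> point" where
  "prim_part z = (SOME p. p \<in> primitive \<and> (\<exists>d\<ge>1. z = real d *\<^sub>R p))"

lemma prim_part:
  assumes "z \<in> lattice"
  shows "prim_part z \<in> primitive" "\<exists>d\<ge>1. z = real d *\<^sub>R prim_part z"
proof -
  have "z \<in> (\<lambda>(d, p). real d *\<^sub>R p) ` ({1..} \<times> primitive)"
    using assms bij_betw_imp_surj_on[OF bij_primitive] by simp
  then obtain d p where "1 \<le> d" "p \<in> primitive" "z = real d *\<^sub>R p" by auto
  then have "\<exists>p. p \<in> primitive \<and> (\<exists>d\<ge>1. z = real d *\<^sub>R p)" by blast
  from someI_ex[OF this] show "prim_part z \<in> primitive" "\<exists>d\<ge>1. z = real d *\<^sub>R prim_part z"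
    unfolding prim_part_def by auto
qed

lemma pang_prim_part: assumes "z \<in> lattice" shows "pang (prim_part z) = pang z"
proof -
  obtain d where d: "1 \<le> d" "z = real d *\<^sub>R prim_part z" using prim_part(2)[OF assms] by blast
  have "pang (real d *\<^sub>R prim_part z) = pang (prim_part z)" using d(1) by (intro pang_scaleR) auto
  then show ?thesis using d(2) by simp
qed

lemma inj_on_prim_part:
  assumes "E \<subseteq> lattice" "inj_on pang E" shows "inj_on prim_part E"
proof (rule inj_onI)
  fix x y assume xy: "x \<in> E" "y \<in> E" "prim_part x = prim_part y"
  then have "pang x = pang y" using pang_prim_part assms(1) by (metis subsetD)
  then show "x = y" using assms(2) xy by (auto dest: inj_onD)
qed

lemma norm_vertical_primitive:
  assumes "p \<in> primitive" "fst p = 0" shows "norm p = 1"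
  using assms by (auto simp: primitive_def norm_Pair)

context gauge
begin

text \<open>For z = d p the gain is (d - 1) g p, which is g of the vector removed.\<close>

lemma g_prim_part:
  assumes "z \<in> lattice" shows "m * norm (z - prim_part z) \<le> g z - g (prim_part z)"
proof -
  obtain d where d: "1 \<le> d" "z = real d *\<^sub>R prim_part z" using prim_part(2)[OF assms] by blast
  have "z - prim_part z = (real d - 1) *\<^sub>R prim_part z" using d(2) by (metis scaleR_left_diff_distrib scaleR_one)
  moreover have "g ((real d - 1) *\<^sub>R prim_part z) = g z - g (prim_part z)"
    using scale[of "real d - 1" "prim_part z"] scale[of "real d" "prim_part z"] d by (simp add: algebra_simps)
  ultimately show ?thesis using lower[of "z - prim_part z"] by simp
qed

text \<open>Four vectors close up the sum of \<open>B\<close>. Each has a coordinate 1 or -1, hence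
  is primitive whatever the other one is; two of them absorb the horizontal defect, two the vertical
  one, and their lengths are of the order of T plus the defect.\<close>

lemma competitor:
  assumes T: "0 < T" and B: "B \<subseteq> prims T"
  shows "\<exists>E. edge_set E \<and> card E = card B + 4 \<and> sum g E \<le> sum g B + M * (4 * T / m + 10 * norm (\<Sum>B) + 20)"
proof -
  have finB: "finite B" using B finite_prims finite_subset by blast
  have "\<Sum>B \<in> \<int> \<times> \<int>"
  proof -
    have "fst (\<Sum>B) \<in> \<int>" "snd (\<Sum>B) \<in> \<int>"
      using B primitive_lattice by (auto simp: fst_sum snd_sum prims_def intro!: Ints_sum)
    then show ?thesis by (simp add: mem_Times_iff)
  qed
  then obtain s1 s2 where s: "\<Sum>B = (of_int s1, of_int s2)" by (auto elim!: Ints_cases)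
  \<comment> \<open>Exceeding T / m by more than the defect, K leaves each of the four vectors a
    coordinate above T / m, hence outside \<open>prims T\<close>; it also makes them
    distinct.\<close>
  define K where "K = \<lceil>T / m\<rceil> + \<bar>s1\<bar> + \<bar>s2\<bar> + 2"
  have Tm: "0 < T / m" using T m_pos by simp
  have K: "T / m + \<bar>s1\<bar> + \<bar>s2\<bar> + 2 \<le> K" "K \<le> T / m + \<bar>s1\<bar> + \<bar>s2\<bar> + 3"
    unfolding K_def by (simp_all, linarith+)
  have K2: "\<bar>s1\<bar> + \<bar>s2\<bar> + 2 < K" using K(1) Tm by linarith
  define F :: "point set" where "F = {(of_int K, 1), (- of_int s1 - of_int K, - 1), (1, of_int K), (- 1, - of_int s2 - of_int K)}"
  have neq: "(of_int K :: real, 1 :: real) \<notin> {(- of_int s1 - of_int K, - 1), (1, of_int K), (- 1, - of_int s2 - of_int K)}"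
    "(- of_int s1 - of_int K :: real, - 1 :: real) \<notin> {(1, of_int K), (- 1, - of_int s2 - of_int K)}"
    "(1 :: real, of_int K :: real) \<notin> {(- 1, - of_int s2 - of_int K)}"
    using K2 by auto
  have F: "finite F" "card F = 4" "\<Sum>F = - \<Sum>B"
    using neq by (simp_all add: F_def s)
  have F_prim: "F \<subseteq> primitive"
  proof -
    have "(of_int a, of_int b) \<in> primitive" if "coprime a b" for a b using that by (auto simp: primitive_def)
    from this[of K 1] this[of "- s1 - K" "- 1"] this[of 1 K] this[of "- 1" "- s2 - K"]
    show ?thesis by (simp add: F_def)
  qed
  have norm_le_abs: "norm (a, b) \<le> \<bar>a\<bar> + \<bar>b\<bar>" for a b :: real using norm_Pair_le[of a b] by simp
  have F_out: "T < g f" if "f \<in> F" for f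
  proof -
    have "T / m < \<bar>fst f\<bar> \<or> T / m < \<bar>snd f\<bar>" using that K(1) by (auto simp: F_def)
    then have "T / m < norm f" using norm_fst_le[of "fst f" "snd f"] norm_snd_le[of "snd f" "fst f"] by auto
    then have "T < m * norm f" using m_pos by (simp add: field_simps)
    then show ?thesis using lower[of f] by linarith
  qed
  then have disj: "B \<inter> F = {}" using B by (force simp: prims_def)
  have sub: "B \<union> F \<subseteq> primitive" using B F_prim by (auto simp: prims_def)
  have "edge_set (B \<union> F)"
    unfolding edge_set_def
    using sub primitive_lattice inj_on_subset[OF inj_on_pang_primitive sub] finB F disj
    by (simp add: sum.union_disjoint) blast
  moreover have "card (B \<union> F) = card B + 4" using finB F disj by (simp add: card_Un_disjoint)
  moreover have "sum g (B \<union> F) \<le> sum g B + M * (4 * T / m + 10 * norm (\<Sum>B) + 20)"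
  proof -
    have "sum g F \<le> (\<Sum>f\<in>F. M * (\<bar>fst f\<bar> + \<bar>snd f\<bar>))"
    proof (rule sum_mono)
      fix f
      have "g f \<le> M * norm f" by (rule upper)
      also have "\<dots> \<le> M * (\<bar>fst f\<bar> + \<bar>snd f\<bar>)"
        using norm_le_abs[of "fst f" "snd f"] M_pos by (intro mult_left_mono) auto
      finally show "g f \<le> M * (\<bar>fst f\<bar> + \<bar>snd f\<bar>)" .
    qed
    also have "\<dots> = M * (\<Sum>f\<in>F. \<bar>fst f\<bar> + \<bar>snd f\<bar>)" by (simp add: sum_distrib_left)
    also have "(\<Sum>f\<in>F. \<bar>fst f\<bar> + \<bar>snd f\<bar>) \<le> 4 * T / m + 10 * norm (\<Sum>B) + 20"
    proof -
      have "(\<Sum>f\<in>F. \<bar>fst f\<bar> + \<bar>snd f\<bar>) = \<bar>of_int K\<bar> + 1 + (\<bar>- of_int s1 - of_int K\<bar> + 1) + (1 + \<bar>of_int K\<bar>) + (1 + \<bar>- of_int s2 - of_int K\<bar>)"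
        using neq unfolding F_def by simp
      also have "\<bar>of_int K :: real\<bar> = of_int K" using K2 by linarith
      also have "of_int K + 1 + (\<bar>- of_int s1 - of_int K\<bar> + 1) + (1 + of_int K) + (1 + \<bar>- of_int s2 - of_int K :: real\<bar>) 
          \<le> of_int K + 1 + (\<bar>of_int s1\<bar> + of_int K + 1) + (1 + of_int K) + (1 + (\<bar>of_int s2\<bar> + of_int K))"
        using K2 by (intro add_mono order_refl) linarith+
      also have "\<dots> \<le> 4 * (T / m) + 5 * (\<bar>of_int s1\<bar> + \<bar>of_int s2\<bar>) + 20" using K(2)[unfolded of_int_abs] by argo
      also have "\<bar>of_int s1\<bar> + \<bar>of_int s2\<bar> \<le> 2 * norm (\<Sum>B)"
        using norm_fst_le[of "of_int s1 :: real" "of_int s2 :: real"] norm_snd_le[of "of_int s2 :: real" "of_int s1 :: real"] s by simp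
      finally show ?thesis by simp
    qed
    finally have "sum g F \<le> M * (4 * T / m + 10 * norm (\<Sum>B) + 20)" using M_pos by (simp add: mult_left_mono)
    then show ?thesis using finB F disj by (simp add: sum.union_disjoint)
  qed
  ultimately show ?thesis by blast
qed

definition minimal_edges :: "nat \<Rightarrow> point set \<Rightarrow> bool" where
  "minimal_edges n E \<longleftrightarrow> edge_set E \<and> card E = n \<and> (\<forall>E'. edge_set E' \<and> card E' = n \<longrightarrow> sum g E \<le> sum g E')"

text \<open>The bound that comparison with \<open>competitor\<close> yields. The competitor keeps n
  - 4 vectors of \<open>prims T\<close>; each one dropped moves their sum by at most
  \<open>T / m\<close>. The last term comes from passing from sums of g to sums of g - T over sets
  of different size.\<close>

definition excess :: "nat \<Rightarrow> real \<Rightarrow> real" where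
  "excess n T = M * (4 * T / m + 10 * (norm (\<Sum>(prims T)) + (real (card (prims T)) - real n + 4) * (T / m)) + 20)
     + (real (card (prims T)) - real n) * T"

text \<open>Comparing \<open>E\<close> with the competitor built from \<open>prims T\<close>: every primitive vector on the wrong side
  of the level \<open>T\<close> and every non-primitive edge costs something.\<close>

lemma minimal_edges_defect:
  assumes E: "minimal_edges n E" and n: "4 \<le> n" "n \<le> card (prims T)" and T: "0 < T"
  defines "A \<equiv> prim_part ` E" and "B \<equiv> prims T"
  shows "(\<Sum>z\<in>(A - B) \<union> (B - A). \<bar>g z - T\<bar>) + m * (\<Sum>e\<in>E. norm (e - prim_part e)) \<le> excess n T"
proof -
  have E': "finite E" "E \<subseteq> lattice" "inj_on pang E" "card E = n"
    using E by (auto simp: minimal_edges_def edge_set_def)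
  have inj: "inj_on prim_part E" by (rule inj_on_prim_part[OF E'(2,3)])
  have A: "finite A" "card A = n" using E' card_image[OF inj] by (auto simp: A_def)
  have "A \<subseteq> primitive" unfolding A_def using E'(2) prim_part(1) by blast
  note A = A this
  have B: "finite B" unfolding B_def by (rule finite_prims)
  have sumA: "(\<Sum>z\<in>A. g z) = (\<Sum>e\<in>E. g (prim_part e))" unfolding A_def using inj by (simp add: sum.reindex)
  \<comment> \<open>Room for the four closing vectors.\<close>
  obtain B' where B': "B' \<subseteq> B" "card B' = n - 4"
    by (rule obtain_subset_with_card_n[of "n - 4" B]) (use n in \<open>auto simp: B_def\<close>)
  obtain E2 where E2: "edge_set E2" "card E2 = card B' + 4" "sum g E2 \<le> sum g B' + M * (4 * T / m + 10 * norm (\<Sum>B') + 20)"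
    using competitor[OF T, of B'] B' by (auto simp: B_def)
  have "sum g E \<le> sum g E2" using E E2 B' n by (auto simp: minimal_edges_def)
  also have "sum g B' \<le> sum g B" using B' B g_nonneg by (intro sum_mono2) auto
  then have "sum g E2 \<le> sum g B + M * (4 * T / m + 10 * norm (\<Sum>B') + 20)" using E2 by linarith
  finally have gE: "sum g E \<le> sum g B + M * (4 * T / m + 10 * norm (\<Sum>B') + 20)" .
  have "norm (\<Sum>B') \<le> norm (\<Sum>B) + (real (card B) - real n + 4) * (T / m)"
  proof -
    have "\<Sum>B' = \<Sum>B - \<Sum>(B - B')" using sum.subset_diff[OF B'(1) B, of "\<lambda>x. x"] by simp
    then have "norm (\<Sum>B') \<le> norm (\<Sum>B) + norm (\<Sum>(B - B'))" by (simp add: norm_triangle_ineq4)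
    also have "norm (\<Sum>(B - B')) \<le> (\<Sum>z\<in>B - B'. norm z)" by (rule norm_sum)
    also have "\<dots> \<le> real (card (B - B')) * (T / m)"
      using norm_le by (intro sum_bounded_above) (auto simp: B_def prims_def)
    also have "real (card (B - B')) = real (card B) - real n + 4"
      using B' B n card_Diff_subset[OF finite_subset[OF B'(1) B] B'(1)] card_mono[OF B B'(1)] by (simp add: of_nat_diff)
    finally show ?thesis by simp
  qed
  then have "M * (4 * T / m + 10 * norm (\<Sum>B') + 20)
      \<le> M * (4 * T / m + 10 * (norm (\<Sum>B) + (real (card B) - real n + 4) * (T / m)) + 20)"
    using M_pos by (intro mult_left_mono) auto
  then have gE': "sum g E - sum g B + (real (card B) - real n) * T \<le> excess n T"
    using gE by (simp add: excess_def B_def)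
  have "m * (\<Sum>e\<in>E. norm (e - prim_part e)) \<le> (\<Sum>e\<in>E. g e - g (prim_part e))"
    unfolding sum_distrib_left using g_prim_part E'(2) by (intro sum_mono) auto
  then have 1: "m * (\<Sum>e\<in>E. norm (e - prim_part e)) \<le> sum g E - sum g A" by (simp add: sum_subtractf sumA)
  \<comment> \<open>The signs are known: primitive vectors outside \<open>B\<close> have g > T,
    those in \<open>B\<close> have g at most T. So the absolute values sum to the difference of the
    totals of g - T over \<open>A\<close> and \<open>B\<close>.\<close>
  have "(\<Sum>z\<in>(A - B) \<union> (B - A). \<bar>g z - T\<bar>) = (\<Sum>z\<in>A - B. \<bar>g z - T\<bar>) + (\<Sum>z\<in>B - A. \<bar>g z - T\<bar>)"
    using A B by (intro sum.union_disjoint) auto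
  also have "(\<Sum>z\<in>A - B. \<bar>g z - T\<bar>) = (\<Sum>z\<in>A - B. g z - T)"
    by (rule sum.cong) (use A in \<open>auto simp: B_def prims_def\<close>)
  also have "(\<Sum>z\<in>B - A. \<bar>g z - T\<bar>) = (\<Sum>z\<in>B - A. T - g z)"
    by (rule sum.cong) (auto simp: B_def prims_def)
  also have "(\<Sum>z\<in>A - B. g z - T) = (\<Sum>z\<in>A. g z - T) - (\<Sum>z\<in>A \<inter> B. g z - T)"
    using sum.Int_Diff[OF A(1), of "\<lambda>z. g z - T" B] by simp
  also have "(\<Sum>z\<in>B - A. T - g z) = - ((\<Sum>z\<in>B. g z - T) - (\<Sum>z\<in>A \<inter> B. g z - T))"
    using sum.Int_Diff[OF B, of "\<lambda>z. T - g z" A] by (simp add: Int_commute sum_subtractf)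
  finally have "(\<Sum>z\<in>(A - B) \<union> (B - A). \<bar>g z - T\<bar>) = (\<Sum>z\<in>A. g z - T) - (\<Sum>z\<in>B. g z - T)" by simp
  also have "\<dots> = sum g A - sum g B + (real (card B) - real n) * T"
    using A by (simp add: sum_subtractf algebra_simps)
  finally show ?thesis using 1 gE' by linarith
qed

text \<open>Away from the level, where |g z - T| is at least \<delta> T, the length of a misplaced
  vector is at most a multiple of |g z - T| and is paid for by \<open>excess\<close>. In the
  remaining shell lengths are at most 2 T / m and the primitive vectors are simply counted.
  Shrinking edges to primitive parts keeps directions, so sectors are respected.\<close>

lemma minimal_edges_sector:
  assumes E: "minimal_edges n E" and n: "4 \<le> n" "n \<le> card (prims T)" and T: "0 < T"
    and \<delta>: "0 < \<delta>" "\<delta> < 1"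
  shows "norm (\<Sum>{e \<in> E. pang e \<le> \<theta>} - \<Sum>{z \<in> prims T. pang z \<le> \<theta>})
    \<le> (3 / (\<delta> * m)) * excess n T
      + (2 * T / m) * (real (card (prims ((1 + \<delta>) * T))) - real (card (prims ((1 - \<delta>) * T))))"
proof -
  define A where "A = prim_part ` E"
  define B where "B = prims T"
  define W where "W = {z \<in> primitive. \<bar>g z - T\<bar> < \<delta> * T}"
  let ?X = "(A - B) \<union> (B - A)"
  note def = minimal_edges_defect[OF E n T, folded A_def B_def]
  have E': "finite E" "E \<subseteq> lattice" "inj_on pang E" "card E = n"
    using E by (auto simp: minimal_edges_def edge_set_def)
  have inj: "inj_on prim_part E" by (rule inj_on_prim_part[OF E'(2,3)])
  have A: "finite A" "A \<subseteq> primitive" unfolding A_def using E'(1,2) prim_part(1) by blast+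
  have B: "finite B" "B \<subseteq> primitive" unfolding B_def by (rule finite_prims) (auto simp: prims_def)
  let ?s = "\<lambda>S. {z \<in> S. pang z \<le> \<theta>}"
  have "\<Sum>(?s E) - \<Sum>(?s B) = (\<Sum>e\<in>?s E. e - prim_part e) + (\<Sum>(?s A) - \<Sum>(?s B))"
  proof -
    have "?s A = prim_part ` (?s E)" using E'(2) pang_prim_part unfolding A_def by (auto simp del: mem_Times_iff) force+
    moreover have "inj_on prim_part (?s E)" using inj by (rule inj_on_subset) auto
    ultimately have "\<Sum>(?s A) = (\<Sum>e\<in>?s E. prim_part e)" by (simp add: sum.reindex)
    then show ?thesis by (simp add: sum_subtractf)
  qed
  also have "norm \<dots> \<le> norm (\<Sum>e\<in>?s E. e - prim_part e) + norm (\<Sum>(?s A) - \<Sum>(?s B))"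
    by (rule norm_triangle_ineq)
  also have "norm (\<Sum>e\<in>?s E. e - prim_part e) \<le> (\<Sum>e\<in>E. norm (e - prim_part e))"
  proof -
    have "norm (\<Sum>e\<in>?s E. e - prim_part e) \<le> (\<Sum>e\<in>?s E. norm (e - prim_part e))" by (rule norm_sum)
    also have "\<dots> \<le> (\<Sum>e\<in>E. norm (e - prim_part e))" using E' by (intro sum_mono2) auto
    finally show ?thesis .
  qed
  also have "norm (\<Sum>(?s A) - \<Sum>(?s B)) \<le> (\<Sum>z\<in>?X. norm z)"
  proof -
    have "\<Sum>(?s A) = \<Sum>(?s (A \<inter> B)) + \<Sum>(?s (A - B))"
      using A by (subst sum.union_disjoint[symmetric]) (auto intro!: sum.cong)
    moreover have "\<Sum>(?s B) = \<Sum>(?s (A \<inter> B)) + \<Sum>(?s (B - A))"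
      using B by (subst sum.union_disjoint[symmetric]) (auto intro!: sum.cong)
    ultimately have "norm (\<Sum>(?s A) - \<Sum>(?s B)) \<le> norm (\<Sum>(?s (A - B))) + norm (\<Sum>(?s (B - A)))"
      by (simp add: norm_triangle_ineq4)
    also have "\<dots> \<le> (\<Sum>z\<in>?s (A - B). norm z) + (\<Sum>z\<in>?s (B - A). norm z)" by (intro add_mono norm_sum)
    also have "\<dots> \<le> (\<Sum>z\<in>A - B. norm z) + (\<Sum>z\<in>B - A. norm z)"
      using A B by (intro add_mono sum_mono2) auto
    also have "\<dots> = (\<Sum>z\<in>?X. norm z)" using A B by (intro sum.union_disjoint[symmetric]) auto
    finally show ?thesis .
  qed
  also have "(\<Sum>z\<in>?X. norm z) \<le> (\<Sum>z\<in>?X. 2 / (\<delta> * m) * \<bar>g z - T\<bar> + (if z \<in> W then 2 * T / m else 0))"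
  proof (rule sum_mono)
    fix z assume z: "z \<in> ?X"
    then have zp: "z \<in> primitive" using A B by auto
    have nz: "norm z \<le> g z / m" using norm_le[of z "g z"] by simp
    show "norm z \<le> 2 / (\<delta> * m) * \<bar>g z - T\<bar> + (if z \<in> W then 2 * T / m else 0)"
    proof (cases "z \<in> W")
      case True
      then have "g z \<le> 2 * T" using \<delta> T by (auto simp: W_def) (smt (verit) mult_less_cancel_right1)
      then have "g z / m \<le> 2 * T / m" using m_pos by (intro divide_right_mono) auto
      moreover have "0 \<le> 2 / (\<delta> * m) * \<bar>g z - T\<bar>" using \<delta> m_pos by simp
      ultimately show ?thesis using True nz by simp
    next
      case False
      then have "\<delta> * T \<le> \<bar>g z - T\<bar>" using zp by (auto simp: W_def)
      then have T': "T \<le> \<bar>g z - T\<bar> / \<delta>" using \<delta> by (simp add: field_simps)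
      have "\<bar>g z - T\<bar> * \<delta> \<le> \<bar>g z - T\<bar> * 1" using \<delta> by (intro mult_left_mono) auto
      then have "\<bar>g z - T\<bar> \<le> \<bar>g z - T\<bar> / \<delta>" using \<delta> by (simp add: field_simps)
      then have "g z \<le> 2 * (\<bar>g z - T\<bar> / \<delta>)" using T' by linarith
      then have "g z / m \<le> 2 * (\<bar>g z - T\<bar> / \<delta>) / m" using m_pos by (intro divide_right_mono) auto
      then show ?thesis using False nz by simp
    qed
  qed
  also have "\<dots> = 2 / (\<delta> * m) * (\<Sum>z\<in>?X. \<bar>g z - T\<bar>) + (\<Sum>z\<in>?X. if z \<in> W then 2 * T / m else 0)"
    by (simp add: sum.distrib sum_distrib_left)
  also have "(\<Sum>z\<in>?X. if z \<in> W then 2 * T / m else 0) = (2 * T / m) * real (card (?X \<inter> W))"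
    using A B by (simp add: sum.If_cases Int_def)
  also have "(2 * T / m) * real (card (?X \<inter> W)) \<le> (2 * T / m) * (real (card (prims ((1 + \<delta>) * T))) - real (card (prims ((1 - \<delta>) * T))))"
  proof (rule mult_left_mono)
    have sub: "prims ((1 - \<delta>) * T) \<subseteq> prims ((1 + \<delta>) * T)"
    proof -
      have "(1 - \<delta>) * T \<le> (1 + \<delta>) * T" using \<delta> T by (intro mult_right_mono) auto
      then show ?thesis by (auto simp: prims_def)
    qed
    have "?X \<inter> W \<subseteq> prims ((1 + \<delta>) * T) - prims ((1 - \<delta>) * T)"
      by (auto simp: W_def prims_def abs_less_iff algebra_simps)
    then have "card (?X \<inter> W) \<le> card (prims ((1 + \<delta>) * T) - prims ((1 - \<delta>) * T))"
      using finite_prims by (intro card_mono) auto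
    also have "\<dots> = card (prims ((1 + \<delta>) * T)) - card (prims ((1 - \<delta>) * T))"
      using sub finite_prims by (intro card_Diff_subset) auto
    finally show "real (card (?X \<inter> W)) \<le> real (card (prims ((1 + \<delta>) * T))) - real (card (prims ((1 - \<delta>) * T)))"
      using card_mono[OF finite_prims sub] by linarith
  qed (use T m_pos in simp)
  finally have *: "norm (\<Sum>(?s E) - \<Sum>(?s B)) \<le> (\<Sum>e\<in>E. norm (e - prim_part e)) + (2 / (\<delta> * m) * (\<Sum>z\<in>?X. \<bar>g z - T\<bar>)
      + (2 * T / m) * (real (card (prims ((1 + \<delta>) * T))) - real (card (prims ((1 - \<delta>) * T)))))"
    by simp
  let ?N = "\<Sum>e\<in>E. norm (e - prim_part e)" and ?G = "\<Sum>z\<in>?X. \<bar>g z - T\<bar>"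
  have pos: "0 \<le> ?N" "0 \<le> ?G" by (auto intro: sum_nonneg)
  have "0 \<le> m * ?N" using pos m_pos by simp
  have "\<delta> * (m * ?N) \<le> 1 * (m * ?N)" using pos m_pos \<delta> by (intro mult_right_mono) auto
  then have "\<delta> * m * ?N + 2 * ?G \<le> 3 * excess n T" using def pos \<open>0 \<le> m * ?N\<close> by linarith
  then have "(\<delta> * m * ?N + 2 * ?G) / (\<delta> * m) \<le> 3 * excess n T / (\<delta> * m)"
    using \<delta> m_pos by (intro divide_right_mono) auto
  moreover have "(\<delta> * m * ?N + 2 * ?G) / (\<delta> * m) = ?N + 2 / (\<delta> * m) * ?G"
    using \<delta> m_pos by (simp add: add_divide_distrib)
  ultimately have "?N + 2 / (\<delta> * m) * ?G \<le> 3 / (\<delta> * m) * excess n T" by simp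
  then show ?thesis using * by (simp add: B_def)
qed

text \<open>A vertical primitive vector has norm 1, so all further length of a vertical edge is
  non-primitive surplus. This limits the freedom in choosing the leftmost point.\<close>

lemma minimal_edges_vertical:
  assumes E: "minimal_edges n E" and n: "4 \<le> n" "n \<le> card (prims T)" and T: "0 < T"
    and e: "e \<in> E" "fst e = 0"
  shows "norm e \<le> 1 + excess n T / m"
proof -
  have E': "finite E" "E \<subseteq> lattice" using E by (auto simp: minimal_edges_def edge_set_def)
  have el: "e \<in> lattice" using e E' by blast
  obtain d where d: "1 \<le> d" "e = real d *\<^sub>R prim_part e" using prim_part(2)[OF el] by blast
  have "real d * fst (prim_part e) = 0" using e(2) d(2) by (metis fst_scaleR real_scaleR_def)
  then have "norm (prim_part e) = 1" using norm_vertical_primitive[OF prim_part(1)[OF el]] d by simp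
  then have 1: "norm e \<le> 1 + norm (e - prim_part e)" using norm_triangle_sub[of e "prim_part e"] by simp
  have "norm (e - prim_part e) \<le> (\<Sum>e\<in>E. norm (e - prim_part e))"
    using E' e by (intro member_le_sum) auto
  then have "m * norm (e - prim_part e) \<le> m * (\<Sum>e\<in>E. norm (e - prim_part e))" using m_pos by simp
  also have "\<dots> \<le> excess n T"
  proof -
    have "0 \<le> (\<Sum>z\<in>(prim_part ` E - prims T) \<union> (prims T - prim_part ` E). \<bar>g z - T\<bar>)" by (intro sum_nonneg) auto
    then show ?thesis using minimal_edges_defect[OF E n T] by linarith
  qed
  finally have "norm (e - prim_part e) \<le> excess n T / m" using m_pos by (simp add: field_simps)
  then show ?thesis using 1 by linarith
qed

end

section \<open>Asymptotics at the level holding about n primitive vectors\<close>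

locale centred_gauge = gauge +
  assumes centred: "J 3 = 0"
begin

text \<open>An integer level always admits a least choice, and it is fine enough: moving T by 1
  changes the count only by o(T^2).\<close>

definition level :: "nat \<Rightarrow> nat" where
  "level n = (LEAST T. n \<le> card (prims (real T)))"

lemma card_prims_mono: "s \<le> t \<Longrightarrow> card (prims s) \<le> card (prims t)"
  by (intro card_mono finite_prims) (auto simp: prims_def)

lemma card_prims_level: "n \<le> card (prims (real (level n)))"
proof -
  have "\<forall>\<^sub>F t in at_top. \<beta> / 2 < card (prims t) / t\<^sup>2"
    using order_tendstoD(1)[OF card_prims_limit, of "\<beta> / 2"] beta_pos by simp
  moreover have "filterlim (\<lambda>t. \<beta> / 2 * t\<^sup>2) at_top at_top"
  proof -
    have *: "filterlim (\<lambda>t::real. b * t\<^sup>2) at_top at_top" if "0 < b" for b using that by real_asymp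
    show ?thesis by (rule *) (use beta_pos in simp)
  qed
  then have "\<forall>\<^sub>F t in at_top. real n \<le> \<beta> / 2 * t\<^sup>2" by (simp add: filterlim_at_top)
  ultimately have "\<forall>\<^sub>F t in at_top. n \<le> card (prims t)"
    using eventually_gt_at_top[of 0]
  proof eventually_elim
    case (elim t)
    then have "\<beta> / 2 * t\<^sup>2 < card (prims t)" by (simp add: field_simps)
    then show ?case using elim by linarith
  qed
  then obtain t where t: "n \<le> card (prims t)" using eventually_happens'[of at_top] by fastforce
  have "card (prims t) \<le> card (prims (real (nat \<lceil>t\<rceil>)))" by (rule card_prims_mono) linarith
  then have "n \<le> card (prims (real (nat \<lceil>t\<rceil>)))" using t by simp
  then show ?thesis unfolding level_def by (rule LeastI)
qed

lemma less_level: "T < level n \<Longrightarrow> card (prims (real T)) < n"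
  unfolding level_def using not_less_Least by (meson not_le)

lemma level_at_top: "filterlim (\<lambda>n. real (level n)) at_top sequentially"
proof (rule filterlim_compose[OF filterlim_real_sequentially])
  show "filterlim level at_top sequentially"
    unfolding filterlim_at_top
  proof
    fix N
    show "\<forall>\<^sub>F n in sequentially. N \<le> level n"
      using eventually_gt_at_top[of "card (prims (real N))"]
    proof eventually_elim
      case (elim n)
      show ?case
      proof (rule ccontr)
        assume "\<not> N \<le> level n"
        then have "card (prims (real (level n))) \<le> card (prims (real N))" by (intro card_prims_mono) simp
        then show False using card_prims_level[of n] elim by linarith
      qed
    qed
  qed
qed

lemma card_prims_scaled:
  assumes "0 < k" shows "(\<lambda>n. card (prims (k * real (level n))) / (real (level n))\<^sup>2) \<longlonglongrightarrow> k\<^sup>2 * \<beta>"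
proof -
  have "filterlim (\<lambda>n. k * real (level n)) at_top sequentially"
    using assms by (intro filterlim_tendsto_pos_mult_at_top[OF tendsto_const] level_at_top) auto
  from filterlim_compose[OF card_prims_limit this]
  have "(\<lambda>n. k\<^sup>2 * (card (prims (k * real (level n))) / (k * real (level n))\<^sup>2)) \<longlonglongrightarrow> k\<^sup>2 * \<beta>"
    by (intro tendsto_intros)
  then show ?thesis using assms by (simp add: power_mult_distrib)
qed

text \<open>The count at \<open>level n - 1\<close> is below n and the count at
  \<open>level n\<close> is not; both have the same leading term.\<close>

lemma n_over_level: "(\<lambda>n. real n / (real (level n))\<^sup>2) \<longlonglongrightarrow> \<beta>"
proof (rule tendsto_sandwich[of "\<lambda>n. card (prims (real (level n) - 1)) / (real (level n))\<^sup>2" _ _ 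
      "\<lambda>n. card (prims (real (level n))) / (real (level n))\<^sup>2"])
  let ?t = "\<lambda>n. real (level n)"
  show "(\<lambda>n. card (prims (?t n)) / (?t n)\<^sup>2) \<longlonglongrightarrow> \<beta>"
    using card_prims_scaled[of 1] by simp
  show "\<forall>\<^sub>F n in sequentially. real n / (?t n)\<^sup>2 \<le> card (prims (?t n)) / (?t n)\<^sup>2"
    using card_prims_level by (intro always_eventually allI divide_right_mono) auto
  have "filterlim (\<lambda>x::real. x - 1) at_top at_top" by real_asymp
  from filterlim_compose[OF card_prims_limit filterlim_compose[OF this level_at_top]]
  have 1: "(\<lambda>n. card (prims (?t n - 1)) / (?t n - 1)\<^sup>2) \<longlonglongrightarrow> \<beta>" .
  have "((\<lambda>x::real. ((x - 1) / x)\<^sup>2) \<longlongrightarrow> 1) at_top" by real_asymp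
  from filterlim_compose[OF this level_at_top]
  have "(\<lambda>n. card (prims (?t n - 1)) / (?t n - 1)\<^sup>2 * ((?t n - 1) / ?t n)\<^sup>2) \<longlonglongrightarrow> \<beta> * 1"
    by (intro tendsto_mult 1)
  moreover have ev: "\<forall>\<^sub>F n in sequentially. 2 \<le> ?t n"
    by (rule level_at_top[unfolded filterlim_at_top, rule_format])
  have "\<forall>\<^sub>F n in sequentially. card (prims (?t n - 1)) / (?t n - 1)\<^sup>2 * ((?t n - 1) / ?t n)\<^sup>2 = card (prims (?t n - 1)) / (?t n)\<^sup>2"
    using ev by eventually_elim (simp add: power_divide)
  ultimately show "(\<lambda>n. card (prims (?t n - 1)) / (?t n)\<^sup>2) \<longlonglongrightarrow> \<beta>"
    using tendsto_cong by fastforce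
  show "\<forall>\<^sub>F n in sequentially. card (prims (?t n - 1)) / (?t n)\<^sup>2 \<le> real n / (?t n)\<^sup>2"
    using ev
  proof eventually_elim
    case (elim n)
    then have "?t n - 1 = real (level n - 1)" "level n - 1 < level n" by linarith+
    then have "card (prims (?t n - 1)) < n" using less_level by metis
    then show ?case by (intro divide_right_mono) auto
  qed
qed

text \<open>This is where \<open>centred\<close> enters: it makes the sum of \<open>prims T\<close>
  of order o(T^3). The surplus of the count over n is o(T^2), and it enters with factors of order
  T.\<close>

lemma excess_limit: "(\<lambda>n. excess n (real (level n)) / real (level n) ^ 3) \<longlonglongrightarrow> 0"
proof -
  let ?t = "\<lambda>n. real (level n)"
  have c: "(\<lambda>n. card (prims (?t n)) / (?t n)\<^sup>2) \<longlonglongrightarrow> \<beta>" using card_prims_scaled[of 1] by simp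
  have "((\<lambda>t. (1 / t ^ 3) *\<^sub>R \<Sum>{z \<in> prims t. pang z \<le> 3}) \<longlongrightarrow> J 3) at_top"
    by (rule tendsto_uniform_limitI[OF sector_sum_limit]) simp
  then have "((\<lambda>t. (1 / t ^ 3) *\<^sub>R \<Sum>(prims t)) \<longlongrightarrow> 0) at_top"
    unfolding prims_sector_3 centred .
  from filterlim_compose[OF this level_at_top]
  have s: "(\<lambda>n. norm ((1 / ?t n ^ 3) *\<^sub>R \<Sum>(prims (?t n)))) \<longlonglongrightarrow> 0" by (rule tendsto_norm_zero)
  have i: "(\<lambda>n. 1 / (?t n)\<^sup>2) \<longlonglongrightarrow> 0" "(\<lambda>n. 1 / ?t n ^ 3) \<longlonglongrightarrow> 0"
  proof -
    have "((\<lambda>t::real. 1 / t\<^sup>2) \<longlongrightarrow> 0) at_top" "((\<lambda>t::real. 1 / t ^ 3) \<longlongrightarrow> 0) at_top" by real_asymp+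
    then show "(\<lambda>n. 1 / (?t n)\<^sup>2) \<longlonglongrightarrow> 0" "(\<lambda>n. 1 / ?t n ^ 3) \<longlonglongrightarrow> 0"
      using filterlim_compose level_at_top by blast+
  qed
  have "(\<lambda>n. M * (4 / m * (1 / (?t n)\<^sup>2) + 10 * (norm ((1 / ?t n ^ 3) *\<^sub>R \<Sum>(prims (?t n)))
      + (card (prims (?t n)) / (?t n)\<^sup>2 - real n / (?t n)\<^sup>2 + 4 * (1 / (?t n)\<^sup>2)) * (1 / m)) + 20 * (1 / ?t n ^ 3))
      + (card (prims (?t n)) / (?t n)\<^sup>2 - real n / (?t n)\<^sup>2))
     \<longlonglongrightarrow> M * (4 / m * 0 + 10 * (0 + (\<beta> - \<beta> + 4 * 0) * (1 / m)) + 20 * 0) + (\<beta> - \<beta>)"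
    by (intro tendsto_intros c s i n_over_level)
  moreover have "\<forall>\<^sub>F n in sequentially. 0 < ?t n"
    by (rule level_at_top[unfolded filterlim_at_top_dense, rule_format])
  then have "\<forall>\<^sub>F n in sequentially. M * (4 / m * (1 / (?t n)\<^sup>2) + 10 * (norm ((1 / ?t n ^ 3) *\<^sub>R \<Sum>(prims (?t n)))
      + (card (prims (?t n)) / (?t n)\<^sup>2 - real n / (?t n)\<^sup>2 + 4 * (1 / (?t n)\<^sup>2)) * (1 / m)) + 20 * (1 / ?t n ^ 3))
      + (card (prims (?t n)) / (?t n)\<^sup>2 - real n / (?t n)\<^sup>2) = excess n (?t n) / ?t n ^ 3"
  proof eventually_elim
    case (elim n)
    have "norm ((1 / ?t n ^ 3) *\<^sub>R \<Sum>(prims (?t n))) = norm (\<Sum>(prims (?t n))) / ?t n ^ 3" using elim by simp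
    then show ?case using elim m_pos
      by (simp add: excess_def divide_simps power2_eq_square power3_eq_cube)
  qed
  ultimately show ?thesis using tendsto_cong by fastforce
qed

text \<open>The shell width \<delta> is fixed before n grows: \<open>excess\<close> then disappears
  in the limit and only the shell count remains. The threshold for n depends neither on the edge set
  nor on \<theta>.\<close>

lemma minimal_edges_limit:
  assumes "0 < \<epsilon>"
  shows "\<forall>\<^sub>F n in sequentially. \<forall>E. minimal_edges n E \<longrightarrow>
    (\<forall>\<theta>. dist ((1 / real (level n) ^ 3) *\<^sub>R \<Sum>{e \<in> E. pang e \<le> \<theta>}) (J \<theta>) < \<epsilon>) \<and>
    (\<forall>e\<in>E. fst e = 0 \<longrightarrow> norm e / real (level n) ^ 3 < \<epsilon>)"
proof -
  let ?t = "\<lambda>n. real (level n)"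
  \<comment> \<open>The shell contributes (2 / m) ((1 + \<delta>)^2 - (1 - \<delta>)^2) \<beta> = 8
    \<beta> \<delta> / m in the limit, and this choice makes that at most \<epsilon> / 4.\<close>
  define \<delta> where "\<delta> = min (1 / 2) (\<epsilon> * m / (32 * \<beta>))"
  have \<delta>: "0 < \<delta>" "\<delta> < 1" using assms m_pos beta_pos by (auto simp: \<delta>_def)
  have "8 * \<beta> * \<delta> \<le> 8 * \<beta> * (\<epsilon> * m / (32 * \<beta>))" using beta_pos by (intro mult_left_mono) (auto simp: \<delta>_def)
  then have small: "8 * \<beta> * \<delta> / m < \<epsilon> / 2" 
  proof -
    have "8 * \<beta> * (\<epsilon> * m / (32 * \<beta>)) = \<epsilon> / 4 * m" using beta_pos by simp
    then have "8 * \<beta> * \<delta> / m \<le> \<epsilon> / 4" using \<open>8 * \<beta> * \<delta> \<le> _\<close> m_pos by (simp only: pos_divide_le_eq)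
    then show ?thesis using assms by linarith
  qed
  define h where "h n = (3 / (\<delta> * m)) * (excess n (?t n) / ?t n ^ 3)
      + (2 / m) * (card (prims ((1 + \<delta>) * ?t n)) / (?t n)\<^sup>2 - card (prims ((1 - \<delta>) * ?t n)) / (?t n)\<^sup>2)" for n
  have "h \<longlonglongrightarrow> (3 / (\<delta> * m)) * 0 + (2 / m) * ((1 + \<delta>)\<^sup>2 * \<beta> - (1 - \<delta>)\<^sup>2 * \<beta>)"
    unfolding h_def using \<delta> by (intro tendsto_intros excess_limit card_prims_scaled) auto
  also have "(3 / (\<delta> * m)) * 0 + (2 / m) * ((1 + \<delta>)\<^sup>2 * \<beta> - (1 - \<delta>)\<^sup>2 * \<beta>) = 8 * \<beta> * \<delta> / m"
    by (simp add: power2_eq_square algebra_simps)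
  finally have h: "\<forall>\<^sub>F n in sequentially. h n < \<epsilon> / 2" using order_tendstoD(2) small by blast
  have "\<forall>\<^sub>F t in at_top. \<forall>\<theta>\<in>UNIV. dist ((1 / t ^ 3) *\<^sub>R \<Sum>{z \<in> prims t. pang z \<le> \<theta>}) (J \<theta>) < \<epsilon> / 2"
    using uniform_limitD[OF sector_sum_limit, of "\<epsilon> / 2"] assms by simp
  then have s: "\<forall>\<^sub>F n in sequentially. \<forall>\<theta>\<in>UNIV. dist ((1 / ?t n ^ 3) *\<^sub>R \<Sum>{z \<in> prims (?t n). pang z \<le> \<theta>}) (J \<theta>) < \<epsilon> / 2"
    using level_at_top unfolding filterlim_iff by blast
  have pos: "\<forall>\<^sub>F n in sequentially. 0 < ?t n" by (rule level_at_top[unfolded filterlim_at_top_dense, rule_format])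
  have "((\<lambda>t::real. 1 / t ^ 3) \<longlongrightarrow> 0) at_top" by real_asymp
  then have i: "(\<lambda>n. 1 / ?t n ^ 3) \<longlonglongrightarrow> 0" using filterlim_compose level_at_top by blast
  have "(\<lambda>n. 1 / ?t n ^ 3 + excess n (?t n) / ?t n ^ 3 * (1 / m)) \<longlonglongrightarrow> 0 + 0 * (1 / m)"
    by (intro tendsto_intros i excess_limit)
  then have v: "\<forall>\<^sub>F n in sequentially. 1 / ?t n ^ 3 + excess n (?t n) / ?t n ^ 3 * (1 / m) < \<epsilon>"
    using order_tendstoD(2) assms by fastforce
  from h s pos v eventually_ge_at_top[of 4] show ?thesis
  proof eventually_elim
    case (elim n)
    show ?case
    proof (intro allI impI conjI ballI)
      fix E \<theta> assume E: "minimal_edges n E"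
      let ?S = "\<Sum>{e \<in> E. pang e \<le> \<theta>}" and ?B = "\<Sum>{z \<in> prims (?t n). pang z \<le> \<theta>}"
      have "dist ((1 / ?t n ^ 3) *\<^sub>R ?S) ((1 / ?t n ^ 3) *\<^sub>R ?B) = norm (?S - ?B) / ?t n ^ 3"
        using elim(3) by (simp add: dist_norm flip: scaleR_diff_right)
      also have "\<dots> \<le> ((3 / (\<delta> * m)) * excess n (?t n)
          + (2 * ?t n / m) * (real (card (prims ((1 + \<delta>) * ?t n))) - real (card (prims ((1 - \<delta>) * ?t n))))) / ?t n ^ 3"
        using elim(3) by (intro divide_right_mono minimal_edges_sector[OF E elim(5) card_prims_level elim(3) \<delta>]) auto
      also have "\<dots> = h n" using elim(3)
        by (simp add: h_def add_divide_distrib power3_eq_cube power2_eq_square diff_divide_distrib right_diff_distrib)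
      finally have "dist ((1 / ?t n ^ 3) *\<^sub>R ?S) ((1 / ?t n ^ 3) *\<^sub>R ?B) < \<epsilon> / 2" using elim(1) by linarith
      moreover have "dist ((1 / ?t n ^ 3) *\<^sub>R ?B) (J \<theta>) < \<epsilon> / 2" using elim(2) by blast
      ultimately show "dist ((1 / ?t n ^ 3) *\<^sub>R ?S) (J \<theta>) < \<epsilon>"
        using dist_triangle[of "(1 / ?t n ^ 3) *\<^sub>R ?S" "J \<theta>" "(1 / ?t n ^ 3) *\<^sub>R ?B"] by linarith
    next
      fix E e assume E: "minimal_edges n E" and e: "e \<in> E" "fst e = 0"
      have "norm e / ?t n ^ 3 \<le> (1 + excess n (?t n) / m) / ?t n ^ 3"
        using elim(3) by (intro divide_right_mono minimal_edges_vertical[OF E elim(5) card_prims_level elim(3) e]) auto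
      also have "\<dots> = 1 / ?t n ^ 3 + excess n (?t n) / ?t n ^ 3 * (1 / m)" by (simp add: add_divide_distrib)
      finally show "norm e / ?t n ^ 3 < \<epsilon>" using elim(4) by linarith
    qed
  qed
qed

text \<open>At a single large t the scaled finite sums are within 1 of \<open>J\<close>, uniformly
  in \<theta>, and they are bounded.\<close>

lemma J_bounded: obtains C where "0 \<le> C" "\<And>\<theta>. norm (J \<theta>) \<le> C"
proof -
  have "\<forall>\<^sub>F t in at_top. (\<forall>\<theta>\<in>UNIV. dist ((1 / t ^ 3) *\<^sub>R \<Sum>{z \<in> prims t. pang z \<le> \<theta>}) (J \<theta>) < 1) \<and> 0 < t"
    using uniform_limitD[OF sector_sum_limit, of 1] eventually_gt_at_top[of 0] by (auto intro: eventually_conj)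
  then obtain t where t: "\<And>\<theta>. dist ((1 / t ^ 3) *\<^sub>R \<Sum>{z \<in> prims t. pang z \<le> \<theta>}) (J \<theta>) < 1" "0 < t"
    using eventually_happens'[of "at_top :: real filter"] by fastforce
  have b: "norm (J \<theta>) \<le> 1 + (1 / t ^ 3) * (\<Sum>z\<in>prims t. norm z)" for \<theta>
  proof -
    let ?s = "(1 / t ^ 3) *\<^sub>R \<Sum>{z \<in> prims t. pang z \<le> \<theta>}"
    have "norm (\<Sum>{z \<in> prims t. pang z \<le> \<theta>}) \<le> (\<Sum>z\<in>{z \<in> prims t. pang z \<le> \<theta>}. norm z)" by (rule norm_sum)
    also have "\<dots> \<le> (\<Sum>z\<in>prims t. norm z)" using finite_prims by (intro sum_mono2) auto
    finally have "(1 / t ^ 3) * norm (\<Sum>{z \<in> prims t. pang z \<le> \<theta>}) \<le> (1 / t ^ 3) * (\<Sum>z\<in>prims t. norm z)"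
      using t(2) by (intro mult_left_mono) auto
    then have "norm ?s \<le> (1 / t ^ 3) * (\<Sum>z\<in>prims t. norm z)" using t(2) by simp
    moreover have "norm (J \<theta>) - norm ?s \<le> dist (J \<theta>) ?s" by (simp only: dist_norm norm_triangle_ineq2)
    moreover have "dist (J \<theta>) ?s < 1" using t(1)[of \<theta>] by (simp only: dist_commute)
    ultimately show ?thesis by linarith
  qed
  show ?thesis
    by (rule that[OF _ b]) (use t(2) in \<open>auto intro!: add_nonneg_nonneg divide_nonneg_nonneg sum_nonneg\<close>)
qed

text \<open>Only the normalisation changes: n^(-3/2) T^3 = (n / T^2)^(-3/2) tends to \<beta>^(-3/2)
  by \<open>n_over_level\<close>. Boundedness of \<open>J\<close> keeps the change uniform in
  \<theta>.\<close>

lemma scaled_edges_limit: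
  assumes "0 < \<epsilon>"
  shows "\<forall>\<^sub>F n in sequentially. \<forall>E. minimal_edges n E \<longrightarrow>
    (\<forall>\<theta>. dist ((real n powr (-3/2)) *\<^sub>R \<Sum>{e \<in> E. pang e \<le> \<theta>}) (\<beta> powr (-3/2) *\<^sub>R J \<theta>) < \<epsilon>) \<and>
    (\<forall>e\<in>E. fst e = 0 \<longrightarrow> real n powr (-3/2) * norm e < \<epsilon>)"
proof -
  let ?t = "\<lambda>n. real (level n)"
  define \<kappa> where "\<kappa> = \<beta> powr (-3/2)"
  have \<kappa>: "0 < \<kappa>" using beta_pos by (simp add: \<kappa>_def)
  obtain C where C: "0 \<le> C" "\<And>\<theta>. norm (J \<theta>) \<le> C" using J_bounded by blast
  define r where "r n = (real n / (?t n)\<^sup>2) powr (-3/2)" for n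
  have "r \<longlonglongrightarrow> \<kappa>"
    unfolding r_def \<kappa>_def using beta_pos by (intro tendsto_powr n_over_level tendsto_const) auto
  then have "(\<lambda>n. \<bar>r n - \<kappa>\<bar>) \<longlonglongrightarrow> \<bar>\<kappa> - \<kappa>\<bar>" by (intro tendsto_intros)
  then have lim0: "(\<lambda>n. \<bar>r n - \<kappa>\<bar>) \<longlonglongrightarrow> 0" by simp
  have "0 < min 1 (\<epsilon> / (2 * (C + 1)))" using assms C by simp
  then have r: "\<forall>\<^sub>F n in sequentially. \<bar>r n - \<kappa>\<bar> < min 1 (\<epsilon> / (2 * (C + 1)))" 
    using order_tendstoD(2)[OF lim0] by blast
  define e where "e = \<epsilon> / (2 * (\<kappa> + 1))"
  have e: "0 < e" "(\<kappa> + 1) * e = \<epsilon> / 2" using assms \<kappa> by (simp_all add: e_def divide_simps)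
  have pos: "\<forall>\<^sub>F n in sequentially. 0 < ?t n" by (rule level_at_top[unfolded filterlim_at_top_dense, rule_format])
  from r minimal_edges_limit[OF e(1)] pos eventually_gt_at_top[of 0] show ?thesis
  proof eventually_elim
    case (elim n)
    have r_eq: "r n = real n powr (-3/2) * ?t n ^ 3"
    proof -
      have "((?t n)\<^sup>2) powr (-3/2) = ?t n powr (-3)"
        using elim(3) by (simp add: powr_powr flip: powr_numeral)
      also have "\<dots> = 1 / ?t n ^ 3" using elim(3) by (simp add: powr_minus_divide flip: powr_numeral)
      finally show ?thesis using elim by (simp add: r_def powr_divide)
    qed
    have r_bd: "0 \<le> r n" "r n \<le> \<kappa> + 1" using elim(1) using elim(1) by (simp add: r_def, linarith)
    have factor: "real n powr (-3/2) = r n * (1 / ?t n ^ 3)" using elim(3) by (simp add: r_eq)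
    show ?case
    proof (intro allI impI conjI ballI)
      fix E \<theta> assume E: "minimal_edges n E"
      let ?x = "(1 / ?t n ^ 3) *\<^sub>R \<Sum>{e \<in> E. pang e \<le> \<theta>}"
      have "dist ?x (J \<theta>) < e" using elim(2) E by blast
      then have 1: "r n * norm (?x - J \<theta>) \<le> (\<kappa> + 1) * e"
        using r_bd \<kappa> by (intro mult_mono) (auto simp: dist_norm)
      have "\<bar>r n - \<kappa>\<bar> * norm (J \<theta>) \<le> \<epsilon> / (2 * (C + 1)) * C"
        using elim(1) C assms by (intro mult_mono) auto
      also have "\<dots> < \<epsilon> / 2" using C assms by (simp add: field_simps)
      finally have 2: "\<bar>r n - \<kappa>\<bar> * norm (J \<theta>) < \<epsilon> / 2" .
      have "(real n powr (-3/2)) *\<^sub>R \<Sum>{e \<in> E. pang e \<le> \<theta>} - \<kappa> *\<^sub>R J \<theta> = r n *\<^sub>R (?x - J \<theta>) + (r n - \<kappa>) *\<^sub>R J \<theta>"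
        unfolding factor by (simp add: algebra_simps)
      then have "dist ((real n powr (-3/2)) *\<^sub>R \<Sum>{e \<in> E. pang e \<le> \<theta>}) (\<kappa> *\<^sub>R J \<theta>) \<le> r n * norm (?x - J \<theta>) + \<bar>r n - \<kappa>\<bar> * norm (J \<theta>)"
        unfolding dist_norm using norm_triangle_ineq[of "r n *\<^sub>R (?x - J \<theta>)" "(r n - \<kappa>) *\<^sub>R J \<theta>"] r_bd by simp
      also have "\<dots> < \<epsilon>" using 1 2 e(2) by linarith
      finally show "dist ((real n powr (-3/2)) *\<^sub>R \<Sum>{e \<in> E. pang e \<le> \<theta>}) (\<beta> powr (-3/2) *\<^sub>R J \<theta>) < \<epsilon>"
        by (simp add: \<kappa>_def)
    next
      fix E x assume E: "minimal_edges n E" and x: "x \<in> E" "fst x = 0"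
      have "norm x / ?t n ^ 3 < e" using elim(2) E x by blast
      then have "r n * (norm x / ?t n ^ 3) \<le> (\<kappa> + 1) * e" using r_bd \<kappa> e elim(3) by (intro mult_mono) auto
      also have "\<dots> < \<epsilon>" using e(2) assms by linarith
      finally show "real n powr (-3/2) * norm x < \<epsilon>" unfolding factor by simp
    qed
  qed
qed

end

section \<open>The limit shape\<close>

text \<open>An inscribed ball of radius \<rho> and an enclosing ball of radius R give the constants
  1 / R and 1 / \<rho>. The infimum is handled through scales approximating it, so its attainment is
  never invoked.\<close>

lemma norm_wrt_gauge:
  assumes "convex D" "compact D" "0 \<in> interior D"
  obtains m M where "gauge (norm_wrt D) m M"
proof -
  obtain \<rho> where \<rho>: "0 < \<rho>" "cball 0 \<rho> \<subseteq> D" using assms(3) mem_interior_cball by blast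
  obtain R where R: "0 < R" "\<And>x. x \<in> D \<Longrightarrow> norm x \<le> R"
    using compact_imp_bounded[OF assms(2)] bounded_pos by blast
  define S where "S x = {t. 0 \<le> t \<and> x \<in> (\<lambda>d. t *\<^sub>R d) ` D}" for x
  have nu: "norm_wrt D x = Inf (S x)" for x by (simp add: norm_wrt_def S_def)
  have SI: "t \<in> S x" if "0 \<le> t" "d \<in> D" "x = t *\<^sub>R d" for t d x
    using that unfolding S_def by blast
  have bdd: "bdd_below (S x)" for x by (rule bdd_belowI[of _ 0]) (auto simp: S_def)
  have le: "norm_wrt D x \<le> t" if "t \<in> S x" for x t unfolding nu using bdd that by (intro cInf_lower)
  have mem: "norm x / \<rho> \<in> S x" for x
  proof (cases "x = 0")
    case True
    have "0 \<in> D" using \<rho> by auto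
    then show ?thesis using True by (intro SI[of _ 0]) auto
  next
    case False
    have "(\<rho> / norm x) *\<^sub>R x \<in> D" using \<rho> False by (intro subsetD[OF \<rho>(2)]) simp
    moreover have "x = (norm x / \<rho>) *\<^sub>R ((\<rho> / norm x) *\<^sub>R x)" using \<rho> False by simp
    ultimately show ?thesis using \<rho> by (intro SI[of _ "(\<rho> / norm x) *\<^sub>R x"]) auto
  qed
  have ne: "S x \<noteq> {}" for x using mem by blast
  have close: "\<exists>t\<in>S x. t < norm_wrt D x + e" if "0 < e" for x e
    using cInf_lessD[OF ne, of x "norm_wrt D x + e"] that by (auto simp: nu)
  have sc: "norm_wrt D (c *\<^sub>R x) \<le> c * norm_wrt D x" if c: "0 < c" for c x
  proof (rule field_le_epsilon)
    fix e :: real assume "0 < e"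
    then obtain t where t: "t \<in> S x" "t < norm_wrt D x + e / c" using close[of "e / c" x] c by auto
    obtain d where "0 \<le> t" "d \<in> D" "x = t *\<^sub>R d" using t(1) by (auto simp: S_def)
    then have "c * t \<in> S (c *\<^sub>R x)" using c by (intro SI[of _ d]) auto
    then have "norm_wrt D (c *\<^sub>R x) \<le> c * t" by (rule le)
    also have "\<dots> \<le> c * (norm_wrt D x + e / c)" using t(2) c by (intro mult_left_mono) auto
    also have "\<dots> = c * norm_wrt D x + e" using c by (simp add: distrib_left)
    finally show "norm_wrt D (c *\<^sub>R x) \<le> c * norm_wrt D x + e" .
  qed
  have lower: "1 / R * norm x \<le> norm_wrt D x" for x
    unfolding nu
  proof (rule cInf_greatest[OF ne])
    fix t assume "t \<in> S x"
    then obtain d where d: "0 \<le> t" "x = t *\<^sub>R d" "d \<in> D" by (auto simp: S_def)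
    have "norm x \<le> t * R" using d R(2)[OF d(3)] by (simp add: mult_left_mono)
    then show "1 / R * norm x \<le> t" using R(1) by (simp add: field_simps)
  qed
  have upper: "norm_wrt D x \<le> 1 / \<rho> * norm x" for x using le[OF mem[of x]] by simp
  have "gauge (norm_wrt D) (1 / R) (1 / \<rho>)"
  proof
    show "norm_wrt D (x + y) \<le> norm_wrt D x + norm_wrt D y" for x y
    proof (rule field_le_epsilon)
      fix e :: real assume "0 < e"
      then obtain s t where st: "s \<in> S x" "s < norm_wrt D x + e / 2" "t \<in> S y" "t < norm_wrt D y + e / 2"
        using close[of "e / 2" x] close[of "e / 2" y] by auto
      obtain a b where ab: "a \<in> D" "x = s *\<^sub>R a" "b \<in> D" "y = t *\<^sub>R b" "0 \<le> s" "0 \<le> t"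
        using st by (auto simp: S_def)
      have "s + t \<in> S (x + y)"
      proof (cases "s + t = 0")
        case True
        then have "s = 0" "t = 0" using ab by auto
        then show ?thesis using ab by (intro SI[of _ a]) auto
      next
        case False
        then have pos: "0 < s + t" using ab by simp
        then have "(s / (s + t)) *\<^sub>R a + (t / (s + t)) *\<^sub>R b \<in> D"
          using ab by (intro convexD[OF assms(1)]) (auto simp flip: add_divide_distrib)
        moreover have "x + y = (s + t) *\<^sub>R ((s / (s + t)) *\<^sub>R a + (t / (s + t)) *\<^sub>R b)"
          using ab pos by (simp add: scaleR_add_right)
        ultimately show ?thesis using pos by (intro SI) auto
      qed
      then have "norm_wrt D (x + y) \<le> s + t" by (rule le)
      then show "norm_wrt D (x + y) \<le> norm_wrt D x + norm_wrt D y + e" using st by linarith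
    qed
    show "norm_wrt D (c *\<^sub>R x) = c * norm_wrt D x" if "0 \<le> c" for c x
    proof (cases "c = 0")
      case True
      then show ?thesis using lower[of 0] upper[of 0] by simp
    next
      case False
      then have c: "0 < c" using that by simp
      have "norm_wrt D ((1 / c) *\<^sub>R (c *\<^sub>R x)) \<le> 1 / c * norm_wrt D (c *\<^sub>R x)" using c by (intro sc) simp
      then have "c * norm_wrt D x \<le> norm_wrt D (c *\<^sub>R x)" using c by (simp add: field_simps)
      then show ?thesis using sc[OF c, of x] by linarith
    qed
  qed (use R lower upper in auto)
  then show ?thesis by (rule that)
qed

text \<open>The points within \<epsilon> of some point of a convex set form a convex set, so
  closeness of generators passes to hulls.\<close>

lemma convex_hull_range_close:
  fixes x y :: "'i \<Rightarrow> 'a::real_normed_vector"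
  assumes "\<And>i. dist (x i) (y i) \<le> \<epsilon>" "a \<in> convex hull (range x)"
  shows "\<exists>b\<in>convex hull (range y). dist a b \<le> \<epsilon>"
proof -
  define U where "U = {a. \<exists>b\<in>convex hull (range y). dist a b \<le> \<epsilon>}"
  have "convex U"
  proof (rule convexI)
    fix p q and s t :: real assume *: "p \<in> U" "q \<in> U" "0 \<le> s" "0 \<le> t" "s + t = 1"
    then obtain b c where bc: "b \<in> convex hull (range y)" "dist p b \<le> \<epsilon>" "c \<in> convex hull (range y)" "dist q c \<le> \<epsilon>"
      by (auto simp: U_def)
    have "s *\<^sub>R b + t *\<^sub>R c \<in> convex hull (range y)"
      using bc * by (intro convexD[OF convex_convex_hull])
    moreover have "dist (s *\<^sub>R p + t *\<^sub>R q) (s *\<^sub>R b + t *\<^sub>R c) \<le> \<epsilon>"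
    proof -
      have "(s *\<^sub>R p + t *\<^sub>R q) - (s *\<^sub>R b + t *\<^sub>R c) = s *\<^sub>R (p - b) + t *\<^sub>R (q - c)" by (simp add: algebra_simps)
      then have "dist (s *\<^sub>R p + t *\<^sub>R q) (s *\<^sub>R b + t *\<^sub>R c) \<le> s * dist p b + t * dist q c"
        unfolding dist_norm using norm_triangle_ineq[of "s *\<^sub>R (p - b)" "t *\<^sub>R (q - c)"] * by simp
      also have "\<dots> \<le> s * \<epsilon> + t * \<epsilon>" using * bc by (intro add_mono mult_left_mono)
      also have "\<dots> = \<epsilon>" using * by (simp flip: distrib_right)
      finally show ?thesis .
    qed
    ultimately show "s *\<^sub>R p + t *\<^sub>R q \<in> U" by (auto simp: U_def)
  qed
  moreover have "range x \<subseteq> U" using assms(1) hull_inc[of _ "range y" convex] by (fastforce simp: U_def)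
  ultimately have "convex hull (range x) \<subseteq> U" by (intro hull_minimal)
  then show ?thesis using assms(2) by (auto simp: U_def)
qed

lemma hausdorff_dist_le:
  assumes "\<And>a. a \<in> A \<Longrightarrow> \<exists>b\<in>B. dist a b \<le> e" "\<And>b. b \<in> B \<Longrightarrow> \<exists>a\<in>A. dist a b \<le> e"
  shows "hausdorff_dist A B \<le> ennreal e"
  unfolding hausdorff_dist_def
proof (intro max.boundedI SUP_least)
  fix a assume "a \<in> A"
  then obtain b where "b \<in> B" "dist a b \<le> e" using assms(1) by blast
  then show "(INF b\<in>B. ennreal (dist a b)) \<le> ennreal e" by (intro INF_lower2 ennreal_leI)
next
  fix b assume "b \<in> B"
  then obtain a where "a \<in> A" "dist a b \<le> e" using assms(2) by blast
  then show "(INF a\<in>A. ennreal (dist a b)) \<le> ennreal e" by (intro INF_lower2 ennreal_leI)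
qed

section \<open>The leftmost vertex\<close>

lemma norm_sum_same_pang:
  assumes "inj_on pang F" "\<And>e. e \<in> F \<Longrightarrow> pang e = p" "\<And>e. e \<in> F \<Longrightarrow> norm e \<le> r" "0 \<le> r"
  shows "norm (\<Sum>F) \<le> r"
proof (cases "F = {}")
  case False
  then obtain e where "e \<in> F" by blast
  then have "F = {e}" using assms(1,2) inj_onD[OF assms(1)] by blast
  then show ?thesis using assms(3) by simp
qed (use assms in simp)

text \<open>Up to \<open>pang\<close> 1 all summands point weakly to the right; beyond it the
  missing edges point weakly to the left, and the total is zero. If the first coordinate vanishes,
  every edge in the sum concerned is vertical with the same direction, and distinct directions leave
  at most one.\<close>

lemma edge_set_partial_sum:
  assumes E: "edge_set E" and r: "0 \<le> r" "\<And>e. e \<in> E \<Longrightarrow> fst e = 0 \<Longrightarrow> norm e \<le> r"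
  defines "C \<equiv> \<lambda>\<theta>. \<Sum>{e \<in> E. pang e \<le> \<theta>}"
  shows "0 \<le> fst (C \<theta>)" "fst (C \<theta>) = 0 \<Longrightarrow> norm (C \<theta>) \<le> r"
proof -
  have E: "finite E" "0 \<notin> E" "inj_on pang E" "\<Sum>E = 0" using E by (auto simp: edge_set_def)
  have "0 \<le> fst (C \<theta>) \<and> (fst (C \<theta>) = 0 \<longrightarrow> norm (C \<theta>) \<le> r)"
  proof (cases "\<theta> \<le> 1")
    case True
    let ?F = "{e \<in> E. pang e \<le> \<theta>}"
    have F: "finite ?F" "inj_on pang ?F" using E by (auto intro: inj_on_subset)
    have lex: "lexpos e" if "e \<in> ?F" for e using that True by (simp add: lexpos_iff_pang)
    have nn: "0 \<le> fst e" if "e \<in> ?F" for e using lex[OF that] by (auto simp: lexpos_def)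
    have eq: "fst (C \<theta>) = (\<Sum>e\<in>?F. fst e)" by (simp add: C_def fst_sum)
    have "norm (C \<theta>) \<le> r" if z: "fst (C \<theta>) = 0"
      unfolding C_def
    proof (rule norm_sum_same_pang[OF F(2), of 1])
      have "(\<Sum>e\<in>?F. fst e) = 0" using z eq by (simp only:)
      then have "\<forall>e\<in>?F. fst e = 0" by (subst (asm) sum_nonneg_eq_0_iff[OF F(1) nn])
      then have f0: "fst e = 0" if "e \<in> ?F" for e using that by (metis neg_equal_0_iff_equal)
      show "pang e = 1" if "e \<in> ?F" for e using lex[OF that] f0[OF that] by (auto simp: pang_def lexpos_def)
      show "norm e \<le> r" if "e \<in> ?F" for e using r(2) f0[OF that] that by simp
    qed (rule r)
    moreover have "0 \<le> fst (C \<theta>)" unfolding eq using nn by (rule sum_nonneg)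
    ultimately show ?thesis by blast
  next
    case False
    let ?F = "{e \<in> E. \<theta> < pang e}"
    have F: "finite ?F" "inj_on pang ?F" using E by (auto intro: inj_on_subset)
    have C: "C \<theta> = - \<Sum>?F"
    proof -
      have "\<Sum>E = \<Sum>({e \<in> E. pang e \<le> \<theta>} \<union> ?F)" by (rule arg_cong[where f = "\<lambda>S. \<Sum>S"]) auto
      also have "\<dots> = C \<theta> + \<Sum>?F" unfolding C_def using E(1) by (intro sum.union_disjoint) auto
      finally show ?thesis using E(4) by (simp add: add_eq_0_iff2)
    qed
    have lex: "\<not> lexpos e" "e \<noteq> 0" if "e \<in> ?F" for e using that False E by (auto simp: lexpos_iff_pang)
    have nn: "0 \<le> - fst e" if "e \<in> ?F" for e using lex(1)[OF that] by (auto simp: lexpos_def not_less)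
    have eq: "fst (C \<theta>) = (\<Sum>e\<in>?F. - fst e)" by (simp add: C fst_sum sum_negf)
    have "norm (\<Sum>?F) \<le> r" if z: "fst (C \<theta>) = 0"
    proof (rule norm_sum_same_pang[OF F(2), of 3])
      have "(\<Sum>e\<in>?F. - fst e) = 0" using z eq by (simp only:)
      then have "\<forall>e\<in>?F. - fst e = 0" by (subst (asm) sum_nonneg_eq_0_iff[OF F(1) nn])
      then have f0: "fst e = 0" if "e \<in> ?F" for e using that by (metis neg_equal_0_iff_equal)
      show "pang e = 3" if "e \<in> ?F" for e
      proof -
        have "snd e < 0" using lex[OF that] f0[OF that] by (cases e) (auto simp: lexpos_def zero_prod_def)
        then show ?thesis using lex(1)[OF that] f0[OF that] by (simp add: pang_def)
      qed
      show "norm e \<le> r" if "e \<in> ?F" for e using r(2) f0[OF that] that by simp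
    qed (rule r)
    moreover have "0 \<le> fst (C \<theta>)" unfolding eq using nn by (rule sum_nonneg)
    ultimately show ?thesis by (simp add: C)
  qed
  then show "0 \<le> fst (C \<theta>)" "fst (C \<theta>) = 0 \<Longrightarrow> norm (C \<theta>) \<le> r" by auto
qed

text \<open>The leftmost point may lie anywhere on a vertical left edge, so it agrees with the vertex \<open>q\<close> at which
  the partial sums start only up to the length of that edge.\<close>

lemma leftmost_translate_bound:
  assumes E: "edge_set E" and r: "0 \<le> r" "\<And>e. e \<in> E \<Longrightarrow> fst e = 0 \<Longrightarrow> norm e \<le> r"
    and Q: "Q = (\<lambda>x. q + x) ` (convex hull (range (\<lambda>\<theta>. \<Sum>{e \<in> E. pang e \<le> \<theta>})))"
    and min: "is_arg_min fst (\<lambda>p. p \<in> Q) 0"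
  shows "norm q \<le> r"
proof -
  define C where "C \<theta> = \<Sum>{e \<in> E. pang e \<le> \<theta>}" for \<theta>
  note C = edge_set_partial_sum[OF E r, folded C_def]
  let ?H = "convex hull (range C)"
  have Q: "Q = (\<lambda>x. q + x) ` ?H" using Q by (simp add: C_def)
  have "range C \<subseteq> {x. (1, 0) \<bullet> x \<ge> 0}" using C(1) by (auto simp: inner_prod_def)
  then have "?H \<subseteq> {x. (1, 0) \<bullet> x \<ge> 0}" by (intro hull_minimal convex_halfspace_ge)
  then have H: "0 \<le> (1, 0) \<bullet> x" if "x \<in> ?H" for x using that by blast
  have m: "0 \<in> Q" "\<And>y. y \<in> Q \<Longrightarrow> 0 \<le> fst y" using min by (auto simp: is_arg_min_def not_less)
  have qH: "- q \<in> ?H" using m(1) Q by (auto simp: image_iff add_eq_0_iff)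
  \<comment> \<open>The empty partial sum puts \<open>q\<close> itself into \<open>Q\<close>, so
    \<open>fst q\<close> is nonnegative; since \<open>- q\<close> lies in the hull, it is also
    nonpositive.\<close>
  have "{e \<in> E. pang e \<le> - 1} = {}" using pang_bounds(1) by (auto simp: not_le)
  then have "C (- 1) = 0" unfolding C_def by (simp only: sum.empty)
  then have "0 \<in> ?H" by (metis hull_inc rangeI)
  then have "q \<in> Q" using Q by force
  then have "0 \<le> fst q" using m(2) by blast
  then have q0: "(1, 0) \<bullet> (- q) = 0" using H[OF qH] by (simp add: inner_prod_def)
  have "range C \<subseteq> sum (\<lambda>x. x) ` Pow E" by (auto simp: C_def)
  moreover have "finite E" using E by (simp add: edge_set_def)
  ultimately have "finite (range C)" by (meson finite_Pow_iff finite_imageI finite_subset)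
  then have "compact (range C)" by (rule finite_imp_compact)
  \<comment> \<open>The vertical left side is a face, hence the hull of those partial sums that lie
    on the axis, and these have norm at most r.\<close>
  moreover have "(?H \<inter> {x. (1, 0) \<bullet> x = 0}) face_of ?H"
    using H by (intro face_of_Int_supporting_hyperplane_ge) auto
  ultimately obtain S where S: "S \<subseteq> range C" "?H \<inter> {x. (1, 0) \<bullet> x = 0} = convex hull S"
    by (rule face_of_convex_hull_subset)
  have "S \<subseteq> cball 0 r"
  proof
    fix x assume x: "x \<in> S"
    then have "x \<in> convex hull S" by (rule hull_inc)
    then have "fst x = 0" using S(2) by (auto simp: inner_prod_def)
    then show "x \<in> cball 0 r" using S(1) x C(2) by auto
  qed
  then have "convex hull S \<subseteq> cball 0 r" by (intro hull_minimal) auto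
  moreover have "- q \<in> convex hull S" using qH q0 S(2) by blast
  ultimately show ?thesis by auto
qed

text \<open>The limit is the hull of the rescaled curve \<open>J\<close> for the centred tilt of the
  norm. Uniform closeness of the partial sums to that curve passes to the hulls, and the translation
  error is at most a rescaled vertical edge.\<close>

theorem theorem2p3:
  fixes D :: "(real \<times> real) set"
  assumes "convex D" and "compact D" and "0 \<in> interior D"
  shows "\<exists>P :: (real \<times> real) set. convex P \<and>
    (\<forall>(M :: nat \<Rightarrow> (real \<times> real) set) (t :: nat \<Rightarrow> real \<times> real) (Q :: nat \<Rightarrow> (real \<times> real) set).
       (\<forall>n\<ge>3. minimizer n D (M n) \<and> Q n = (\<lambda>x. t n + x) ` M n \<and>
              is_arg_min fst (\<lambda>p. p \<in> Q n) 0) \<longrightarrow>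
       (\<lambda>n. hausdorff_dist ((\<lambda>x. (real n powr (-3/2)) *\<^sub>R x) ` Q n) P) \<longlonglongrightarrow> 0)"
proof -
  obtain m K where "gauge (norm_wrt D) m K" using norm_wrt_gauge[OF assms] by blast
  then interpret N: gauge "norm_wrt D" m K .
  obtain r u where ru: "0 < r" "u \<in> N.tilts r"
    "\<And>v. (\<integral>z. (if norm_wrt D z - u \<bullet> z \<le> 1 then v \<bullet> z else 0) \<partial>lborel) = 0"
    by (rule N.exists_centred_tilt) blast
  let ?g = "\<lambda>z. norm_wrt D z - u \<bullet> z"
  interpret G: gauge ?g r "K + norm u" by (rule N.gauge_tilt[OF ru(1,2)])
  interpret G: centred_gauge ?g r "K + norm u"
    by unfold_locales (rule G.J_3, rule ru(3))
  \<comment> \<open>The functional vanishes on the sum of the edges, so minimality for the norm and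
    for its tilt coincide.\<close>
  have sum_g: "(\<Sum>e\<in>E. ?g e) = (\<Sum>e\<in>E. norm_wrt D e)" if "edge_set E" for E
    using that by (simp add: edge_set_def sum_subtractf flip: inner_sum_right)
  define y where "y \<theta> = G.\<beta> powr (-3/2) *\<^sub>R G.J \<theta>" for \<theta>
  define P where "P = convex hull (range y)"
  have main: "\<forall>\<^sub>F n in sequentially. hausdorff_dist ((\<lambda>x. (real n powr (-3/2)) *\<^sub>R x) ` Q n) P \<le> ennreal \<epsilon>"
    if *: "\<And>n. 3 \<le> n \<Longrightarrow> minimizer n D (M n) \<and> Q n = (\<lambda>x. t n + x) ` M n \<and> is_arg_min fst (\<lambda>p. p \<in> Q n) 0"
      and "0 < \<epsilon>" for M t Q \<epsilon>
  proof -
    have "0 < \<epsilon> / 2" using \<open>0 < \<epsilon>\<close> by simp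
    from G.scaled_edges_limit[OF this] eventually_ge_at_top[of 3] show ?thesis
    proof eventually_elim
      case (elim n)
      define \<kappa> where "\<kappa> = real n powr (-3/2)"
      have \<kappa>: "0 < \<kappa>" using elim(2) by (simp add: \<kappa>_def)
      have min: "M n \<in> lattice_polygons n" "perimeter D (M n) = min_perimeter n D"
        using *[OF elim(2)] by (auto simp: minimizer_def)
      obtain w E where E: "edge_set E" "card E = n" "perimeter D (M n) = (\<Sum>e\<in>E. norm_wrt D e)"
        "vertices (M n) = range (\<lambda>\<theta>. w + \<Sum>{e \<in> E. pang e \<le> \<theta>})"
        by (rule polygon_edges[OF min(1) elim(2)])
      \<comment> \<open>Every competing edge set bounds an actual polygon, so minimality among
        polygons becomes minimality among edge sets.\<close>
      have "(\<Sum>e\<in>E. ?g e) \<le> (\<Sum>e\<in>E'. ?g e)" if E': "edge_set E'" "card E' = n" for E'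
      proof -
        obtain P' where P': "P' \<in> lattice_polygons n" "perimeter D P' = (\<Sum>e\<in>E'. norm_wrt D e)"
          by (rule edges_polygon[OF E' elim(2)])
        have "0 \<le> perimeter D X" for X
          unfolding perimeter_def Let_def using N.g_nonneg by (intro sum_nonneg)
        then have "bdd_below (perimeter D ` lattice_polygons n)" by (intro bdd_belowI[of _ 0]) auto
        then have "min_perimeter n D \<le> perimeter D P'"
          unfolding min_perimeter_def using P'(1) by (intro cInf_lower) auto
        then show ?thesis using min(2) E(3) P'(2) sum_g[OF E(1)] sum_g[OF E'(1)] by simp
      qed
      then have "G.minimal_edges n E" using E by (simp add: G.minimal_edges_def)
      then have lim: "\<And>\<theta>. dist (\<kappa> *\<^sub>R \<Sum>{e \<in> E. pang e \<le> \<theta>}) (y \<theta>) < \<epsilon> / 2"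
        "\<And>e. e \<in> E \<Longrightarrow> fst e = 0 \<Longrightarrow> \<kappa> * norm e < \<epsilon> / 2"
        using elim(1) by (auto simp: \<kappa>_def y_def)
      define C where "C \<theta> = \<Sum>{e \<in> E. pang e \<le> \<theta>}" for \<theta>
      define q where "q = t n + w"
      have "M n = convex hull (vertices (M n))"
        using min(1) vertices_polytope(2) by (auto simp: lattice_polygons_def)
      also have "vertices (M n) = (\<lambda>x. w + x) ` range C" unfolding E(4) by (auto simp: C_def)
      finally have "M n = (\<lambda>x. w + x) ` (convex hull (range C))" by (simp only: convex_hull_translation)
      then have Q: "Q n = (\<lambda>x. q + x) ` (convex hull (range C))"
        using *[OF elim(2)] by (simp add: q_def image_image add.assoc)
      have "norm q \<le> \<epsilon> / 2 / \<kappa>"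
      proof (rule leftmost_translate_bound[OF E(1) _ _ Q[unfolded C_def]])
        show "norm e \<le> \<epsilon> / 2 / \<kappa>" if "e \<in> E" "fst e = 0" for e
          using lim(2)[OF that] \<kappa> by (simp add: field_simps)
      qed (use *[OF elim(2)] \<open>0 < \<epsilon>\<close> \<kappa> in auto)
      then have q: "\<kappa> * norm q \<le> \<epsilon> / 2" using \<kappa> by (simp add: field_simps)
      have hull: "convex hull (range (\<lambda>\<theta>. \<kappa> *\<^sub>R C \<theta>)) = (\<lambda>x. \<kappa> *\<^sub>R x) ` (convex hull (range C))"
        using convex_hull_scaling[of \<kappa> "range C"] by (simp add: image_image)
      have near: "dist (\<kappa> *\<^sub>R (q + h)) b \<le> \<epsilon>" if "dist (\<kappa> *\<^sub>R h) b \<le> \<epsilon> / 2" for h b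
      proof -
        have "dist (\<kappa> *\<^sub>R (q + h)) (\<kappa> *\<^sub>R h) = \<kappa> * norm q" using \<kappa> by (simp add: dist_norm scaleR_add_right)
        then show ?thesis using dist_triangle[of "\<kappa> *\<^sub>R (q + h)" b "\<kappa> *\<^sub>R h"] q that by linarith
      qed
      show ?case
      proof (rule hausdorff_dist_le, unfold \<kappa>_def[symmetric])
        fix a assume "a \<in> (\<lambda>x. \<kappa> *\<^sub>R x) ` Q n"
        then obtain h where h: "h \<in> convex hull (range C)" "a = \<kappa> *\<^sub>R (q + h)" unfolding Q by blast
        have "\<kappa> *\<^sub>R h \<in> convex hull (range (\<lambda>\<theta>. \<kappa> *\<^sub>R C \<theta>))" unfolding hull using h by blast
        from convex_hull_range_close[OF less_imp_le[OF lim(1), folded C_def] this]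
        obtain b where "b \<in> P" "dist (\<kappa> *\<^sub>R h) b \<le> \<epsilon> / 2" unfolding P_def by blast
        then show "\<exists>b\<in>P. dist a b \<le> \<epsilon>" using near h(2) by blast
      next
        fix b assume "b \<in> P"
        then have "b \<in> convex hull (range y)" by (simp add: P_def)
        have "dist (y \<theta>) (\<kappa> *\<^sub>R C \<theta>) \<le> \<epsilon> / 2" for \<theta>
          using lim(1)[of \<theta>] by (simp add: C_def dist_commute)
        from convex_hull_range_close[OF this \<open>b \<in> convex hull (range y)\<close>]
        obtain c where c: "c \<in> convex hull (range (\<lambda>\<theta>. \<kappa> *\<^sub>R C \<theta>))" "dist b c \<le> \<epsilon> / 2" by blast
        then obtain h where h: "h \<in> convex hull (range C)" "c = \<kappa> *\<^sub>R h" unfolding hull by blast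
        have "dist (\<kappa> *\<^sub>R (q + h)) b \<le> \<epsilon>" using c(2) h(2) by (intro near) (simp add: dist_commute)
        then show "\<exists>a\<in>(\<lambda>x. \<kappa> *\<^sub>R x) ` Q n. dist a b \<le> \<epsilon>" unfolding Q using h(1) by blast
      qed
    qed
  qed
  show ?thesis
  proof (intro exI[of _ P] conjI allI impI)
    show "convex P" by (simp add: P_def)
    fix M :: "nat \<Rightarrow> (real \<times> real) set" and t Q
    assume *: "\<forall>n\<ge>3. minimizer n D (M n) \<and> Q n = (\<lambda>x. t n + x) ` M n \<and> is_arg_min fst (\<lambda>p. p \<in> Q n) 0"
    show "(\<lambda>n. hausdorff_dist ((\<lambda>x. (real n powr (-3/2)) *\<^sub>R x) ` Q n) P) \<longlonglongrightarrow> 0"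
    proof (rule order_tendstoI)
      fix a :: ennreal assume "0 < a"
      then obtain \<epsilon> where \<epsilon>: "0 < \<epsilon>" "ennreal \<epsilon> < a"
      proof (cases a)
        case (real c)
        then have "0 < c / 2" "ennreal (c / 2) < a" using \<open>0 < a\<close> by (auto simp: ennreal_less_iff)
        then show ?thesis by (rule that)
      next
        case top
        then show ?thesis using that[of 1] by simp
      qed
      have "\<forall>\<^sub>F n in sequentially. hausdorff_dist ((\<lambda>x. (real n powr (-3/2)) *\<^sub>R x) ` Q n) P \<le> ennreal \<epsilon>"
        by (rule main[OF _ \<epsilon>(1)]) (use * in blast)
      then show "\<forall>\<^sub>F n in sequentially. hausdorff_dist ((\<lambda>x. (real n powr (-3/2)) *\<^sub>R x) ` Q n) P < a"
        by eventually_elim (rule le_less_trans[OF _ \<epsilon>(2)])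
    qed simp
  qed
qed

end
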